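(* For every integer $N\ge 2$, the protocol $P_{RL}$ (with parameter $N$, defined in the context) is a self-stabilizing leader election protocol on every directed ring of any size $n$ with $2\le n\le N$. Its expected convergence time is $O(nN)$ and its number of states is $O(N)$, where the constants hidden in $O(\cdot)$ do not depend on $n$ or $N$.
   Context: Model. A population is a directed ring of $n\ge 2$ anonymous agents $u_0,\dots,u_{n-1}$ (indices modulo $n$) with arc set $E=\{e_i=(u_i,u_{i+1}) : 0\le i\le n-1\}$. A protocol has a finite state set $Q$, a transition function $T:Q\times Q\to Q\times Q$ and an output function. A configuration is a map $C:V\to Q$. For an arc $e_i$, $C\xrightarrow{e_i}C'$ means $(C'(u_i),C'(u_{i+1}))=T(C(u_i),C(u_{i+1}))$ ($u_i$ is the initiator, $u_{i+1}$ the responder) and $C'(v)=C(v)$ for all other $v$; $C\to C'$ means $C\xrightarrow{e}C'$ for some $e\in E$. A configuration is reachable from $C$ if it is obtained from $C$ by finitely many such steps. The uniformly random scheduler chooses at each step $t=0,1,2,\dots$ an arc $\Gamma_t\in E$ uniformly at random (probability $1/n$ each), independently; the execution from $C_0$ is $C_0,C_1,\dots$ with $C_t\xrightarrow{\Gamma_t}C_{t+1}$. Self-stabilizing leader election. A configuration $C$ is safe if (i) exactly one agent outputs $L$ and all others output $F$ in $C$, and (ii) in every configuration reachable from $C$ every agent has the same output as in $C$. A protocol is a self-stabilizing leader election protocol if from every initial configuration its execution reaches a safe configuration with probability $1$. Its expected convergence time is the maximum over all initial configurations $C$ of the expected number of steps until the execution from $C$ reaches a safe configuration. Its number of states is $|Q|$.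 Protocol $P_{RL}$ (parameter $N$). Each agent has variables $\mathit{leader}\in\{0,1\}$, $\mathit{bullet}\in\{0,1,2\}$, $\mathit{shield}\in\{0,1\}$, $\mathit{signal}\in\{0,1\}$, $\mathit{dist}\in\{0,1,\dots,N\}$; an agent outputs $L$ if $\mathit{leader}=1$ and $F$ otherwise. In an interaction with initiator $l$ and responder $r$ the following are executed in order (each line uses the current values after the previous lines): 1. If $l.\mathit{leader}=1$ then $l.\mathit{dist}\gets 0$. 2. If $r.\mathit{leader}=1$ then $r.\mathit{dist}\gets 0$; else if $r.\mathit{bullet}=0$ then $r.\mathit{dist}\gets\min(l.\mathit{dist}+1,N)$. 3. If $r.\mathit{dist}=N$ then $r.\mathit{leader}\gets1$, $r.\mathit{bullet}\gets2$, $r.\mathit{shield}\gets1$, $r.\mathit{signal}\gets0$, $r.\mathit{dist}\gets0$. 4. If $l.\mathit{leader}=1$ and $l.\mathit{signal}=1$ then $l.\mathit{bullet}\gets2$, $l.\mathit{shield}\gets1$, $l.\mathit{signal}\gets0$. 5. If $r.\mathit{leader}=1$ and $r.\mathit{signal}=1$ then $r.\mathit{bullet}\gets1$, $r.\mathit{shield}\gets0$, $r.\mathit{signal}\gets0$. 6. If $l.\mathit{bullet}>0$ and $r.\mathit{leader}=1$: set $r.\mathit{leader}\gets0$ if ($l.\mathit{bullet}=2$ and $r.\mathit{shield}=0$), otherwise leave it $1$; then $l.\mathit{bullet}\gets0$. Else, if $l.\mathit{bullet}>0$ and $r.\mathit{leader}=0$: if $r.\mathit{bullet}=0$ then $r.\mathit{bullet}\gets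 l.\mathit{bullet}$; then $l.\mathit{bullet}\gets0$ and $r.\mathit{signal}\gets0$. 7. $l.\mathit{signal}\gets\max(l.\mathit{signal},r.\mathit{signal},r.\mathit{leader})$. *)

theory Defs
  imports "HOL-Probability.Probability"
begin

record agent =
  leader :: nat
  bullet :: nat
  shield :: nat
  signal :: nat
  dist :: nat

definition Q :: "nat \<Rightarrow> agent set" where
  "Q N = {s. leader s \<le> 1 \<and> bullet s \<le> 2 \<and> shield s \<le> 1 \<and> signal s \<le> 1 \<and> dist s \<le> N}"

definition outputs_L :: "agent \<Rightarrow> bool" where
  "outputs_L s \<longleftrightarrow> leader s = 1"

text \<open>Transition function T (initiator l, responder r), lines 1--7 executed in order.\<close>
definition trans :: "nat \<Rightarrow> agent \<Rightarrow> agent \<Rightarrow> agent \<times> agent" where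
  "trans N l0 r0 = (let
     l1 = (if leader l0 = 1 then l0\<lparr>dist := 0\<rparr> else l0);
     r2 = (if leader r0 = 1 then r0\<lparr>dist := 0\<rparr>
           else if bullet r0 = 0 then r0\<lparr>dist := min (dist l1 + 1) N\<rparr> else r0);
     r3 = (if dist r2 = N then r2\<lparr>leader := 1, bullet := 2, shield := 1, signal := 0, dist := 0\<rparr>
           else r2);
     l4 = (if leader l1 = 1 \<and> signal l1 = 1 then l1\<lparr>bullet := 2, shield := 1, signal := 0\<rparr> else l1);
     r5 = (if leader r3 = 1 \<and> signal r3 = 1 then r3\<lparr>bullet := 1, shield := 0, signal := 0\<rparr> else r3);
     lr6 = (if bullet l4 > 0 \<and> leader r5 = 1 then
              (l4\<lparr>bullet := 0\<rparr>,
               (if bullet l4 = 2 \<and> shield r5 = 0 then r5\<lparr>leader := 0\<rparr> else r5))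
            else if bullet l4 > 0 \<and> leader r5 = 0 then
              (l4\<lparr>bullet := 0\<rparr>,
               (if bullet r5 = 0 then r5\<lparr>bullet := bullet l4\<rparr> else r5)\<lparr>signal := 0\<rparr>)
            else (l4, r5));
     l6 = fst lr6; r6 = snd lr6;
     l7 = l6\<lparr>signal := max (signal l6) (max (signal r6) (leader r6))\<rparr>
   in (l7, r6))"

text \<open>Configurations on the directed ring of n agents u_0..u_{n-1}: functions
  nat => agent, of which only the values at 0..n-1 are meaningful.\<close>
type_synonym config = "nat \<Rightarrow> agent"

definition valid_config :: "nat \<Rightarrow> nat \<Rightarrow> config \<Rightarrow> bool" where
  "valid_config N n C \<longleftrightarrow> (\<forall>i<n. C i \<in> Q N)"

definition step_arc :: "nat \<Rightarrow> nat \<Rightarrow> config \<Rightarrow> nat \<Rightarrow> config" where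
  "step_arc N n C i =
     (let j = (i + 1) mod n; p = trans N (C i) (C j) in C(i := fst p, j := snd p))"

definition step :: "nat \<Rightarrow> nat \<Rightarrow> config \<Rightarrow> config \<Rightarrow> bool" where
  "step N n C C' \<longleftrightarrow> (\<exists>i<n. C' = step_arc N n C i)"

definition reachable :: "nat \<Rightarrow> nat \<Rightarrow> config \<Rightarrow> config \<Rightarrow> bool" where
  "reachable N n = (step N n)\<^sup>*\<^sup>*"

definition safe :: "nat \<Rightarrow> nat \<Rightarrow> config \<Rightarrow> bool" where
  "safe N n C \<longleftrightarrow>
     (\<exists>!i. i < n \<and> outputs_L (C i)) \<and>
     (\<forall>C'. reachable N n C C' \<longrightarrow> (\<forall>i<n. outputs_L (C' i) = outputs_L (C i)))"

definition sched :: "nat \<Rightarrow> (nat \<Rightarrow> nat) measure" where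
  "sched n = PiM UNIV (\<lambda>_::nat. measure_pmf (pmf_of_set {..<n}))"

primrec exec :: "nat \<Rightarrow> nat \<Rightarrow> config \<Rightarrow> (nat \<Rightarrow> nat) \<Rightarrow> nat \<Rightarrow> config" where
  "exec N n C \<omega> 0 = C"
| "exec N n C \<omega> (Suc t) = step_arc N n (exec N n C \<omega> t) (\<omega> t)"

definition conv_steps :: "nat \<Rightarrow> nat \<Rightarrow> config \<Rightarrow> (nat \<Rightarrow> nat) \<Rightarrow> ennreal" where
  "conv_steps N n C \<omega> =
     (if \<exists>t. safe N n (exec N n C \<omega> t)
      then of_nat (LEAST t. safe N n (exec N n C \<omega> t)) else \<infinity>)"

definition expected_conv_time :: "nat \<Rightarrow> nat \<Rightarrow> config \<Rightarrow> ennreal" where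
  "expected_conv_time N n C = (\<integral>\<^sup>+ \<omega>. conv_steps N n C \<omega> \<partial>sched n)"

definition self_stabilizing_LE :: "nat \<Rightarrow> nat \<Rightarrow> bool" where
  "self_stabilizing_LE N n \<longleftrightarrow>
     (\<forall>C. valid_config N n C \<longrightarrow>
        (AE \<omega> in sched n. \<exists>t. safe N n (exec N n C \<omega> t)))"

end

theory Submission
  imports Defs
begin

text \<open>
  We construct a function \<open>V\<close> on configurations that is bounded by a multiple of \<open>n * N\<close> and decreases
  by at least \<open>1\<close> in expectation in every step from an unsafe configuration; additive drift then
  bounds the expected convergence time by \<open>V\<close>. The function treats three successive phases.

  First, call a live bullet peaceful if the nearest leader behind it is shielded and the
  stretch between them carries no signal and correct distances. Peaceful bullets stay peaceful, and all
  other live bullets die after at most \<open>N\<close> moves. From then on the last leader is never killed.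

  Second, a distance value is harmful if it would reach \<open>N\<close> before meeting a leader. No new harmful value
  appears, because a killing bullet has just rewritten the distances behind it. Harmful values grow
  when copied and are overwritten, so a sum of weights \<open>2 ^ (N - distance)\<close> decays by a
  factor \<open>1 - c / n\<close> per step, and its logarithm is the potential. When no value is harmful, some
  leader exists and no leader is ever created again.

  Third, consecutive leaders with gaps \<open>g1\<close>, \<open>g2\<close> fight a duel: each shot is live and shielding or a dummy
  and unshielding with probability \<open>1 / 2\<close>, and a kill takes \<open>O(n * (g1 + g2))\<close> steps. Summing over all
  leaders, the number \<open>m\<close> of leaders drops at rate \<open>(m / n)\<^sup>2\<close>, so that \<open>1 / m\<close> grows at constant rate and
  one leader is left after \<open>O(n\<^sup>2)\<close> steps.
\<close>

section \<open>Additive drift\<close>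

primrec unsafe_steps :: "nat \<Rightarrow> nat \<Rightarrow> nat \<Rightarrow> config \<Rightarrow> (nat \<Rightarrow> nat) \<Rightarrow> ennreal" where
  "unsafe_steps N n 0 C \<omega> = 0"
| "unsafe_steps N n (Suc t) C \<omega> =
     (if safe N n C then 0 else 1 + unsafe_steps N n t (step_arc N n C (\<omega> 0)) (\<lambda>k. \<omega> (Suc k)))"

lemma exec_Suc_shift:
  "exec N n C \<omega> (Suc t) = exec N n (step_arc N n C (\<omega> 0)) (\<lambda>k. \<omega> (Suc k)) t"
  by (induction t) auto

lemma unsafe_steps_eq:
  assumes "\<And>s. s < t \<Longrightarrow> \<not> safe N n (exec N n C \<omega> s)"
  shows "unsafe_steps N n t C \<omega> = of_nat t"
  using assms
proof (induction t arbitrary: C \<omega>)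
  case (Suc t)
  have "\<not> safe N n C" using Suc.prems[of 0] by simp
  moreover have "unsafe_steps N n t (step_arc N n C (\<omega> 0)) (\<lambda>k. \<omega> (Suc k)) = of_nat t"
    by (rule Suc.IH) (use Suc.prems exec_Suc_shift in \<open>metis Suc_less_eq\<close>)
  ultimately show ?case by simp
qed simp

lemma conv_steps_le_SUP: "conv_steps N n C \<omega> \<le> (SUP t. unsafe_steps N n t C \<omega>)"
proof (cases "\<exists>t. safe N n (exec N n C \<omega> t)")
  case True
  define k where "k = (LEAST t. safe N n (exec N n C \<omega> t))"
  have "unsafe_steps N n k C \<omega> = of_nat k"
    by (rule unsafe_steps_eq) (use not_less_Least k_def in blast)
  with True have "conv_steps N n C \<omega> = unsafe_steps N n k C \<omega>"
    by (simp add: conv_steps_def k_def)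
  then show ?thesis by (metis SUP_upper UNIV_I)
next
  case False
  then have "unsafe_steps N n t C \<omega> = of_nat t" for t by (intro unsafe_steps_eq) auto
  then have "(SUP t. unsafe_steps N n t C \<omega>) = top"
    using ennreal_SUP_of_nat_eq_top by simp
  then show ?thesis by (simp only: top_greatest)
qed

lemma unsafe_steps_le_Suc: "unsafe_steps N n t C \<omega> \<le> unsafe_steps N n (Suc t) C \<omega>"
proof (induction t arbitrary: C \<omega>)
  case (Suc t)
  show ?case
    using add_left_mono[OF Suc.IH[of "step_arc N n C (\<omega> 0)" "\<lambda>k. \<omega> (Suc k)"], of 1]
    by (simp only: unsafe_steps.simps(2) split: if_split) simp
qed simp

lemma incseq_unsafe_steps: "incseq (\<lambda>t. unsafe_steps N n t C)"
  by (intro incseq_SucI le_funI unsafe_steps_le_Suc)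

lemma measurable_shift_sched: "(\<lambda>\<omega> k. \<omega> (Suc k)) \<in> measurable (sched n) (sched n)"
  unfolding sched_def by (rule measurable_PiM_single') (auto intro: measurable_component_singleton)

lemma measurable_unsafe_steps: "unsafe_steps N n t C \<in> borel_measurable (sched n)"
proof (induction t arbitrary: C)
  case (Suc t)
  have "(\<lambda>\<omega>. \<omega> 0) \<in> measurable (sched n) (count_space UNIV)"
    unfolding sched_def
    using measurable_component_singleton[of 0 UNIV "\<lambda>_. measure_pmf (pmf_of_set {..<n})"] by simp
  moreover have "(\<lambda>\<omega>. unsafe_steps N n t (step_arc N n C i) (\<lambda>k. \<omega> (Suc k)))
       \<in> borel_measurable (sched n)" for i
    using measurable_compose[OF measurable_shift_sched Suc] .
  ultimately have "(\<lambda>\<omega>. unsafe_steps N n t (step_arc N n C (\<omega> 0)) (\<lambda>k. \<omega> (Suc k)))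
       \<in> borel_measurable (sched n)"
    by (rule measurable_compose_countable[rotated])
  then show ?case by simp
next
  case 0
  have "unsafe_steps N n 0 C = (\<lambda>_. 0)" by (simp add: fun_eq_iff)
  then show ?case by simp
qed

lemma nn_integral_sched:
  assumes f: "f \<in> borel_measurable (sched n)" and n: "n > 0"
  shows "(\<integral>\<^sup>+ \<omega>. f \<omega> \<partial>sched n) = (\<Sum>i<n. \<integral>\<^sup>+ \<omega>. f (case_nat i \<omega>) \<partial>sched n) / of_nat n"
proof -
  let ?M = "measure_pmf (pmf_of_set {..<n})"
  interpret S: sequence_space ?M ..
  interpret P: prob_space "sched n" unfolding sched_def by (rule prob_space_PiM) (rule prob_space_measure_pmf)
  have eq: "distr (?M \<Otimes>\<^sub>M sched n) (sched n) (\<lambda>(s, \<omega>). case_nat s \<omega>) = sched n"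
    unfolding sched_def using S.PiM_iter .
  have m: "(\<lambda>(s, \<omega>). case_nat s \<omega>) \<in> measurable (?M \<Otimes>\<^sub>M sched n) (sched n)"
    unfolding sched_def by simp
  have "(\<integral>\<^sup>+ \<omega>. f \<omega> \<partial>sched n) = (\<integral>\<^sup>+ x. f ((\<lambda>(s, \<omega>). case_nat s \<omega>) x) \<partial>(?M \<Otimes>\<^sub>M sched n))"
    by (subst eq[symmetric], rule nn_integral_distr) (use m f in auto)
  also have "\<dots> = (\<integral>\<^sup>+ s. (\<integral>\<^sup>+ \<omega>. f (case_nat s \<omega>) \<partial>sched n) \<partial>?M)"
    using P.nn_integral_fst[of "\<lambda>x. f ((\<lambda>(s, \<omega>). case_nat s \<omega>) x)" ?M, symmetric]
      measurable_compose[OF m f] by simp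
  also have "\<dots> = (\<Sum>i<n. \<integral>\<^sup>+ \<omega>. f (case_nat i \<omega>) \<partial>sched n) / of_nat n"
    using n by (subst nn_integral_pmf_of_set) auto
  finally show ?thesis .
qed

theorem expected_conv_time_le_Lyapunov:
  fixes V :: "config \<Rightarrow> real"
  assumes n: "n > 0"
    and closed: "\<And>C i. I C \<Longrightarrow> i < n \<Longrightarrow> I (step_arc N n C i)"
    and nonneg: "\<And>C. I C \<Longrightarrow> 0 \<le> V C"
    and drift: "\<And>C. I C \<Longrightarrow> \<not> safe N n C \<Longrightarrow> (\<Sum>i<n. V (step_arc N n C i)) \<le> real n * (V C - 1)"
    and I: "I C"
  shows "expected_conv_time N n C \<le> ennreal (V C)"
proof -
  interpret P: prob_space "sched n" unfolding sched_def by (rule prob_space_PiM) (rule prob_space_measure_pmf)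
  have *: "(\<integral>\<^sup>+ \<omega>. unsafe_steps N n t C \<omega> \<partial>sched n) \<le> ennreal (V C)" if "I C" for t C
    using that
  proof (induction t arbitrary: C)
    case (Suc t)
    show ?case
    proof (cases "safe N n C")
      case False
      have pos: "0 \<le> V (step_arc N n C i)" if "i < n" for i using nonneg closed Suc.prems that by blast
      have "(\<integral>\<^sup>+ \<omega>. unsafe_steps N n (Suc t) C \<omega> \<partial>sched n) =
          (\<Sum>i<n. \<integral>\<^sup>+ \<omega>. 1 + unsafe_steps N n t (step_arc N n C i) \<omega> \<partial>sched n) / of_nat n"
        using False by (subst nn_integral_sched[OF measurable_unsafe_steps n]) simp
      also have "\<dots> \<le> (\<Sum>i<n. 1 + ennreal (V (step_arc N n C i))) / of_nat n"
        by (intro divide_right_mono_ennreal sum_mono)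
          (auto simp: nn_integral_add measurable_unsafe_steps P.emeasure_space_1 intro!: add_left_mono Suc closed)
      also have "(\<Sum>i<n. 1 + ennreal (V (step_arc N n C i))) = ennreal (real n + (\<Sum>i<n. V (step_arc N n C i)))"
        using pos by (subst ennreal_plus) (auto simp: sum.distrib ennreal_of_nat_eq_real_of_nat intro!: sum_nonneg sum_ennreal)
      also have "\<dots> \<le> ennreal (real n * V C)"
        by (rule ennreal_leI) (use drift[OF Suc.prems False] in \<open>simp add: algebra_simps\<close>)
      also have "ennreal (real n * V C) / of_nat n = ennreal (V C)"
        using n nonneg[OF Suc.prems] by (simp add: ennreal_of_nat_eq_real_of_nat divide_ennreal)
      finally show ?thesis by (simp add: divide_right_mono_ennreal)
    qed simp
  next
    case 0
    have "unsafe_steps N n 0 C = (\<lambda>_. 0)" by (simp add: fun_eq_iff)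
    then show ?case by simp
  qed
  have "expected_conv_time N n C \<le> (\<integral>\<^sup>+ \<omega>. (SUP t. unsafe_steps N n t C \<omega>) \<partial>sched n)"
    unfolding expected_conv_time_def by (intro nn_integral_mono conv_steps_le_SUP)
  also have "\<dots> = (SUP t. \<integral>\<^sup>+ \<omega>. unsafe_steps N n t C \<omega> \<partial>sched n)"
    using incseq_unsafe_steps measurable_unsafe_steps by (rule nn_integral_monotone_convergence_SUP)
  also have "\<dots> \<le> ennreal (V C)" by (rule SUP_least) (use * I in blast)
  finally show ?thesis .
qed

lemma AE_safe_if_expected_conv_time_finite:
  assumes "expected_conv_time N n C \<noteq> \<infinity>"
  shows "AE \<omega> in sched n. \<exists>t. safe N n (exec N n C \<omega> t)"
proof -
  have c: "(\<lambda>\<omega>. \<omega> t) \<in> measurable (sched n) (count_space UNIV)" for t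
    unfolding sched_def
    using measurable_component_singleton[of t UNIV "\<lambda>_. measure_pmf (pmf_of_set {..<n})"] by simp
  have "(\<lambda>\<omega>. exec N n C \<omega> t) \<in> measurable (sched n) (count_space UNIV)" for t
  proof (induction t)
    case (Suc t)
    have "(\<lambda>\<omega>. step_arc N n (exec N n C \<omega> t) i) \<in> measurable (sched n) (count_space UNIV)" for i
      by (rule measurable_compose[OF Suc]) simp
    then show ?case
      unfolding exec.simps by (rule measurable_compose_countable[OF _ c])
  qed simp
  then have [measurable]: "Measurable.pred (sched n) (\<lambda>\<omega>. safe N n (exec N n C \<omega> t))" for t
    by (rule measurable_compose) simp
  have "conv_steps N n C \<in> borel_measurable (sched n)"
    unfolding conv_steps_def by measurable
  then have "AE \<omega> in sched n. conv_steps N n C \<omega> \<noteq> \<infinity>"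
    using assms unfolding expected_conv_time_def by (rule nn_integral_PInf_AE)
  then show ?thesis by eventually_elim (auto simp: conv_steps_def split: if_splits)
qed

lemma card_Q_le: "N \<ge> 1 \<Longrightarrow> real (card (Q N)) \<le> 48 * real N"
proof -
  assume "N \<ge> 1"
  let ?f = "\<lambda>s. (leader s, bullet s, shield s, signal s, dist s)"
  let ?T = "{..1::nat} \<times> {..2::nat} \<times> {..1::nat} \<times> {..1::nat} \<times> {..N}"
  have "inj_on ?f (Q N)" by (auto simp: inj_on_def)
  moreover have "?f ` Q N \<subseteq> ?T" by (auto simp: Q_def)
  ultimately have "card (Q N) \<le> card ?T" by (rule card_inj_on_le) auto
  then have "card (Q N) \<le> 24 * Suc N" by (simp add: card_cartesian_product)
  with \<open>N \<ge> 1\<close> have "card (Q N) \<le> 48 * N" by simp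
  then show ?thesis by (metis of_nat_le_iff of_nat_mult of_nat_numeral)
qed

section \<open>Single interactions\<close>

definition fires :: "agent \<Rightarrow> bool" where
  "fires s \<longleftrightarrow> leader s = 1 \<and> signal s = 1"

definition shot :: "agent \<Rightarrow> nat" where
  "shot s = (if fires s then 2 else bullet s)"

definition eff_dist :: "agent \<Rightarrow> nat" where
  "eff_dist s = (if leader s = 1 then 0 else dist s)"

definition creates :: "nat \<Rightarrow> agent \<Rightarrow> agent \<Rightarrow> bool" where
  "creates N l r \<longleftrightarrow> leader r = 0 \<and> (if bullet r = 0 then N \<le> Suc (eff_dist l) else dist r = N)"

definition kills :: "agent \<Rightarrow> agent \<Rightarrow> bool" where
  "kills l r \<longleftrightarrow> leader r = 1 \<and> shot l = 2 \<and> (signal r = 1 \<or> shield r = 0)"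

definition after_fire :: "agent \<Rightarrow> agent" where
  "after_fire l = l\<lparr>bullet := shot l, shield := (if fires l then 1 else shield l),
     signal := (if fires l then 0 else signal l), dist := eff_dist l\<rparr>"

definition after_create :: "nat \<Rightarrow> agent \<Rightarrow> agent \<Rightarrow> agent" where
  "after_create N l r =
     (if creates N l r then r\<lparr>leader := 1, bullet := 2, shield := 1, signal := 0, dist := 0\<rparr>
      else if leader r = 1 then r\<lparr>dist := 0\<rparr>
      else if bullet r = 0 then r\<lparr>dist := Suc (eff_dist l)\<rparr> else r)"

definition after_respond :: "agent \<Rightarrow> agent" where
  "after_respond r = (if fires r then r\<lparr>bullet := 1, shield := 0, signal := 0\<rparr> else r)"

definition after_hit :: "agent \<Rightarrow> agent \<Rightarrow> agent" where
  "after_hit l r = (if bullet l > 0 \<and> leader r = 1 then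
       (if bullet l = 2 \<and> shield r = 0 then r\<lparr>leader := 0\<rparr> else r)
     else if bullet l > 0 \<and> leader r = 0 then
       (if bullet r = 0 then r\<lparr>bullet := bullet l\<rparr> else r)\<lparr>signal := 0\<rparr>
     else r)"

lemma after_create_eq:
  assumes "r \<in> Q N" "2 \<le> N"
    and "r2 = (if leader r = 1 then r\<lparr>dist := 0\<rparr>
       else if bullet r = 0 then r\<lparr>dist := min (eff_dist l + 1) N\<rparr> else r)"
  shows "(if dist r2 = N then r2\<lparr>leader := 1, bullet := 2, shield := 1, signal := 0, dist := 0\<rparr> else r2)
    = after_create N l r"
proof -
  consider "leader r = 1" | "leader r = 0" "bullet r = 0" | "leader r = 0" "bullet r \<noteq> 0"
    using assms(1) by (fastforce simp: Q_def)
  then show ?thesis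
  proof cases
    case 1
    with assms show ?thesis by (simp add: after_create_def creates_def)
  next
    case 2
    with assms show ?thesis
      by (cases "N \<le> Suc (eff_dist l)") (simp_all add: after_create_def creates_def min_def)
  next
    case 3
    with assms show ?thesis by (simp add: after_create_def creates_def)
  qed
qed

lemma trans_eq:
  assumes "l \<in> Q N" "r \<in> Q N" "2 \<le> N"
  defines "r' \<equiv> after_hit (after_fire l) (after_respond (after_create N l r))"
  shows "snd (trans N l r) = r'" (is ?A)
    and "fst (trans N l r) = (after_fire l)\<lparr>bullet := 0,
          signal := max (signal (after_fire l)) (max (signal r') (leader r'))\<rparr>" (is ?B)
proof -
  define l1 where "l1 = (if leader l = 1 then l\<lparr>dist := 0\<rparr> else l)"
  define r2 where "r2 = (if leader r = 1 then r\<lparr>dist := 0\<rparr>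
           else if bullet r = 0 then r\<lparr>dist := min (dist l1 + 1) N\<rparr> else r)"
  define r3 where "r3 = (if dist r2 = N
           then r2\<lparr>leader := 1, bullet := 2, shield := 1, signal := 0, dist := 0\<rparr> else r2)"
  define l4 where "l4 = (if leader l1 = 1 \<and> signal l1 = 1
           then l1\<lparr>bullet := 2, shield := 1, signal := 0\<rparr> else l1)"
  define r5 where "r5 = (if leader r3 = 1 \<and> signal r3 = 1
           then r3\<lparr>bullet := 1, shield := 0, signal := 0\<rparr> else r3)"
  define lr6 where "lr6 = (if bullet l4 > 0 \<and> leader r5 = 1 then
              (l4\<lparr>bullet := 0\<rparr>,
               (if bullet l4 = 2 \<and> shield r5 = 0 then r5\<lparr>leader := 0\<rparr> else r5))
            else if bullet l4 > 0 \<and> leader r5 = 0 then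
              (l4\<lparr>bullet := 0\<rparr>,
               (if bullet r5 = 0 then r5\<lparr>bullet := bullet l4\<rparr> else r5)\<lparr>signal := 0\<rparr>)
            else (l4, r5))"
  have T: "trans N l r = ((fst lr6)\<lparr>signal := max (signal (fst lr6)) (max (signal (snd lr6)) (leader (snd lr6)))\<rparr>, snd lr6)"
    unfolding trans_def Let_def l1_def r2_def r3_def l4_def r5_def lr6_def by (rule refl)
  have l1: "l1 = l\<lparr>dist := eff_dist l\<rparr>" by (simp add: l1_def eff_dist_def)
  have l4: "l4 = after_fire l" unfolding l4_def l1 by (simp add: after_fire_def shot_def fires_def)
  have r3: "r3 = after_create N l r"
    unfolding r3_def by (rule after_create_eq[OF assms(2,3)]) (simp add: r2_def l1)
  have r5: "r5 = after_respond (after_create N l r)" unfolding r5_def r3 by (simp add: after_respond_def fires_def)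
  have lr: "leader r5 = 0 \<or> leader r5 = 1"
    using assms(2) unfolding r5 by (auto simp: after_respond_def after_create_def Q_def)
  have s: "snd lr6 = r'" unfolding lr6_def r'_def after_hit_def l4 r5 by simp
  have "fst lr6 = l4\<lparr>bullet := 0\<rparr>"
    using lr unfolding lr6_def by (cases "bullet l4 > 0") auto
  with s show ?A ?B
    unfolding T l4 by simp_all
qed

lemma trans_initiator:
  assumes "l \<in> Q N" "r \<in> Q N" "2 \<le> N"
  shows "leader (fst (trans N l r)) = leader l"
    and "bullet (fst (trans N l r)) = 0"
    and "dist (fst (trans N l r)) = eff_dist l"
    and "shield (fst (trans N l r)) = (if fires l then 1 else shield l)"
    and "signal (fst (trans N l r)) = max (if fires l then 0 else signal l)
          (max (signal (snd (trans N l r))) (leader (snd (trans N l r))))"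
  by (simp_all add: trans_eq[OF assms] after_fire_def)

lemma trans_leader:
  assumes "l \<in> Q N" "r \<in> Q N" "2 \<le> N" "leader r = 1"
  shows "leader (snd (trans N l r)) = (if kills l r then 0 else 1)" (is ?A)
    and "bullet (snd (trans N l r)) = (if signal r = 1 then 1 else bullet r)" (is ?B)
    and "shield (snd (trans N l r)) = (if signal r = 1 then 0 else shield r)" (is ?C)
    and "signal (snd (trans N l r)) = 0" (is ?D)
    and "dist (snd (trans N l r)) = 0" (is ?E)
proof -
  have "after_create N l r = r\<lparr>dist := 0\<rparr>" using assms by (simp add: after_create_def creates_def)
  moreover have "signal r = 0 \<or> signal r = 1" using assms(2) by (auto simp: Q_def)
  moreover have "bullet (after_fire l) = shot l" by (simp add: after_fire_def)
  ultimately show ?A ?B ?C ?D ?E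
    using assms by (auto simp: trans_eq[OF assms(1-3)] after_respond_def after_hit_def kills_def fires_def)
qed

lemma trans_create:
  assumes "l \<in> Q N" "r \<in> Q N" "2 \<le> N" "creates N l r"
  shows "snd (trans N l r) = r\<lparr>leader := 1, bullet := 2, shield := 1, signal := 0, dist := 0\<rparr>"
  using assms(4) by (simp add: trans_eq[OF assms(1-3)] after_create_def after_respond_def after_hit_def fires_def)

lemma trans_follower:
  assumes "l \<in> Q N" "r \<in> Q N" "2 \<le> N" "leader r = 0" "\<not> creates N l r"
  shows "leader (snd (trans N l r)) = 0" (is ?A)
    and "bullet (snd (trans N l r)) = (if bullet r = 0 then shot l else bullet r)" (is ?B)
    and "shield (snd (trans N l r)) = shield r" (is ?C)
    and "signal (snd (trans N l r)) = (if shot l > 0 then 0 else signal r)" (is ?D)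
    and "dist (snd (trans N l r)) = (if bullet r = 0 then Suc (eff_dist l) else dist r)" (is ?E)
proof -
  have "after_create N l r = (if bullet r = 0 then r\<lparr>dist := Suc (eff_dist l)\<rparr> else r)"
    using assms by (simp add: after_create_def)
  moreover have "bullet (after_fire l) = shot l" by (simp add: after_fire_def)
  ultimately show ?A ?B ?C ?D ?E
    using assms by (auto simp: trans_eq[OF assms(1-3)] after_respond_def after_hit_def fires_def)
qed

lemma trans_in_Q:
  assumes "l \<in> Q N" "r \<in> Q N" "2 \<le> N"
  shows "fst (trans N l r) \<in> Q N" "snd (trans N l r) \<in> Q N"
proof -
  have l: "leader l \<le> 1" "shield l \<le> 1" "signal l \<le> 1" "bullet l \<le> 2" "dist l \<le> N"
    and r: "leader r \<le> 1" "shield r \<le> 1" "signal r \<le> 1" "bullet r \<le> 2" "dist r \<le> N"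
    using assms by (auto simp: Q_def)
  have s: "shot l \<le> 2" "eff_dist l \<le> N" using l by (auto simp: shot_def eff_dist_def)
  consider "leader r = 1" | "creates N l r" | "leader r = 0" "\<not> creates N l r" using r by linarith
  then show r': "snd (trans N l r) \<in> Q N"
  proof cases
    case 1
    then show ?thesis using r by (simp add: Q_def trans_leader[OF assms])
  next
    case 2
    then show ?thesis by (simp add: Q_def trans_create[OF assms])
  next
    case 3
    then have "bullet r = 0 \<Longrightarrow> Suc (eff_dist l) \<le> N" by (simp add: creates_def)
    with 3 show ?thesis using r s by (simp add: Q_def trans_follower[OF assms])
  qed
  then show "fst (trans N l r) \<in> Q N"
    using l s by (simp add: Q_def trans_initiator[OF assms])
qed

locale ring =
  fixes N n :: nat
  assumes n_ge_2: "2 \<le> n" and n_le_N: "n \<le> N"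
begin

lemma N_ge_2: "2 \<le> N" using n_ge_2 n_le_N by simp

lemma n_pos: "0 < n" using n_ge_2 by simp

definition ag :: "config \<Rightarrow> nat \<Rightarrow> nat \<Rightarrow> agent" where
  "ag C p j = C ((p + j) mod n)"

abbreviation step_from :: "config \<Rightarrow> nat \<Rightarrow> nat \<Rightarrow> config" where
  "step_from C p a \<equiv> step_arc N n C ((p + a) mod n)"

lemma offset_eq_iff:
  assumes "j < n" "k < n"
  shows "(p + j) mod n = (p + k) mod n \<longleftrightarrow> j = k"
proof -
  have *: "j = k" if "(p + j) mod n = (p + k) mod n" "j \<le> k" "k < n" for j k
  proof -
    have "n dvd (p + k) - (p + j)" using that mod_eq_dvd_iff_nat[of "p + j" "p + k" n] by simp
    then have "n dvd k - j" by simp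
    then show ?thesis using that dvd_imp_le[of n "k - j"] by linarith
  qed
  show ?thesis using *[of j k] *[of k j] assms by (metis linear)
qed

lemma offset_exists:
  assumes "q < n" obtains j where "j < n" "(p + j) mod n = q"
proof
  show "(q + n - p mod n) mod n < n" using n_pos by simp
  have "p mod n \<le> q + n" using n_pos by (simp add: less_imp_le trans_le_add2)
  then have "p mod n + (q + n - p mod n) = q + n" by simp
  then have "(p mod n + (q + n - p mod n)) mod n = q" using assms by (simp only:) simp
  then show "(p + (q + n - p mod n) mod n) mod n = q" by (simp add: mod_simps)
qed

lemma ag_add: "ag C ((p + j) mod n) k = ag C p (j + k)"
  by (simp add: ag_def mod_simps ac_simps)

lemma ag_mod: "ag C p (j mod n) = ag C p j"
  by (simp add: ag_def mod_simps)

lemma ag_n: "ag C p n = ag C p 0"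
  by (simp add: ag_def)

lemma ag_0: "p < n \<Longrightarrow> ag C p 0 = C p"
  by (simp add: ag_def)

lemma sum_offset: "(\<Sum>a<n. f ((p + a) mod n)) = (\<Sum>i<n. f i)"
proof (rule sum.reindex_bij_betw)
  show "bij_betw (\<lambda>a. (p + a) mod n) {..<n} {..<n}"
    unfolding bij_betw_def
  proof
    show inj: "inj_on (\<lambda>a. (p + a) mod n) {..<n}" by (auto simp: inj_on_def offset_eq_iff)
    show "(\<lambda>a. (p + a) mod n) ` {..<n} = {..<n}"
      by (rule card_subset_eq) (use n_pos card_image[OF inj] in auto)
  qed
qed

lemma ag_step:
  assumes "a < n" "j < n"
  shows "ag (step_from C p a) p j =
    (if j = Suc a mod n then snd (trans N (ag C p a) (ag C p (Suc a)))
     else if j = a then fst (trans N (ag C p a) (ag C p (Suc a))) else ag C p j)"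
proof -
  have "((p + a) mod n + 1) mod n = (p + Suc a mod n) mod n" by (simp add: mod_simps)
  then show ?thesis
    using assms n_pos offset_eq_iff[of j a p] offset_eq_iff[of j "Suc a mod n" p]
    by (auto simp: step_arc_def Let_def ag_def mod_simps)
qed

lemma Suc_mod_neq: "a < n \<Longrightarrow> Suc a mod n \<noteq> a"
  using n_ge_2 by (auto simp: mod_Suc)

lemma ag_step_initiator: "a < n \<Longrightarrow> ag (step_from C p a) p a = fst (trans N (ag C p a) (ag C p (Suc a)))"
  using Suc_mod_neq[of a] by (simp add: ag_step)

lemma ag_step_responder: "a < n \<Longrightarrow> ag (step_from C p a) p (Suc a) = snd (trans N (ag C p a) (ag C p (Suc a)))"
  using ag_step[of a "Suc a mod n"] n_pos by (simp add: ag_mod)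

lemma ag_step_other: "a < n \<Longrightarrow> j < n \<Longrightarrow> j \<noteq> a \<Longrightarrow> j \<noteq> Suc a mod n \<Longrightarrow> ag (step_from C p a) p j = ag C p j"
  by (simp add: ag_step)

abbreviation valid :: "config \<Rightarrow> bool" where "valid \<equiv> valid_config N n"

lemma valid_at: "valid C \<Longrightarrow> ag C p j \<in> Q N"
  using n_pos by (simp add: valid_config_def ag_def)

lemma valid_step: "valid C \<Longrightarrow> i < n \<Longrightarrow> valid (step_arc N n C i)"
  using n_pos trans_in_Q[OF _ _ N_ge_2] by (auto simp: valid_config_def step_arc_def Let_def)

text \<open>The last clause, about distances, is what keeps a new leader from being created between a
  peaceful bullet and the leader guarding it, and makes peacefulness a property that a bullet never
  loses.\<close>

definition clear_run :: "config \<Rightarrow> nat \<Rightarrow> nat \<Rightarrow> bool" where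
  "clear_run C A k \<longleftrightarrow> k < n \<and> leader (ag C A 0) = 1 \<and> shield (ag C A 0) = 1 \<and>
     (\<forall>j\<le>k. signal (ag C A j) = 0) \<and>
     (\<forall>j. 1 \<le> j \<and> j \<le> k \<longrightarrow> leader (ag C A j) = 0 \<and> dist (ag C A j) \<le> j)"

definition peaceful :: "config \<Rightarrow> nat \<Rightarrow> bool" where
  "peaceful C p \<longleftrightarrow> (\<exists>A k. (A + k) mod n = p \<and> clear_run C A k)"

lemma clear_run_eff_dist: "clear_run C A k \<Longrightarrow> j \<le> k \<Longrightarrow> eff_dist (ag C A j) \<le> j"
  by (cases j) (auto simp: clear_run_def eff_dist_def)

lemma clear_run_not_fires: "clear_run C A k \<Longrightarrow> j \<le> k \<Longrightarrow> \<not> fires (ag C A j)"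
  by (auto simp: clear_run_def fires_def)

lemma leader_cases: "s \<in> Q N \<Longrightarrow> leader s = 0 \<or> leader s = 1"
  by (auto simp: Q_def)

lemma clear_run_step:
  assumes v: "valid C" and c: "clear_run C A k" and a: "a < n" "a \<noteq> k"
  shows "clear_run (step_from C A a) A k"
proof -
  define C' where "C' = step_from C A a"
  let ?l = "ag C A a" and ?r = "ag C A (Suc a)"
  note q = valid_at[OF v] and N2 = N_ge_2
  have kn: "k < n" and L: "leader (ag C A 0) = 1" and S: "shield (ag C A 0) = 1"
    and sg: "\<And>j. j \<le> k \<Longrightarrow> signal (ag C A j) = 0"
    and fo: "\<And>j. 1 \<le> j \<Longrightarrow> j \<le> k \<Longrightarrow> leader (ag C A j) = 0 \<and> dist (ag C A j) \<le> j"
    using c by (auto simp: clear_run_def)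
  consider "a < k" | "k < a" "Suc a < n" | "k < a" "Suc a = n" using a by linarith
  then have "clear_run C' A k"
  proof cases
    case 1
    have r: "leader ?r = 0" "signal ?r = 0" "dist ?r \<le> Suc a" using 1 sg fo by auto
    have e: "eff_dist ?l \<le> a" and f: "\<not> fires ?l"
      using 1 clear_run_eff_dist[OF c] clear_run_not_fires[OF c] by auto
    have nc: "\<not> creates N ?l ?r" using 1 r e kn n_le_N by (auto simp: creates_def)
    note t = trans_follower[OF q q N2 r(1) nc] trans_initiator[OF q[of A a] q[of A "Suc a"] N2]
    have l': "ag C' A a = fst (trans N ?l ?r)" and r': "ag C' A (Suc a) = snd (trans N ?l ?r)"
      using a by (simp_all add: C'_def ag_step_initiator ag_step_responder del: add_Suc_right)
    have o: "ag C' A j = ag C A j" if "j < n" "j \<noteq> a" "j \<noteq> Suc a" for j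
      using that 1 kn a by (simp add: C'_def ag_step_other)
    have sl: "signal (ag C' A a) = 0" and sr: "signal (ag C' A (Suc a)) = 0"
      and dl: "dist (ag C' A a) \<le> a" and dr: "dist (ag C' A (Suc a)) \<le> Suc a"
      and ll: "leader (ag C' A a) = leader ?l" and lr: "leader (ag C' A (Suc a)) = 0"
      and hl: "shield (ag C' A a) = shield ?l"
      using r e f sg[of a] 1 unfolding l' r' by (simp_all add: t)
    show ?thesis unfolding clear_run_def
    proof (intro conjI allI impI)
      show "leader (ag C' A 0) = 1" "shield (ag C' A 0) = 1"
        using L S ll hl o[of 0] n_pos by (cases a; simp)+
      show "signal (ag C' A j) = 0" if "j \<le> k" for j
        using that kn sl sr o[of j] sg[of j] by (cases "j = a"; cases "j = Suc a") auto
      fix j assume j: "1 \<le> j \<and> j \<le> k"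
      show "leader (ag C' A j) = 0"
        using j kn ll lr o[of j] fo[of j] by (cases "j = a"; cases "j = Suc a") auto
      show "dist (ag C' A j) \<le> j"
        using j kn dl dr o[of j] fo[of j] by (cases "j = a"; cases "j = Suc a") auto
    qed (rule kn)
  next
    case 2
    have "ag C' A j = ag C A j" if "j \<le> k" for j
      using that 2 kn a by (simp add: C'_def ag_step_other)
    then show ?thesis using c by (simp add: clear_run_def)
  next
    case 3
    have A: "?r = ag C A 0" using 3 by (simp add: ag_n)
    have r: "leader ?r = 1" "signal ?r = 0" "shield ?r = 1" using L S sg[of 0] A by auto
    have nk: "\<not> kills ?l ?r" using r by (simp add: kills_def)
    note t = trans_leader[OF q q N2 r(1)]
    have "ag C' A 0 = snd (trans N ?l ?r)"
      using ag_step_responder[OF a(1), of C A] 3 ag_n[of C' A] by (simp add: C'_def)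
    then have "leader (ag C' A 0) = 1" "signal (ag C' A 0) = 0" "shield (ag C' A 0) = 1"
      using r nk by (simp_all add: t)
    moreover have "ag C' A j = ag C A j" if "j \<le> k" "j \<noteq> 0" for j
      using that 3 kn a by (simp add: C'_def ag_step_other)
    ultimately show ?thesis using kn sg fo unfolding clear_run_def by (metis not_one_le_zero)
  qed
  then show ?thesis by (simp add: C'_def)
qed

lemma clear_run_extend:
  assumes v: "valid C" and c: "clear_run C A k" and b: "bullet (ag C A k) > 0"
    and r: "leader (ag C A (Suc k)) = 0" "bullet (ag C A (Suc k)) = 0"
  shows "clear_run (step_from C A k) A (Suc k)"
proof -
  define C' where "C' = step_from C A k"
  let ?l = "ag C A k" and ?r = "ag C A (Suc k)"
  note q = valid_at[OF v] and N2 = N_ge_2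
  have L: "leader (ag C A 0) = 1" and S: "shield (ag C A 0) = 1"
    and sg: "\<And>j. j \<le> k \<Longrightarrow> signal (ag C A j) = 0"
    and fo: "\<And>j. 1 \<le> j \<Longrightarrow> j \<le> k \<Longrightarrow> leader (ag C A j) = 0 \<and> dist (ag C A j) \<le> j"
    using c by (auto simp: clear_run_def)
  have "Suc k \<noteq> n"
  proof
    assume "Suc k = n"
    then have "ag C A (Suc k) = ag C A 0" using ag_n by simp
    with r(1) L show False by simp
  qed
  then have kn: "Suc k < n" using c by (simp add: clear_run_def)
  have e: "eff_dist ?l \<le> k" and f: "\<not> fires ?l"
    using clear_run_eff_dist[OF c] clear_run_not_fires[OF c] by auto
  have nc: "\<not> creates N ?l ?r" using r e kn n_le_N by (auto simp: creates_def)
  note t = trans_follower[OF q q N2 r(1) nc] trans_initiator[OF q[of A k] q[of A "Suc k"] N2]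
  have s: "shot ?l > 0" using b f by (simp add: shot_def)
  have l': "ag C' A k = fst (trans N ?l ?r)" and r': "ag C' A (Suc k) = snd (trans N ?l ?r)"
    using kn by (simp_all add: C'_def ag_step_initiator ag_step_responder del: add_Suc_right)
  have o: "ag C' A j = ag C A j" if "j < k" for j
    using that kn by (simp add: C'_def ag_step_other)
  have sl: "signal (ag C' A k) = 0" and sr: "signal (ag C' A (Suc k)) = 0"
    and dl: "dist (ag C' A k) \<le> k" and dr: "dist (ag C' A (Suc k)) \<le> Suc k"
    and ll: "leader (ag C' A k) = leader ?l" and lr: "leader (ag C' A (Suc k)) = 0"
    and hl: "shield (ag C' A k) = shield ?l"
    using r e f s sg[of k] unfolding l' r' by (simp_all add: t)
  have "clear_run C' A (Suc k)" unfolding clear_run_def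
  proof (intro conjI allI impI)
    show "leader (ag C' A 0) = 1" "shield (ag C' A 0) = 1"
      using L S ll hl o[of 0] n_pos by (cases k; simp)+
    show "signal (ag C' A j) = 0" if "j \<le> Suc k" for j
      using that sl sr o[of j] sg[of j] by (cases "j = k"; cases "j = Suc k") auto
    fix j assume j: "1 \<le> j \<and> j \<le> Suc k"
    show "leader (ag C' A j) = 0"
      using j ll lr o[of j] fo[of j] by (cases "j = k"; cases "j = Suc k") auto
    show "dist (ag C' A j) \<le> j"
      using j dl dr o[of j] fo[of j] by (cases "j = k"; cases "j = Suc k") auto
  qed (rule kn)
  then show ?thesis by (simp add: C'_def)
qed

lemma clear_run_fire:
  assumes v: "valid C" and f: "fires (ag C A 0)"
    and r: "leader (ag C A (Suc 0)) = 0" "bullet (ag C A (Suc 0)) = 0"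
  shows "clear_run (step_from C A 0) A (Suc 0)"
proof -
  define C' where "C' = step_from C A 0"
  let ?l = "ag C A 0" and ?r = "ag C A (Suc 0)"
  note q = valid_at[OF v] and N2 = N_ge_2
  have e: "eff_dist ?l = 0" and L: "leader ?l = 1" using f by (simp_all add: fires_def eff_dist_def)
  have nc: "\<not> creates N ?l ?r" using r e N2 by (auto simp: creates_def)
  note t = trans_follower[OF q q N2 r(1) nc] trans_initiator[OF q[of A 0] q[of A "Suc 0"] N2]
  have l': "ag C' A 0 = fst (trans N ?l ?r)" and r': "ag C' A (Suc 0) = snd (trans N ?l ?r)"
    unfolding C'_def by (rule ag_step_initiator ag_step_responder, rule n_pos)+
  have "shot ?l = 2" using f by (simp add: shot_def)
  then have "leader (ag C' A 0) = 1" "shield (ag C' A 0) = 1" "signal (ag C' A 0) = 0"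
    "leader (ag C' A (Suc 0)) = 0" "signal (ag C' A (Suc 0)) = 0" "dist (ag C' A (Suc 0)) \<le> Suc 0"
    using L f r e unfolding l' r' by (simp_all add: t)
  then have "clear_run C' A (Suc 0)" using n_ge_2 by (auto simp: clear_run_def le_Suc_eq)
  then show ?thesis by (simp add: C'_def)
qed

lemma peaceful_step:
  assumes v: "valid C" and p: "peaceful C p" and i: "i < n" "i \<noteq> p"
  shows "peaceful (step_arc N n C i) p"
proof -
  from p obtain A k where A: "(A + k) mod n = p" "clear_run C A k" by (auto simp: peaceful_def)
  obtain a where a: "a < n" "(A + a) mod n = i" using offset_exists i(1) by blast
  have "a \<noteq> k" using a A i by auto
  from clear_run_step[OF v A(2) a(1) this] A(1) a(2) show ?thesis by (auto simp: peaceful_def)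
qed

lemma peaceful_moves:
  assumes v: "valid C" and p: "peaceful C i" and i: "i < n" and b: "bullet (C i) > 0"
    and r: "leader (C (Suc i mod n)) = 0" "bullet (C (Suc i mod n)) = 0"
  shows "peaceful (step_arc N n C i) (Suc i mod n)"
proof -
  from p obtain A k where A: "(A + k) mod n = i" "clear_run C A k" by (auto simp: peaceful_def)
  have l: "ag C A k = C i" using A by (simp add: ag_def)
  have s: "(A + Suc k) mod n = Suc i mod n" using A(1) by (metis add_Suc_right mod_Suc_eq)
  then have "ag C A (Suc k) = C (Suc i mod n)" by (simp add: ag_def)
  with clear_run_extend[OF v A(2)] b r l A(1) s show ?thesis unfolding peaceful_def by metis
qed

lemma peaceful_leader:
  assumes "leader (C p) = 1" "p < n"
  shows "peaceful C p \<longleftrightarrow> shield (C p) = 1 \<and> signal (C p) = 0"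
proof
  assume "peaceful C p"
  then obtain A k where A: "(A + k) mod n = p" "clear_run C A k" by (auto simp: peaceful_def)
  have "ag C A k = C p" using A by (simp add: ag_def)
  with A(2) assms have "k = 0" by (cases k) (auto simp: clear_run_def)
  with A \<open>ag C A k = C p\<close> show "shield (C p) = 1 \<and> signal (C p) = 0" by (auto simp: clear_run_def)
next
  assume "shield (C p) = 1 \<and> signal (C p) = 0"
  then have "clear_run C p 0" using assms n_pos by (simp add: clear_run_def ag_0)
  then show "peaceful C p" using assms(2) unfolding peaceful_def by (intro exI[of _ p] exI[of _ 0]) simp
qed

end

definition log_pot :: "real \<Rightarrow> real" where
  "log_pot x = (if x = 0 then 0 else 1 + ln x)"

lemma log_pot_nonneg: "x = 0 \<or> 1 \<le> x \<Longrightarrow> 0 \<le> log_pot x"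
  by (auto simp: log_pot_def)

lemma log_pot_drift:
  fixes W :: real and Ws :: "nat \<Rightarrow> real"
  assumes W: "1 \<le> W" and Ws: "\<And>i. i < n \<Longrightarrow> Ws i = 0 \<or> 1 \<le> Ws i"
    and sum: "(\<Sum>i<n. Ws i) \<le> (real n - c) * W"
  shows "(\<Sum>i<n. log_pot (Ws i)) \<le> real n * log_pot W - c"
proof -
  have "log_pot (Ws i) \<le> log_pot W - 1 + Ws i / W" if "i < n" for i
  proof (cases "Ws i = 0")
    case True
    then show ?thesis using W by (simp add: log_pot_def)
  next
    case False
    then have 1: "1 \<le> Ws i" using Ws that by blast
    have "ln (Ws i / W) \<le> Ws i / W - 1" using W 1 by (intro ln_le_minus_one) simp
    moreover have "ln (Ws i / W) = ln (Ws i) - ln W" using W 1 by (simp add: ln_div)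
    ultimately show ?thesis using W 1 by (simp add: log_pot_def)
  qed
  then have "(\<Sum>i<n. log_pot (Ws i)) \<le> (\<Sum>i<n. log_pot W - 1 + Ws i / W)" by (intro sum_mono) simp
  also have "\<dots> = real n * (log_pot W - 1) + (\<Sum>i<n. Ws i) / W"
    by (simp add: sum.distrib sum_divide_distrib)
  also have "\<dots> \<le> real n * (log_pot W - 1) + (real n - c)"
    using sum W by (simp add: divide_le_eq)
  finally show ?thesis by (simp add: algebra_simps)
qed

lemma log_pot_le:
  assumes "x = 0 \<or> 1 \<le> x" "x \<le> 2 ^ k"
  shows "log_pot x \<le> 1 + real k"
proof (cases "x = 0")
  case False
  then have "ln x \<le> ln (2 ^ k)" using assms by simp
  also have "\<dots> = real k * ln 2" by (simp add: ln_realpow)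
  also have "\<dots> \<le> real k" using ln_2_less_1 by (simp add: mult_left_le)
  finally show ?thesis using False by (simp add: log_pot_def)
qed (simp add: log_pot_def)

lemma sum_eq_0_or_ge_1:
  fixes f :: "nat \<Rightarrow> real"
  assumes "finite S" "\<And>q. q \<in> S \<Longrightarrow> f q = 0 \<or> 1 \<le> f q"
  shows "sum f S = 0 \<or> 1 \<le> sum f S"
proof (cases "\<exists>q\<in>S. f q \<noteq> 0")
  case True
  then obtain q where q: "q \<in> S" "1 \<le> f q" using assms by blast
  have "f q \<le> sum f S" using assms q by (intro member_le_sum) force+
  then show ?thesis using q by simp
qed simp

context ring
begin

lemma Suc_lt: "Suc i mod n < n"
  using n_pos by simp

lemma step_arc_initiator: "i < n \<Longrightarrow> step_arc N n C i i = fst (trans N (C i) (C (Suc i mod n)))"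
  using Suc_mod_neq[of i] by (auto simp: step_arc_def Let_def)

lemma step_arc_responder: "step_arc N n C i (Suc i mod n) = snd (trans N (C i) (C (Suc i mod n)))"
  by (simp add: step_arc_def Let_def)

lemma step_arc_other: "q \<noteq> i \<Longrightarrow> q \<noteq> Suc i mod n \<Longrightarrow> step_arc N n C i q = C q"
  by (simp add: step_arc_def Let_def)

lemma sum_Suc_mod: "(\<Sum>i<n. f (Suc i mod n)) = (\<Sum>i<n. f i)"
  using sum_offset[of f 1] by simp

lemma sum_change:
  fixes w w' :: "nat \<Rightarrow> real"
  assumes "i < n" and "w' i \<le> w i + x" and "w' (Suc i mod n) \<le> w (Suc i mod n) + y"
    and "\<And>q. q < n \<Longrightarrow> q \<noteq> i \<Longrightarrow> q \<noteq> Suc i mod n \<Longrightarrow> w' q \<le> w q"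
  shows "(\<Sum>q<n. w' q) \<le> (\<Sum>q<n. w q) + x + y"
proof -
  let ?j = "Suc i mod n"
  have "(\<Sum>q<n. w' q) \<le> (\<Sum>q<n. w q + (if q = i then x else 0) + (if q = ?j then y else 0))"
  proof (rule sum_mono)
    fix q assume q: "q \<in> {..<n}"
    show "w' q \<le> w q + (if q = i then x else 0) + (if q = ?j then y else 0)"
      using assms q Suc_mod_neq[OF assms(1)] by (cases "q = i"; cases "q = ?j") auto
  qed
  also have "\<dots> = (\<Sum>q<n. w q) + x + y" using assms(1) Suc_lt[of i] by (simp add: sum.distrib)
  finally show ?thesis .
qed

lemma valid_Q: "valid C \<Longrightarrow> q < n \<Longrightarrow> C q \<in> Q N"
  by (simp add: valid_config_def)

lemma responder_cases:
  assumes "valid C"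
  shows "leader (C (Suc i mod n)) = 1
    \<or> creates N (C i) (C (Suc i mod n))
    \<or> leader (C (Suc i mod n)) = 0 \<and> \<not> creates N (C i) (C (Suc i mod n))"
  using leader_cases[OF valid_Q[OF assms Suc_lt]] by blast

section \<open>Stray live bullets\<close>

definition stray :: "config \<Rightarrow> nat \<Rightarrow> bool" where
  "stray C p \<longleftrightarrow> bullet (C p) = 2 \<and> \<not> peaceful C p"

text \<open>A stray bullet carries its distance value along and increases it with every move, so it makes at
  most \<open>N\<close> moves; with weight \<open>2 ^ (N - distance)\<close> each move halves its contribution.\<close>

definition stray_wt :: "config \<Rightarrow> nat \<Rightarrow> real" where
  "stray_wt C p = (if stray C p then 2 ^ (N - eff_dist (C p)) else 0)"

definition clash_wt :: "config \<Rightarrow> nat \<Rightarrow> real" where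
  "clash_wt C p = (if bullet (C p) > 0 \<and> signal (C p) = 1 then 1 else 0)"

definition stray_pot :: "config \<Rightarrow> real" where
  "stray_pot C = (\<Sum>p<n. stray_wt C p + clash_wt C p)"

lemma stray_wt_responder:
  assumes v: "valid C" and i: "i < n"
  shows "stray_wt (step_arc N n C i) (Suc i mod n) \<le> stray_wt C (Suc i mod n) + stray_wt C i / 2"
proof -
  define C' where "C' = step_arc N n C i"
  define j where "j = Suc i mod n"
  have jn: "j < n" "j \<noteq> i" using Suc_lt Suc_mod_neq[OF i] by (auto simp: j_def)
  note q = valid_Q[OF v i] valid_Q[OF v jn(1)] N_ge_2
  have C'j: "C' j = snd (trans N (C i) (C j))" by (simp add: C'_def j_def step_arc_responder)
  have nonneg: "0 \<le> stray_wt C x" for x by (simp add: stray_wt_def)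
  have "stray_wt C' j \<le> stray_wt C j + stray_wt C i / 2" if st: "stray C' j"
  proof -
    consider (leader) "leader (C (Suc i mod n)) = 1" | (create) "creates N (C i) (C (Suc i mod n))"
    | (follower) "leader (C (Suc i mod n)) = 0" "\<not> creates N (C i) (C (Suc i mod n))"
    using responder_cases[OF v, of i] by metis
    then show ?thesis
    proof cases
      case leader
      then have L: "leader (C j) = 1" by (simp add: j_def)
      note t = trans_leader[OF q L]
      have b: "bullet (C j) = 2" "signal (C j) \<noteq> 1"
        using st by (auto simp: stray_def C'j t split: if_splits)
      then have s0: "signal (C j) = 0" using q(2) by (auto simp: Q_def)
      have "\<not> peaceful C j"
      proof
        assume "peaceful C j"
        then have sh: "shield (C j) = 1" using L jn by (simp add: peaceful_leader)
        then have "\<not> kills (C i) (C j)" using s0 by (simp add: kills_def)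
        then have "peaceful C' j" using sh s0 jn by (subst peaceful_leader) (simp_all add: C'j t)
        then show False using st by (simp add: stray_def)
      qed
      moreover have "eff_dist (C' j) = 0" by (simp add: eff_dist_def C'j t)
      moreover have "eff_dist (C j) = 0" using L by (simp add: eff_dist_def)
      ultimately show ?thesis using st b nonneg[of i] by (simp add: stray_wt_def stray_def)
    next
      case create
      then have "creates N (C i) (C j)" by (simp add: j_def)
      then have "peaceful C' j" using jn by (subst peaceful_leader) (simp_all add: C'j trans_create[OF q])
      then show ?thesis using st by (simp add: stray_def)
    next
      case follower
      then have F: "leader (C j) = 0" "\<not> creates N (C i) (C j)" by (auto simp: j_def)
      note t = trans_follower[OF q F]
      show ?thesis
      proof (cases "bullet (C j) = 0")
        case False
        then have "stray C j" using st peaceful_step[OF v _ i, of j] jn F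
          by (auto simp: stray_def C'j t C'_def[symmetric])
        moreover have "eff_dist (C' j) = eff_dist (C j)" using False F by (simp add: eff_dist_def C'j t)
        ultimately show ?thesis using st nonneg[of i] by (simp add: stray_wt_def)
      next
        case True
        have s: "shot (C i) = 2" using st True by (simp add: stray_def C'j t)
        have ag0: "ag C i 0 = C i" "ag C i (Suc 0) = C j" using i by (simp_all add: ag_def j_def)
        have "\<not> fires (C i)"
        proof
          assume "fires (C i)"
          then have "clear_run C' i (Suc 0)"
            using clear_run_fire[OF v, of i] F True ag0 i by (simp add: C'_def)
          then have "peaceful C' j" unfolding peaceful_def by (intro exI[of _ i] exI[of _ "Suc 0"]) (simp add: j_def)
          then show False using st by (simp add: stray_def)
        qed
        then have b: "bullet (C i) = 2" using s by (simp add: shot_def)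
        have "\<not> peaceful C i"
          using peaceful_moves[OF v _ i] b F True st by (auto simp: stray_def j_def C'_def)
        then have si: "stray C i" using b by (simp add: stray_def)
        have e: "eff_dist (C' j) = Suc (eff_dist (C i))" using True F by (simp add: eff_dist_def C'j t)
        have "Suc (eff_dist (C i)) < N" using F True by (simp add: creates_def)
        then have "N - eff_dist (C i) = Suc (N - Suc (eff_dist (C i)))" by simp
        then have "stray_wt C' j = stray_wt C i / 2"
          using st si e by (simp add: stray_wt_def)
        then show ?thesis using nonneg[of j] by simp
      qed
    qed
  qed
  moreover have "stray_wt C' j \<le> stray_wt C j + stray_wt C i / 2" if "\<not> stray C' j"
    using that nonneg[of i] nonneg[of j] by (simp add: stray_wt_def)
  ultimately show ?thesis unfolding C'_def j_def by blast
qed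

lemma clash_wt_responder:
  assumes v: "valid C" and i: "i < n"
  shows "clash_wt (step_arc N n C i) (Suc i mod n) \<le> clash_wt C (Suc i mod n)"
proof -
  note q = valid_Q[OF v i] valid_Q[OF v Suc_lt] N_ge_2
  consider (leader) "leader (C (Suc i mod n)) = 1" | (create) "creates N (C i) (C (Suc i mod n))"
    | (follower) "leader (C (Suc i mod n)) = 0" "\<not> creates N (C i) (C (Suc i mod n))"
    using responder_cases[OF v, of i] by metis
  then show ?thesis
  proof cases
    case leader
    then show ?thesis by (simp add: clash_wt_def step_arc_responder trans_leader[OF q])
  next
    case create
    then show ?thesis by (simp add: clash_wt_def step_arc_responder trans_create[OF q])
  next
    case follower
    then show ?thesis by (auto simp: clash_wt_def step_arc_responder trans_follower[OF q])
  qed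
qed

lemma stray_pot_step:
  assumes v: "valid C" and i: "i < n"
  shows "stray_pot (step_arc N n C i) \<le> stray_pot C - (stray_wt C i + clash_wt C i) / 2"
proof -
  define C' where "C' = step_arc N n C i"
  note q = valid_Q[OF v i] valid_Q[OF v Suc_lt] N_ge_2
  have "stray_pot C' \<le> stray_pot C + - (stray_wt C i + clash_wt C i) + (stray_wt C i + clash_wt C i) / 2"
    unfolding stray_pot_def
  proof (rule sum_change[OF i])
    have "bullet (C' i) = 0" by (simp add: C'_def step_arc_initiator[OF i] trans_initiator[OF q])
    then show "stray_wt C' i + clash_wt C' i
        \<le> stray_wt C i + clash_wt C i + - (stray_wt C i + clash_wt C i)"
      by (simp add: stray_wt_def stray_def clash_wt_def)
    have "0 \<le> clash_wt C i" by (simp add: clash_wt_def)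
    then show "stray_wt C' (Suc i mod n) + clash_wt C' (Suc i mod n)
        \<le> stray_wt C (Suc i mod n) + clash_wt C (Suc i mod n) + (stray_wt C i + clash_wt C i) / 2"
      using stray_wt_responder[OF v i] clash_wt_responder[OF v i] unfolding C'_def by argo
    fix p assume p: "p < n" "p \<noteq> i" "p \<noteq> Suc i mod n"
    then have "C' p = C p" by (simp add: C'_def step_arc_other)
    moreover have "stray C' p \<Longrightarrow> stray C p"
      using peaceful_step[OF v _ i, of p] p \<open>C' p = C p\<close> by (auto simp: stray_def C'_def)
    ultimately show "stray_wt C' p + clash_wt C' p \<le> stray_wt C p + clash_wt C p"
      by (simp add: stray_wt_def clash_wt_def)
  qed
  then show ?thesis by (simp add: C'_def field_simps)
qed

lemma stray_pot_sum:
  assumes "valid C"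
  shows "(\<Sum>i<n. stray_pot (step_arc N n C i)) \<le> (real n - 1 / 2) * stray_pot C"
proof -
  have "(\<Sum>i<n. stray_pot (step_arc N n C i))
      \<le> (\<Sum>i<n. stray_pot C - (stray_wt C i + clash_wt C i) / 2)"
    by (intro sum_mono stray_pot_step[OF assms]) simp
  also have "\<dots> = real n * stray_pot C - stray_pot C / 2"
    by (simp add: sum_subtractf stray_pot_def sum_divide_distrib)
  finally show ?thesis by (simp add: algebra_simps)
qed

lemma stray_wt_cases: "stray_wt C p + clash_wt C p = 0 \<or> 1 \<le> stray_wt C p + clash_wt C p"
  by (auto simp: stray_wt_def clash_wt_def add_increasing2)

lemma stray_pot_cases: "stray_pot C = 0 \<or> 1 \<le> stray_pot C"
  unfolding stray_pot_def by (rule sum_eq_0_or_ge_1) (use stray_wt_cases in auto)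

lemma n_le_power: "real n \<le> 2 ^ N"
proof -
  have "real n \<le> real N" using n_le_N by simp
  also have "\<dots> \<le> 2 ^ N" using less_exp[of N] by (metis less_imp_le of_nat_le_iff of_nat_numeral of_nat_power)
  finally show ?thesis .
qed

lemma stray_pot_le: "stray_pot C \<le> 2 ^ (2 * N + 1)"
proof -
  have "stray_pot C \<le> (\<Sum>p<n. 2 ^ N + 1)"
    unfolding stray_pot_def
    by (intro sum_mono add_mono) (auto simp: stray_wt_def clash_wt_def power_increasing)
  also have "\<dots> = real n * (2 ^ N + 1)" by simp
  also have "\<dots> \<le> 2 ^ N * (2 * 2 ^ N)" using n_le_power by (intro mult_mono) auto
  also have "(2::real) ^ N * (2 * 2 ^ N) = 2 ^ (N + Suc N)" unfolding power_add power_Suc ..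
  also have "N + Suc N = 2 * N + 1" by simp
  finally show ?thesis .
qed

definition calm :: "config \<Rightarrow> bool" where
  "calm C \<longleftrightarrow> valid C \<and> stray_pot C = 0"

lemma calm_valid: "calm C \<Longrightarrow> valid C" by (simp add: calm_def)

lemma calmD:
  assumes "calm C" "p < n"
  shows "bullet (C p) = 2 \<Longrightarrow> peaceful C p" (is "PROP ?A") "\<not> (bullet (C p) > 0 \<and> signal (C p) = 1)" (is ?B)
proof -
  have nn: "0 \<le> stray_wt C q + clash_wt C q" for q
    by (simp add: stray_wt_def clash_wt_def)
  have "stray_wt C p + clash_wt C p = 0"
    using assms nn by (auto simp: calm_def stray_pot_def sum_nonneg_eq_0_iff)
  moreover have "0 \<le> stray_wt C p" "0 \<le> clash_wt C p" by (auto simp: stray_wt_def clash_wt_def)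
  ultimately have "stray_wt C p = 0" "clash_wt C p = 0" by linarith+
  then show "PROP ?A" ?B
    by (auto simp: stray_wt_def clash_wt_def stray_def split: if_splits)
qed

lemma calm_step: "calm C \<Longrightarrow> i < n \<Longrightarrow> calm (step_arc N n C i)"
proof -
  assume C: "calm C" and i: "i < n"
  have "0 \<le> stray_wt C i + clash_wt C i" by (simp add: stray_wt_def clash_wt_def)
  then have "stray_pot (step_arc N n C i) \<le> 0"
    using stray_pot_step[OF calm_valid[OF C] i] C[unfolded calm_def, THEN conjunct2] by argo
  then show ?thesis
    using stray_pot_cases[of "step_arc N n C i"] valid_step[OF calm_valid[OF C] i] by (auto simp: calm_def)
qed

section \<open>Overlong distances\<close>

lemma leader_step_other: "valid C \<Longrightarrow> i < n \<Longrightarrow> q < n \<Longrightarrow> q \<noteq> Suc i mod n \<Longrightarrow> leader (step_arc N n C i q) = leader (C q)"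
  using valid_Q[of C] Suc_lt[of i] N_ge_2
  by (cases "q = i") (simp_all add: step_arc_initiator step_arc_other trans_initiator)

lemma leader_step:
  assumes v: "valid C" and i: "i < n" and q: "q < n" and L: "leader (C q) = 1"
    and nk: "q = Suc i mod n \<Longrightarrow> \<not> kills (C i) (C q)"
  shows "leader (step_arc N n C i q) = 1"
proof (cases "q = Suc i mod n")
  case True
  then show ?thesis
    using trans_leader(1)[OF valid_Q[OF v i] valid_Q[OF v q] N_ge_2 L] nk by (simp add: step_arc_responder)
qed (simp add: leader_step_other[OF v i q] L)

text \<open>A killing bullet has swept the whole stretch behind it down to the leader guarding it.\<close>

lemma kill_swept:
  assumes C: "calm C" and i: "i < n" and k: "kills (C i) (C (Suc i mod n))"
  obtains A k where "A < n" "(A + k) mod n = i" "Suc k < n" "leader (C A) = 1"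
    "\<And>t. 1 \<le> t \<Longrightarrow> t \<le> k \<Longrightarrow> leader (ag C A t) = 0 \<and> dist (ag C A t) \<le> t"
proof (cases "fires (C i)")
  case True
  then show thesis using that[of i 0] i n_ge_2 by (simp add: fires_def)
next
  case False
  then have "bullet (C i) = 2" using k by (simp add: kills_def shot_def)
  then obtain A' k where A': "(A' + k) mod n = i" "clear_run C A' k"
    using calmD(1)[OF C i] by (auto simp: peaceful_def)
  define A where "A = A' mod n"
  have ag: "ag C A t = ag C A' t" for t by (simp add: ag_def A_def mod_simps)
  have A: "(A + k) mod n = i" "clear_run C A k" "A < n"
    using A' n_pos by (simp_all add: clear_run_def ag) (simp_all add: A_def mod_simps)
  have "Suc k \<noteq> n"
  proof
    assume "Suc k = n"
    then have "Suc i mod n = A" using A(1,3) by (metis add_Suc_right mod_Suc_eq mod_add_self2 mod_less)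
    then show False using A(2,3) k by (auto simp: clear_run_def kills_def ag_0)
  qed
  then show thesis using that[of A k] A by (auto simp: clear_run_def ag_0)
qed

text \<open>The value of a harmless agent is overwritten by a leader ahead before it can grow to \<open>N\<close>.\<close>

definition harmless :: "config \<Rightarrow> nat \<Rightarrow> bool" where
  "harmless C q \<longleftrightarrow> (\<exists>k. 1 \<le> k \<and> k \<le> n \<and> leader (ag C q k) = 1 \<and> dist (C q) + k \<le> N)"

lemma harmless_step:
  assumes C: "calm C" and i: "i < n" and q: "q < n" and L: "leader (C q) = 0"
    and h: "harmless C q" and d: "dist (step_arc N n C i q) \<le> dist (C q)"
  shows "harmless (step_arc N n C i) q"
proof -
  define C' where "C' = step_arc N n C i"
  note v = calm_valid[OF C]
  from h obtain k where k: "1 \<le> k" "k \<le> n" "leader (ag C q k) = 1" "dist (C q) + k \<le> N"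
    by (auto simp: harmless_def)
  define p where "p = (q + k) mod n"
  have p: "p < n" "leader (C p) = 1" using k n_pos by (auto simp: p_def ag_def)
  show ?thesis
  proof (cases "p = Suc i mod n \<and> kills (C i) (C p)")
    case False
    then have "leader (C' p) = 1" using leader_step[OF v i p] by (auto simp: C'_def)
    then have "leader (ag C' q k) = 1" by (simp add: ag_def p_def)
    then show ?thesis using k d unfolding harmless_def C'_def[symmetric] by (intro exI[of _ k]) (auto simp: C'_def)
  next
    case True
    then obtain A m where A: "A < n" "(A + m) mod n = i" "Suc m < n" "leader (C A) = 1"
      and sw: "\<And>t. 1 \<le> t \<Longrightarrow> t \<le> m \<Longrightarrow> leader (ag C A t) = 0 \<and> dist (ag C A t) \<le> t"
      using kill_swept[OF C i] by metis
    obtain t where t: "t < n" "(A + t) mod n = q" using offset_exists[OF q] by blast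
    have pA: "p = (A + Suc m) mod n" using True A(2) by (metis add_Suc_right mod_Suc_eq)
    have "A \<noteq> p"
      using pA offset_eq_iff[of 0 "Suc m" A] A(1,3) n_pos by auto
    then have LA: "leader (C' A) = 1" using leader_step[OF v i A(1,4)] True by (auto simp: C'_def)
    have t0: "t \<noteq> 0"
    proof
      assume "t = 0"
      then have "q = A" using t(2) A(1) by simp
      then show False using A(4) L by simp
    qed
    have "dist (C q) + (n - t) \<le> N"
    proof (cases "t \<le> m")
      case True
      then have "dist (C q) \<le> t" using sw[of t] t0 t by (simp add: ag_def)
      then show ?thesis using t(1) n_le_N by linarith
    next
      case False
      have "(A + (t + k)) mod n = (A + Suc m) mod n"
        using t(2) pA unfolding p_def by (metis add.assoc mod_add_left_eq)
      moreover have "n - t < k"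
      proof (rule ccontr)
        assume "\<not> n - t < k"
        then have le: "t + k \<le> n" using t(1) by linarith
        show False
        proof (cases "t + k = n")
          case True
          then show False using \<open>(A + (t + k)) mod n = (A + Suc m) mod n\<close> \<open>A \<noteq> p\<close> pA A(1) by simp
        next
          case False
          then have "t + k = Suc m"
            using offset_eq_iff[of "t + k" "Suc m" A] le A(3) \<open>(A + (t + k)) mod n = (A + Suc m) mod n\<close> by auto
          then show False using \<open>\<not> t \<le> m\<close> k(1) by linarith
        qed
      qed
      ultimately show ?thesis using k(4) by linarith
    qed
    moreover have "leader (ag C' q (n - t)) = 1"
    proof -
      have "(q + (n - t)) mod n = (A + t + (n - t)) mod n" using t(2) by (metis mod_add_left_eq)
      also have "\<dots> = A" using t(1) A(1) by simp
      finally show ?thesis using LA by (simp add: ag_def)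
    qed
    moreover have "1 \<le> n - t" "n - t \<le> n" using t(1) by auto
    ultimately show ?thesis using d unfolding harmless_def C'_def[symmetric]
      by (intro exI[of _ "n - t"]) (auto simp: C'_def)
  qed
qed

definition harm :: "config \<Rightarrow> nat \<Rightarrow> real" where
  "harm C q = (if leader (C q) = 1 \<or> harmless C q then 0 else 2 ^ (N - dist (C q)))"

definition harm_wt :: "config \<Rightarrow> nat \<Rightarrow> real" where
  "harm_wt C q = (if bullet (C q) > 0 then 5 * harm C q else harm C q)"

definition harm_pot :: "config \<Rightarrow> real" where
  "harm_pot C = (\<Sum>q<n. harm_wt C q)"

lemma harm_nonneg: "0 \<le> harm C q" by (simp add: harm_def)

lemma harm_same_dist:
  assumes C: "calm C" and i: "i < n" and q: "q < n"
    and L: "leader (step_arc N n C i q) = leader (C q)"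
    and d: "leader (C q) = 0 \<Longrightarrow> dist (step_arc N n C i q) = dist (C q)"
  shows "harm (step_arc N n C i) q \<le> harm C q"
proof (cases "leader (C q) = 1")
  case False
  then have "leader (C q) = 0" using leader_cases[OF valid_Q[OF calm_valid[OF C] q]] by simp
  then show ?thesis using harmless_step[OF C i q] d L by (auto simp: harm_def)
qed (simp add: harm_def L)

lemma harm_initiator:
  assumes C: "calm C" and i: "i < n"
  shows "harm (step_arc N n C i) i \<le> harm C i"
proof (rule harm_same_dist[OF C i i])
  note t = trans_initiator[OF valid_Q[OF calm_valid[OF C] i] valid_Q[OF calm_valid[OF C] Suc_lt] N_ge_2]
  show "leader (step_arc N n C i i) = leader (C i)" by (simp add: step_arc_initiator[OF i] t)
  show "leader (C i) = 0 \<Longrightarrow> dist (step_arc N n C i i) = dist (C i)"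
    by (simp add: step_arc_initiator[OF i] t eff_dist_def)
qed

lemma harm_responder:
  assumes C: "calm C" and i: "i < n"
  defines "j \<equiv> Suc i mod n"
  shows "harm (step_arc N n C i) j \<le> (if bullet (C j) > 0 then harm C j else harm C i / 2)"
    and "bullet (C j) = 0 \<Longrightarrow> leader (C j) = 0 \<Longrightarrow> \<not> creates N (C i) (C j) \<Longrightarrow>
      bullet (step_arc N n C i j) = shot (C i)"
    and "leader (C j) = 1 \<or> creates N (C i) (C j) \<Longrightarrow> harm (step_arc N n C i) j = 0"
proof -
  define C' where "C' = step_arc N n C i"
  note v = calm_valid[OF C]
  have jn: "j < n" "j \<noteq> i" using Suc_lt Suc_mod_neq[OF i] by (auto simp: j_def)
  note q = valid_Q[OF v i] valid_Q[OF v jn(1)] N_ge_2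
  have C'j: "C' j = snd (trans N (C i) (C j))" by (simp add: C'_def j_def step_arc_responder)
  show zero: "harm C' j = 0" if "leader (C j) = 1 \<or> creates N (C i) (C j)"
  proof (cases "kills (C i) (C j)")
    case True
    then have L: "leader (C j) = 1" by (simp add: kills_def)
    from True obtain A m where A: "A < n" "(A + m) mod n = i" "Suc m < n" "leader (C A) = 1"
      using kill_swept[OF C i] unfolding j_def by metis
    have pA: "j = (A + Suc m) mod n" using A(2) by (metis add_Suc_right mod_Suc_eq j_def)
    have "A \<noteq> j" using pA offset_eq_iff[of 0 "Suc m" A] A(1,3) n_pos by auto
    then have LA: "leader (C' A) = 1"
      using leader_step[OF v i A(1,4)] by (auto simp: C'_def j_def)
    have "(j + (n - Suc m)) mod n = (A + Suc m + (n - Suc m)) mod n" using pA by (metis mod_add_left_eq)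
    also have "\<dots> = A" using A by simp
    finally have "leader (ag C' j (n - Suc m)) = 1" using LA by (simp add: ag_def)
    moreover have "dist (C' j) = 0" by (simp add: C'j trans_leader[OF q L])
    moreover have "1 \<le> n - Suc m" "n - Suc m \<le> n" "n - Suc m \<le> N" using A(3) n_le_N by auto
    ultimately have "harmless C' j" unfolding harmless_def by (intro exI[of _ "n - Suc m"]) simp
    then show ?thesis by (simp add: harm_def)
  next
    case False
    then have "leader (C' j) = 1" using that by (auto simp: C'j trans_leader[OF q] trans_create[OF q])
    then show ?thesis by (simp add: harm_def)
  qed
  show "bullet (C' j) = shot (C i)" if "bullet (C j) = 0" "leader (C j) = 0" "\<not> creates N (C i) (C j)"
    using that by (simp add: C'j trans_follower[OF q])
  show "harm C' j \<le> (if bullet (C j) > 0 then harm C j else harm C i / 2)"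
  proof (cases "leader (C j) = 1 \<or> creates N (C i) (C j)")
    case True
    then show ?thesis using zero harm_nonneg by simp
  next
    case False
    then have F: "leader (C j) = 0" "\<not> creates N (C i) (C j)" using leader_cases[OF q(2)] by auto
    note t = trans_follower[OF q F]
    show ?thesis
    proof (cases "bullet (C j) > 0")
      case True
      then have "harm C' j \<le> harm C j" unfolding C'_def
        by (intro harm_same_dist[OF C i jn(1)]) (simp_all add: C'j[unfolded C'_def] t F)
      then show ?thesis using True by simp
    next
      case False
      then have d: "dist (C' j) = Suc (eff_dist (C i))" and L': "leader (C' j) = 0" by (simp_all add: C'j t)
      have lt: "Suc (eff_dist (C i)) < N" using F False by (simp add: creates_def)
      have "harm C' j \<le> harm C i / 2"
      proof (cases "leader (C i) = 1 \<or> harmless C i")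
        case False
        then have "eff_dist (C i) = dist (C i)" by (simp add: eff_dist_def)
        moreover from this lt have "N - dist (C i) = Suc (N - Suc (dist (C i)))" by simp
        ultimately show ?thesis using False d by (simp add: harm_def)
      next
        case True
        have "harmless C' j"
        proof (cases "leader (C i) = 1")
          case True
          then have "leader (C' i) = 1" using leader_step_other[OF v i i] jn by (simp add: C'_def j_def)
          moreover have "(j + (n - 1)) mod n = i"
          proof -
            have "(j + (n - 1)) mod n = (Suc i + (n - 1)) mod n" by (simp add: j_def mod_simps)
            then show ?thesis using i n_pos by simp
          qed
          moreover have "dist (C' j) = 1" using d True by (simp add: eff_dist_def)
          ultimately show ?thesis unfolding harmless_def
            using n_ge_2 n_le_N by (intro exI[of _ "n - 1"]) (auto simp: ag_def)
        next
          case False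
          with True obtain k where k: "1 \<le> k" "k \<le> n" "leader (ag C i k) = 1" "dist (C i) + k \<le> N"
            by (auto simp: harmless_def)
          have "k \<noteq> 1" using k(3) F(1) by (auto simp: ag_def j_def)
          define p where "p = (i + k) mod n"
          have p: "p < n" "leader (C p) = 1" using k n_pos by (auto simp: p_def ag_def)
          then have "p \<noteq> j" using F(1) by auto
          then have "leader (C' p) = 1" using leader_step[OF v i p] by (auto simp: C'_def j_def)
          moreover have "(j + (k - 1)) mod n = p"
          proof -
            have "(j + (k - 1)) mod n = (Suc i + (k - 1)) mod n" by (simp add: j_def mod_simps)
            then show ?thesis using k(1) by (simp add: p_def)
          qed
          ultimately show ?thesis unfolding harmless_def
            using k d \<open>k \<noteq> 1\<close> False by (intro exI[of _ "k - 1"]) (auto simp: ag_def eff_dist_def)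
        qed
        then show ?thesis using harm_nonneg by (simp add: harm_def)
      qed
      then show ?thesis using False by simp
    qed
  qed
qed

definition harm_gain_init :: "config \<Rightarrow> nat \<Rightarrow> real" where
  "harm_gain_init C i = (if bullet (C i) > 0 then - 3 / 2 * harm C i else harm C i / 2)"

definition harm_gain_resp :: "config \<Rightarrow> nat \<Rightarrow> real" where
  "harm_gain_resp C j = (if bullet (C j) > 0 then 0 else - harm C j)"

lemma harm_pot_step:
  assumes C: "calm C" and i: "i < n"
  shows "harm_pot (step_arc N n C i) \<le> harm_pot C + harm_gain_init C i + harm_gain_resp C (Suc i mod n)"
proof -
  define C' where "C' = step_arc N n C i"
  define j where "j = Suc i mod n"
  note v = calm_valid[OF C]
  have jn: "j < n" "j \<noteq> i" using Suc_lt Suc_mod_neq[OF i] by (auto simp: j_def)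
  note q = valid_Q[OF v i] valid_Q[OF v jn(1)] N_ge_2
  note hr = harm_responder[OF C i, folded j_def C'_def]
  have hi: "harm_wt C' i \<le> harm C i"
    using harm_initiator[OF C i]
    by (simp add: harm_wt_def C'_def step_arc_initiator[OF i] trans_initiator[OF q(1) valid_Q[OF v Suc_lt] q(3)])
  have ot: "harm_wt C' p \<le> harm_wt C p" if "p < n" "p \<noteq> i" "p \<noteq> j" for p
  proof -
    have e: "C' p = C p" using that by (simp add: C'_def j_def step_arc_other)
    then have "harm C' p \<le> harm C p"
      unfolding C'_def by (intro harm_same_dist[OF C i that(1)]) simp_all
    then show ?thesis using e by (simp add: harm_wt_def)
  qed
  let ?y = "if bullet (C j) > 0 then 0 else (if bullet (C i) > 0 then 5 / 2 * harm C i else harm C i / 2) - harm C j"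
  have "harm_wt C' j \<le> harm_wt C j + ?y"
  proof (cases "leader (C j) = 1 \<or> creates N (C i) (C j)")
    case True
    then have "harm C' j = 0" using hr(3) by simp
    then show ?thesis using harm_nonneg[of C j] harm_nonneg[of C i] by (simp add: harm_wt_def)
  next
    case False
    then have F: "leader (C j) = 0" "\<not> creates N (C i) (C j)" using leader_cases[OF q(2)] by auto
    show ?thesis
    proof (cases "bullet (C j) > 0")
      case True
      then have "bullet (C' j) > 0" using trans_follower[OF q F] by (simp add: C'_def j_def step_arc_responder)
      then show ?thesis using True hr(1) by (simp add: harm_wt_def)
    next
      case b: False
      then have b': "bullet (C' j) = shot (C i)" using hr(2) F by simp
      show ?thesis
      proof (cases "leader (C i) = 1")
        case True
        then have "harm C i = 0" by (simp add: harm_def)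
        then have "harm C' j = 0" using hr(1) b harm_nonneg[of C' j] by simp
        then show ?thesis using \<open>harm C i = 0\<close> b by (simp add: harm_wt_def)
      next
        case False
        then have "shot (C i) = bullet (C i)" by (simp add: shot_def fires_def)
        then show ?thesis using hr(1) b b' harm_nonneg[of C' j] by (simp add: harm_wt_def)
      qed
    qed
  qed
  moreover have "harm_wt C' i \<le> harm_wt C i + (harm C i - harm_wt C i)" using hi by simp
  ultimately have "harm_pot C' \<le> harm_pot C + (harm C i - harm_wt C i) + ?y"
    unfolding harm_pot_def j_def by (intro sum_change[OF i]) (use ot in \<open>auto simp: j_def\<close>)
  also have "\<dots> \<le> harm_pot C + harm_gain_init C i + harm_gain_resp C j"
    using harm_nonneg[of C i] by (simp add: harm_gain_init_def harm_gain_resp_def harm_wt_def)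
  finally show ?thesis by (simp add: C'_def j_def)
qed

lemma harm_pot_sum:
  assumes "calm C"
  shows "(\<Sum>i<n. harm_pot (step_arc N n C i)) \<le> (real n - 3 / 10) * harm_pot C"
proof -
  have "(\<Sum>i<n. harm_pot (step_arc N n C i))
      \<le> (\<Sum>i<n. harm_pot C + harm_gain_init C i + harm_gain_resp C (Suc i mod n))"
    by (intro sum_mono harm_pot_step[OF assms]) simp
  also have "\<dots> = real n * harm_pot C + (\<Sum>i<n. harm_gain_init C i + harm_gain_resp C i)"
    using sum_Suc_mod[of "harm_gain_resp C"] by (simp add: sum.distrib)
  also have "(\<Sum>i<n. harm_gain_init C i + harm_gain_resp C i) \<le> (\<Sum>i<n. - (3 / 10) * harm_wt C i)"
  proof (rule sum_mono)
    fix i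
    show "harm_gain_init C i + harm_gain_resp C i \<le> - (3 / 10) * harm_wt C i"
      using harm_nonneg[of C i] by (simp add: harm_gain_init_def harm_gain_resp_def harm_wt_def)
  qed
  also have "\<dots> = - (3 / 10) * harm_pot C" by (simp add: harm_pot_def sum_distrib_left)
  finally show ?thesis by (simp add: algebra_simps)
qed

lemma harm_wt_cases: "harm_wt C p = 0 \<or> 1 \<le> harm_wt C p"
proof -
  have "harm C p = 0 \<or> 1 \<le> harm C p" by (simp add: harm_def)
  then show ?thesis by (auto simp: harm_wt_def)
qed

lemma harm_pot_cases: "harm_pot C = 0 \<or> 1 \<le> harm_pot C"
  unfolding harm_pot_def by (rule sum_eq_0_or_ge_1) (use harm_wt_cases in auto)

lemma harm_pot_le: "harm_pot C \<le> 2 ^ (2 * N + 3)"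
proof -
  have "harm_wt C p \<le> 8 * 2 ^ N" for p
  proof -
    have "(2::real) ^ (N - dist (C p)) \<le> 2 ^ N" by (simp add: power_increasing)
    moreover have "(0::real) \<le> 2 ^ N" by simp
    ultimately have "5 * (2::real) ^ (N - dist (C p)) \<le> 8 * 2 ^ N" "(2::real) ^ (N - dist (C p)) \<le> 8 * 2 ^ N"
      by linarith+
    then show ?thesis by (simp add: harm_wt_def harm_def)
  qed
  then have "harm_pot C \<le> (\<Sum>p<n. 8 * 2 ^ N)" unfolding harm_pot_def by (intro sum_mono)
  also have "\<dots> = real n * (8 * 2 ^ N)" by simp
  also have "\<dots> \<le> 2 ^ N * (8 * 2 ^ N)" using n_le_power by (intro mult_right_mono) auto
  also have "(8::real) = 2 ^ 3" by simp
  also have "(2::real) ^ N * (2 ^ 3 * 2 ^ N) = 2 ^ (N + (3 + N))" unfolding power_add ..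
  also have "N + (3 + N) = 2 * N + 3" by simp
  finally show ?thesis .
qed

definition settled :: "config \<Rightarrow> bool" where
  "settled C \<longleftrightarrow> calm C \<and> harm_pot C = 0"

lemma settledD:
  assumes "settled C" "q < n"
  shows "leader (C q) = 1 \<or> harmless C q"
proof -
  have "0 \<le> harm_wt C p" for p using harm_nonneg[of C p] by (simp add: harm_wt_def)
  then have "harm_wt C q = 0"
    using assms by (auto simp: settled_def harm_pot_def sum_nonneg_eq_0_iff)
  then show ?thesis by (auto simp: harm_wt_def harm_def split: if_splits)
qed

lemma settled_step:
  assumes S: "settled C" and i: "i < n"
  shows "settled (step_arc N n C i)"
proof -
  have C: "calm C" using S by (simp add: settled_def)
  have "harm C i = 0" using settledD[OF S i] by (auto simp: harm_def)
  then have "harm_gain_init C i = 0" by (simp add: harm_gain_init_def)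
  moreover have "harm_gain_resp C (Suc i mod n) \<le> 0" using harm_nonneg by (simp add: harm_gain_resp_def)
  ultimately have "harm_pot (step_arc N n C i) \<le> 0"
    using harm_pot_step[OF C i] S by (simp add: settled_def)
  then show ?thesis using harm_pot_cases[of "step_arc N n C i"] calm_step[OF C i] by (auto simp: settled_def)
qed

lemma settled_leader: "settled C \<Longrightarrow> \<exists>q<n. leader (C q) = 1"
  using settledD[of C 0] n_pos by (auto simp: harmless_def ag_def intro: mod_less_divisor)

lemma settled_no_create:
  assumes S: "settled C" and i: "i < n"
  shows "\<not> creates N (C i) (C (Suc i mod n))"
proof
  define j where "j = Suc i mod n"
  assume cr: "creates N (C i) (C (Suc i mod n))"
  then have L: "leader (C j) = 0" by (simp add: creates_def j_def)
  have jn: "j < n" using Suc_lt by (simp add: j_def)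
  show False
  proof (cases "bullet (C j) = 0")
    case True
    then have N: "N \<le> Suc (eff_dist (C i))" using cr by (simp add: creates_def j_def)
    then have nl: "leader (C i) \<noteq> 1" using N_ge_2 by (auto simp: eff_dist_def)
    then obtain k where k: "1 \<le> k" "leader (ag C i k) = 1" "dist (C i) + k \<le> N"
      using settledD[OF S i] by (auto simp: harmless_def)
    have "k \<noteq> 1" using k(2) L by (auto simp: ag_def j_def)
    then show False using k N nl by (simp add: eff_dist_def)
  next
    case False
    then have "dist (C j) = N" using cr by (simp add: creates_def j_def)
    then show False using settledD[OF S jn] L by (auto simp: harmless_def)
  qed
qed

lemma settled_follower_stays:
  assumes S: "settled C" and i: "i < n" and q: "q < n" and L: "leader (C q) = 0"
  shows "leader (step_arc N n C i q) = 0"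
proof (cases "q = Suc i mod n")
  case True
  have v: "valid C" using S by (simp add: settled_def calm_def)
  show ?thesis
    using trans_follower(1)[OF valid_Q[OF v i] valid_Q[OF v q] N_ge_2 L] settled_no_create[OF S i] True
    by (simp add: step_arc_responder)
next
  case False
  then show ?thesis using leader_step_other[OF _ i q] S L by (simp add: settled_def calm_def)
qed

lemma settled_unique_safe:
  assumes S: "settled C" and u: "\<exists>!q. q < n \<and> leader (C q) = 1"
  shows "safe N n C"
proof -
  have inv: "settled D' \<and> (\<forall>q<n. leader (D' q) = leader (C q))"
    if D: "settled D \<and> (\<forall>q<n. leader (D q) = leader (C q))" and st: "step N n D D'" for D D'
  proof -
    from st obtain i where i: "i < n" "D' = step_arc N n D i" by (auto simp: step_def)
    have calm: "calm D" and v: "valid D" using D by (simp_all add: settled_def calm_def)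
    have nk: "\<not> kills (D i) (D (Suc i mod n))"
    proof
      assume k: "kills (D i) (D (Suc i mod n))"
      then obtain A m where A: "A < n" "(A + m) mod n = i" "Suc m < n" "leader (D A) = 1"
        using kill_swept[OF calm i(1)] by metis
      have "Suc i mod n = (A + Suc m) mod n" using A(2) by (metis add_Suc_right mod_Suc_eq)
      then have "A \<noteq> Suc i mod n" using offset_eq_iff[of 0 "Suc m" A] A(1,3) n_pos by auto
      moreover have "leader (D (Suc i mod n)) = 1" using k by (simp add: kills_def)
      ultimately show False using u D A Suc_lt by metis
    qed
    have "leader (D' q) = leader (D q)" if "q < n" for q
    proof (cases "leader (D q) = 1")
      case True
      then show ?thesis using leader_step[OF v i(1) that] nk i by auto
    next
      case False
      then have "leader (D q) = 0" using leader_cases[OF valid_Q[OF v that]] by simp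
      then show ?thesis using settled_follower_stays[of D i q] D i that by simp
    qed
    then show ?thesis using D settled_step[of D i] i by simp
  qed
  have "settled C' \<and> (\<forall>q<n. leader (C' q) = leader (C q))" if "reachable N n C C'" for C'
    using that unfolding reachable_def
  proof (induction rule: rtranclp_induct)
    case base
    show ?case using S by simp
  next
    case (step D D')
    from step.IH step.hyps(2) show ?case by (rule inv)
  qed
  then show ?thesis using u by (simp add: safe_def outputs_L_def)
qed

end

section \<open>A symmetric race\<close>

text \<open>\<open>race y x\<close> is the probability that, of two counters one of which is decreased per coin flip, the one
  started at \<open>x\<close> reaches \<open>0\<close> before the one started at \<open>y\<close>. It serves as an exact martingale for a
  bullet at distance \<open>y\<close> from a leader that fires again after \<open>x\<close> moves.\<close>

fun race :: "nat \<Rightarrow> nat \<Rightarrow> real" where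
  "race y 0 = 1"
| "race 0 (Suc x) = 0"
| "race (Suc y) (Suc x) = (race y (Suc x) + race (Suc y) x) / 2"

lemma race_bounds: "0 \<le> race y x \<and> race y x \<le> 1"
  by (induction y x rule: race.induct) auto

lemma race_nonneg: "0 \<le> race y x" and race_le_1: "race y x \<le> 1"
  using race_bounds by auto

lemma race_shift: "race y (Suc x) \<le> race (Suc y) x"
proof (induction "y + x" arbitrary: y x rule: less_induct)
  case less
  show ?case
  proof (cases y)
    case 0
    then show ?thesis using race_nonneg by simp
  next
    case y: (Suc y')
    show ?thesis
    proof (cases x)
      case 0
      then show ?thesis using race_le_1 by simp
    next
      case x: (Suc x')
      have "race y' (Suc x) \<le> race (Suc y') x" using less[of y' x] y by simp
      moreover have "race y (Suc x') \<le> race (Suc y) x'" using less[of y x'] x by simp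
      ultimately show ?thesis using y x by simp
    qed
  qed
qed

lemma race_mono_y: "y \<le> y' \<Longrightarrow> race y x \<le> race y' x"
proof (rule lift_Suc_mono_le[of "\<lambda>y. race y x"])
  show "race y x \<le> race (Suc y) x" for y
  proof (cases x)
    case (Suc x')
    then show ?thesis using race_shift[of y x'] by simp
  qed simp
qed

lemma race_antimono_x: "x \<le> x' \<Longrightarrow> race y x' \<le> race y x"
proof (rule lift_Suc_antimono_le[of "\<lambda>x. race y x"])
  show "race y (Suc x) \<le> race y x" for x
  proof (cases y)
    case 0
    then show ?thesis using race_nonneg by simp
  next
    case (Suc y')
    then show ?thesis using race_shift[of y' x] by simp
  qed
qed

lemma race_symmetric: "race (Suc y) (Suc x) + race (Suc x) (Suc y) = 1"
proof (induction "y + x" arbitrary: y x rule: less_induct)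
  case less
  have "race y (Suc x) + race (Suc x) y = 1"
  proof (cases y)
    case (Suc y')
    then show ?thesis using less[of y' x] by simp
  qed simp
  moreover have "race (Suc y) x + race x (Suc y) = 1"
  proof (cases x)
    case (Suc x')
    then show ?thesis using less[of y x'] by simp
  qed simp
  ultimately show ?case by (simp only: race.simps(3)) argo
qed

lemma race_diag: "race (Suc x) (Suc x) = 1 / 2"
  using race_symmetric[of x x] by linarith

lemma race_ge_half: "x \<le> y \<Longrightarrow> 1 / 2 \<le> race y x"
proof (cases x)
  case (Suc x')
  assume "x \<le> y"
  then have "race x x \<le> race y x" by (rule race_mono_y)
  then show ?thesis using race_diag[of x'] Suc by simp
qed simp

lemma race_le_half: "y \<le> x \<Longrightarrow> 0 < x \<Longrightarrow> race y x \<le> 1 / 2"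
proof (cases x)
  case (Suc x')
  assume "y \<le> x"
  then have "race y x \<le> race x x" by (rule race_mono_y)
  then show ?thesis using race_diag[of x'] Suc by simp
qed simp

text \<open>The exact probability of a hit would be \<open>1 - race y x / 2\<close> for an unshielded and \<open>race y x / 2\<close> for a
  shielded target. Crediting a target that fires again with \<open>1 / 4\<close> instead of \<open>1 / 2\<close> leaves a strict gain
  whenever it does.\<close>

definition hit_value :: "nat \<Rightarrow> nat \<Rightarrow> nat \<Rightarrow> real" where
  "hit_value sh y x = (if sh = 0 then 1 - 3 / 4 * race y x else race y x / 4)"

lemma hit_value_bounds: "0 \<le> hit_value sh y x" "hit_value sh y x \<le> 1"
  using race_nonneg[of y x] race_le_1[of y x] by (auto simp: hit_value_def)

lemma hit_value_harmonic:
  "hit_value sh y (Suc x) + hit_value sh (Suc y) x = 2 * hit_value sh (Suc y) (Suc x)"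
  by (simp add: hit_value_def field_simps)

lemma hit_value_x0: "hit_value sh y 0 = 1 / 4"
  by (simp add: hit_value_def)

section \<open>Segments between consecutive leaders\<close>

text \<open>Offsets are counted from the leader at the start of the segment, \<open>g\<close> is the offset of the next
  leader, and \<open>b\<close>, \<open>s\<close> are the bullets and signals. Only the first object matters for the next shot: a
  bullet has to run to the end and its signal back, a signal has to run back.\<close>

definition first_obj :: "nat \<Rightarrow> (nat \<Rightarrow> nat) \<Rightarrow> (nat \<Rightarrow> nat) \<Rightarrow> nat" where
  "first_obj g b s = (LEAST k. k = g \<or> b k > 0 \<or> s k > 0)"

definition fire_time :: "nat \<Rightarrow> (nat \<Rightarrow> nat) \<Rightarrow> (nat \<Rightarrow> nat) \<Rightarrow> nat" where
  "fire_time g b s = (let k = first_obj g b s in if k < g \<and> b k > 0 then 2 * g - k else k + 1)"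

text \<open>Dirt \<open>2\<close> means that the leader will fire behind an old bullet, dirt \<open>1\<close> that there are several bullets
  which merge before the next shot.\<close>

definition dirt :: "nat \<Rightarrow> (nat \<Rightarrow> nat) \<Rightarrow> (nat \<Rightarrow> nat) \<Rightarrow> nat" where
  "dirt g b s = (let k = first_obj g b s in
     if \<forall>j<g. j \<noteq> k \<longrightarrow> b j = 0 then 0 else if k < g \<and> b k > 0 then 1 else 2)"

definition armed :: "nat \<Rightarrow> (nat \<Rightarrow> nat) \<Rightarrow> (nat \<Rightarrow> nat) \<Rightarrow> bool" where
  "armed g b s \<longleftrightarrow> first_obj g b s < g \<and> b (first_obj g b s) = 2"

definition next_hop :: "nat \<Rightarrow> (nat \<Rightarrow> nat) \<Rightarrow> (nat \<Rightarrow> nat) \<Rightarrow> nat" where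
  "next_hop g b s = (let k = first_obj g b s in if k < g \<and> b k > 0 then k else k - 1)"

definition is_first :: "nat \<Rightarrow> (nat \<Rightarrow> nat) \<Rightarrow> (nat \<Rightarrow> nat) \<Rightarrow> nat \<Rightarrow> bool" where
  "is_first g b s k \<longleftrightarrow> k \<le> g \<and> (\<forall>j<k. b j = 0 \<and> s j = 0) \<and> (k < g \<longrightarrow> b k > 0 \<or> s k > 0)"

lemma first_objI: "is_first g b s k \<Longrightarrow> first_obj g b s = k"
  unfolding first_obj_def
proof (rule Least_equality)
  assume k: "is_first g b s k"
  then show "k = g \<or> b k > 0 \<or> s k > 0" by (auto simp: is_first_def)
  fix j assume "j = g \<or> b j > 0 \<or> s j > 0"
  then show "k \<le> j" using k by (cases "j < k") (auto simp: is_first_def)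
qed

lemma first_obj_is_first: "is_first g b s (first_obj g b s)"
proof -
  let ?P = "\<lambda>k. k = g \<or> b k > 0 \<or> s k > 0"
  have "?P (first_obj g b s)" "first_obj g b s \<le> g" unfolding first_obj_def
    by (rule LeastI[of ?P g], simp) (rule Least_le, simp)
  moreover have "\<not> ?P j" if "j < first_obj g b s" for j
    using not_less_Least[of j ?P] that unfolding first_obj_def by blast
  ultimately show ?thesis by (auto simp: is_first_def)
qed

lemma first_obj_cong:
  assumes "\<And>k. k < g \<Longrightarrow> b k = b' k \<and> s k = s' k"
  shows "first_obj g b s = first_obj g b' s'"
  using first_obj_is_first[of g b' s'] assms by (intro first_objI) (auto simp: is_first_def)

lemma segment_cong:
  assumes "\<And>k. k < g \<Longrightarrow> b k = b' k \<and> s k = s' k"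
  shows "fire_time g b s = fire_time g b' s'" "dirt g b s = dirt g b' s'"
    "armed g b s = armed g b' s'"
proof -
  have f: "first_obj g b s = first_obj g b' s'" using assms by (rule first_obj_cong)
  have b: "k < g \<Longrightarrow> b k = b' k" for k using assms by blast
  show "fire_time g b s = fire_time g b' s'" "armed g b s = armed g b' s'"
    unfolding fire_time_def armed_def f Let_def using b[of "first_obj g b' s'"] by (auto split: if_splits)
  have all: "(\<forall>j<g. j \<noteq> k \<longrightarrow> b j = 0) \<longleftrightarrow> (\<forall>j<g. j \<noteq> k \<longrightarrow> b' j = 0)" for k using b by metis
  show "dirt g b s = dirt g b' s'"
  proof (cases "first_obj g b' s' < g")
    case True
    show ?thesis unfolding dirt_def f Let_def all b[OF True] by (rule refl)
  next
    case False
    then show ?thesis unfolding dirt_def f Let_def all by simp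
  qed
qed

definition tidy :: "nat \<Rightarrow> (nat \<Rightarrow> nat) \<Rightarrow> (nat \<Rightarrow> nat) \<Rightarrow> bool" where
  "tidy g b s \<longleftrightarrow> 1 \<le> g \<and> (\<forall>k<g. s k \<le> 1 \<and> \<not> (b k > 0 \<and> s k > 0))"

text \<open>The effect of an interaction on a segment with \<open>g\<close> agents: code \<open>e < g\<close> is the arc whose
  initiator has offset \<open>e\<close>, code \<open>g\<close> is the arc whose responder is the leader at offset \<open>0\<close>, and
  every larger code is an arc elsewhere.\<close>

definition seg_shot :: "(nat \<Rightarrow> nat) \<Rightarrow> (nat \<Rightarrow> nat) \<Rightarrow> nat \<Rightarrow> nat" where
  "seg_shot b s e = (if e = 0 \<and> s 0 = 1 then 2 else b e)"

definition seg_bullet :: "nat \<Rightarrow> nat \<Rightarrow> (nat \<Rightarrow> nat) \<Rightarrow> (nat \<Rightarrow> nat) \<Rightarrow> nat \<Rightarrow> nat" where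
  "seg_bullet g e b s k =
     (if e < g then if k = e then 0 else if k = Suc e \<and> b k = 0 then seg_shot b s e else b k
      else if e = g \<and> k = 0 \<and> s 0 = 1 then 1 else b k)"

definition seg_signal :: "nat \<Rightarrow> nat \<Rightarrow> (nat \<Rightarrow> nat) \<Rightarrow> (nat \<Rightarrow> nat) \<Rightarrow> nat \<Rightarrow> nat" where
  "seg_signal g e b s k =
     (if e < g then
        if k = e then if Suc e = g then 1
          else max (if e = 0 \<and> s 0 = 1 then 0 else s e) (if seg_shot b s e > 0 then 0 else s (Suc e))
        else if k = Suc e then if seg_shot b s e > 0 then 0 else s k else s k
      else if e = g \<and> k = 0 then 0 else s k)"

lemma fire_time_bounds:
  assumes "1 \<le> g"
  shows "1 \<le> fire_time g b s" "fire_time g b s \<le> 2 * g"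
  using assms first_obj_is_first[of g b s]
  by (auto simp: fire_time_def Let_def is_first_def)

lemma fire_time_1: "tidy g b s \<Longrightarrow> fire_time g b s = 1 \<longleftrightarrow> s 0 = 1"
proof -
  assume t: "tidy g b s"
  define k where "k = first_obj g b s"
  have k: "is_first g b s k" using first_obj_is_first by (simp add: k_def)
  show ?thesis
  proof (cases "k = 0")
    case True
    then show ?thesis using t k unfolding fire_time_def k_def[symmetric] Let_def
      by (auto simp: is_first_def tidy_def le_Suc_eq)
  next
    case False
    then have "s 0 = 0" using k by (auto simp: is_first_def)
    then show ?thesis using False k by (auto simp: fire_time_def k_def[symmetric] Let_def is_first_def)
  qed
qed

lemma dirt_le_2: "dirt g b s \<le> 2" by (simp add: dirt_def Let_def)

lemma armed_fire_time: "armed g b s \<Longrightarrow> g < fire_time g b s"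
  by (auto simp: armed_def fire_time_def Let_def)

lemma dirt_1_time: "dirt g b s = 1 \<Longrightarrow> 2 \<le> fire_time g b s"
proof -
  assume d: "dirt g b s = 1"
  have "first_obj g b s < g \<and> b (first_obj g b s) > 0"
    by (rule ccontr) (use d in \<open>simp add: dirt_def Let_def split: if_split_asm\<close>)
  then have "fire_time g b s = 2 * g - first_obj g b s" "first_obj g b s < g" by (simp_all add: fire_time_def)
  then show ?thesis by linarith
qed

lemma next_hop_less:
  assumes "tidy g b s" shows "next_hop g b s < g"
  using assms first_obj_is_first[of g b s] by (auto simp: next_hop_def Let_def is_first_def tidy_def)

lemma armed_next_hop:
  assumes "armed g b s" "fire_time g b s = g + 1"
  shows "next_hop g b s = g - 1"
  using assms by (auto simp: armed_def fire_time_def next_hop_def Let_def)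

lemma seg_step_signal:
  fixes e :: nat
  assumes t: "tidy g b s" and k: "is_first g b s k" "k = g \<or> b k = 0" "1 \<le> k"
  defines "b' \<equiv> seg_bullet g e b s" and "s' \<equiv> seg_signal g e b s"
  shows "is_first g b' s' (if e = k - 1 then k - 1 else k) \<and>
    (let k' = (if e = k - 1 then k - 1 else k) in k' = g \<or> b' k' = 0) \<and>
    ((\<forall>j<g. b j = 0) \<longrightarrow> (\<forall>j<g. b' j = 0))"
proof -
  have z: "\<And>j. j < k \<Longrightarrow> b j = 0 \<and> s j = 0" and kg: "k \<le> g" using k by (auto simp: is_first_def)
  have sk: "k < g \<Longrightarrow> s k = 1" using k t by (auto simp: is_first_def tidy_def le_Suc_eq)
  have s0: "s 0 = 0" and b0: "b 0 = 0" using z[of 0] k by auto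
  have shot: "seg_shot b s e = b e" using s0 by (simp add: seg_shot_def)
  have nb: "(\<forall>j<g. b j = 0) \<longrightarrow> (\<forall>j<g. b' j = 0)" by (auto simp: b'_def seg_bullet_def shot s0)
  consider "e = k - 1" | "e < k - 1" | "e = k" "e < g" | "k < e" "e < g" | "g \<le> e" using k kg by linarith
  then show ?thesis
  proof cases
    case 1
    then have "Suc e = k" "e < g" using k kg by auto
    then have "b' e = 0" "s' e = 1" "\<And>j. j < e \<Longrightarrow> b' j = 0 \<and> s' j = 0"
      using z sk kg s0 shot unfolding b'_def s'_def
      by (auto simp: seg_bullet_def seg_signal_def)
    then show ?thesis using 1 \<open>e < g\<close> nb by (auto simp: is_first_def Let_def)
  next
    case 2
    then have "Suc e < k" by simp
    then have "b' j = 0 \<and> s' j = 0" if "j < k" for j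
      using z[of j] z[of e] z[of "Suc e"] that kg s0 shot unfolding b'_def s'_def
      by (auto simp: seg_bullet_def seg_signal_def)
    moreover have "b' k = b k" "s' k = s k"
      using \<open>Suc e < k\<close> unfolding b'_def s'_def by (auto simp: seg_bullet_def seg_signal_def)
    ultimately show ?thesis using 2 k nb by (auto simp: is_first_def Let_def)
  next
    case 3
    then have "b' j = 0 \<and> s' j = 0" if "j < k" for j
      using z[of j] that unfolding b'_def s'_def by (auto simp: seg_bullet_def seg_signal_def)
    moreover have "b' k = 0" "s' k > 0"
      using 3 k sk unfolding b'_def s'_def by (auto simp: seg_bullet_def seg_signal_def)
    ultimately show ?thesis using 3 k nb by (auto simp: is_first_def Let_def)
  next
    case 4
    then have "b' j = b j \<and> s' j = s j" if "j \<le> k" for j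
      using that unfolding b'_def s'_def by (auto simp: seg_bullet_def seg_signal_def)
    then show ?thesis using 4 k nb by (auto simp: is_first_def Let_def)
  next
    case 5
    then have "b' j = b j \<and> s' j = s j" for j
      using s0 unfolding b'_def s'_def by (auto simp: seg_bullet_def seg_signal_def)
    then show ?thesis using 5 k kg nb by (auto simp: is_first_def Let_def)
  qed
qed

lemma seg_step_bullet:
  fixes e :: nat
  assumes t: "tidy g b s" and k: "is_first g b s k" "k < g" "b k > 0"
  defines "b' \<equiv> seg_bullet g e b s" and "s' \<equiv> seg_signal g e b s"
  shows "e \<noteq> k \<Longrightarrow> is_first g b' s' k \<and> b' k = b k"
    and "e = k \<Longrightarrow> Suc k < g \<Longrightarrow> is_first g b' s' (Suc k) \<and> b' (Suc k) > 0 \<and> (b (Suc k) = 0 \<longrightarrow> b' (Suc k) = b k)"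
    and "e = k \<Longrightarrow> Suc k = g \<Longrightarrow> is_first g b' s' k \<and> b' k = 0"
    and "(\<forall>j<g. j \<noteq> k \<longrightarrow> b j = 0) \<Longrightarrow> (\<forall>j<g. j \<noteq> (if e = k then Suc k else k) \<longrightarrow> b' j = 0)"
proof -
  have z: "\<And>j. j < k \<Longrightarrow> b j = 0 \<and> s j = 0" using k by (auto simp: is_first_def)
  have sk: "s k = 0" using k t by (auto simp: tidy_def)
  have s0: "s 0 = 0" using z[of 0] sk by (cases k) auto
  have shot: "seg_shot b s e = b e" for e using s0 by (simp add: seg_shot_def)
  show "is_first g b' s' k \<and> b' k = b k" if "e \<noteq> k"
  proof (cases "e < k")
    case True
    have "b' j = 0 \<and> s' j = 0" if "j < k" for j
      using z[of j] z[of e] z[of "Suc e"] sk True that k s0 shot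
      unfolding b'_def s'_def by (cases "Suc e = k") (auto simp: seg_bullet_def seg_signal_def)
    moreover have "b' k = b k"
      using True k unfolding b'_def by (auto simp: seg_bullet_def s0)
    ultimately show ?thesis using k by (auto simp: is_first_def)
  next
    case False
    then have "b' j = b j \<and> s' j = s j" if "j \<le> k" for j
      using that \<open>e \<noteq> k\<close> s0 unfolding b'_def s'_def by (auto simp: seg_bullet_def seg_signal_def)
    then show ?thesis using k by (auto simp: is_first_def)
  qed
  show "is_first g b' s' (Suc k) \<and> b' (Suc k) > 0 \<and> (b (Suc k) = 0 \<longrightarrow> b' (Suc k) = b k)" if "e = k" "Suc k < g"
  proof -
    have "b' j = 0 \<and> s' j = 0" if "j \<le> k" for j
      using z[of j] sk that k s0 shot \<open>e = k\<close> \<open>Suc k < g\<close>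
      unfolding b'_def s'_def by (cases "j = k") (auto simp: seg_bullet_def seg_signal_def)
    moreover have "b' (Suc k) > 0 \<and> (b (Suc k) = 0 \<longrightarrow> b' (Suc k) = b k)"
      using that k shot unfolding b'_def by (auto simp: seg_bullet_def)
    ultimately show ?thesis using that by (auto simp: is_first_def)
  qed
  show "is_first g b' s' k \<and> b' k = 0" if "e = k" "Suc k = g"
  proof -
    have "b' j = 0 \<and> s' j = 0" if "j < k" for j
      using z[of j] that k \<open>e = k\<close> unfolding b'_def s'_def by (auto simp: seg_bullet_def seg_signal_def)
    moreover have "b' k = 0" "s' k = 1"
      using that unfolding b'_def s'_def by (auto simp: seg_bullet_def seg_signal_def)
    ultimately show ?thesis using k by (auto simp: is_first_def)
  qed
  show "\<forall>j<g. j \<noteq> (if e = k then Suc k else k) \<longrightarrow> b' j = 0" if "\<forall>j<g. j \<noteq> k \<longrightarrow> b j = 0"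
    using that s0 shot unfolding b'_def by (auto simp: seg_bullet_def split: if_splits)
qed

lemma seg_step_fire:
  fixes e :: nat
  assumes t: "tidy g b s" and s0: "s 0 = 1"
  defines "b' \<equiv> seg_bullet g e b s" and "s' \<equiv> seg_signal g e b s"
  shows "e = 0 \<Longrightarrow> 2 \<le> g \<Longrightarrow> is_first g b' s' 1 \<and> b' 1 > 0 \<and> (b 1 = 0 \<longrightarrow> b' 1 = 2)"
    and "e = 0 \<Longrightarrow> g = 1 \<Longrightarrow> is_first g b' s' 0 \<and> b' 0 = 0"
    and "e = g \<Longrightarrow> is_first g b' s' 0 \<and> b' 0 = 1"
    and "e \<noteq> 0 \<Longrightarrow> e \<noteq> g \<Longrightarrow> is_first g b' s' 0 \<and> b' 0 = 0"
    and "\<forall>j<g. b j = 0 \<Longrightarrow> \<forall>j<g. \<not> (e = 0 \<and> j = 1 \<or> e = g \<and> j = 0) \<longrightarrow> b' j = 0"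
proof -
  have b0: "b 0 = 0" and g: "1 \<le> g" using t s0 by (auto simp: tidy_def)
  show "is_first g b' s' 1 \<and> b' 1 > 0 \<and> (b 1 = 0 \<longrightarrow> b' 1 = 2)" if "e = 0" "2 \<le> g"
    using that s0 b0 unfolding b'_def s'_def by (auto simp: is_first_def seg_bullet_def seg_signal_def seg_shot_def)
  show "is_first g b' s' 0 \<and> b' 0 = 0" if "e = 0" "g = 1"
    using that s0 b0 unfolding b'_def s'_def by (auto simp: is_first_def seg_bullet_def seg_signal_def seg_shot_def)
  show "is_first g b' s' 0 \<and> b' 0 = 1" if "e = g"
    using that s0 b0 g unfolding b'_def s'_def by (auto simp: is_first_def seg_bullet_def seg_signal_def seg_shot_def)
  show "is_first g b' s' 0 \<and> b' 0 = 0" if "e \<noteq> 0" "e \<noteq> g"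
    using that s0 b0 g unfolding b'_def s'_def by (auto simp: is_first_def seg_bullet_def seg_signal_def seg_shot_def)
  show "\<forall>j<g. \<not> (e = 0 \<and> j = 1 \<or> e = g \<and> j = 0) \<longrightarrow> b' j = 0" if "\<forall>j<g. b j = 0"
    using that unfolding b'_def by (auto simp: seg_bullet_def seg_shot_def split: if_splits)
qed

lemma fire_time_step:
  assumes t: "tidy g b s"
  shows "fire_time g (seg_bullet g e b s) (seg_signal g e b s) =
    (if fire_time g b s = 1 then if e = 0 then 2 * g - 1 else if e = g then 2 * g else 1
     else if e = next_hop g b s then fire_time g b s - 1 else fire_time g b s)"
proof -
  define k where "k = first_obj g b s"
  let ?b' = "seg_bullet g e b s" and ?s' = "seg_signal g e b s"
  have k: "is_first g b s k" using first_obj_is_first by (simp add: k_def)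
  have g: "1 \<le> g" and kg: "k \<le> g" using t k by (auto simp: tidy_def is_first_def)
  have X: "fire_time g b s = (if k < g \<and> b k > 0 then 2 * g - k else k + 1)"
    and H: "next_hop g b s = (if k < g \<and> b k > 0 then k else k - 1)"
    by (simp_all add: fire_time_def next_hop_def Let_def k_def)
  have X': "fire_time g ?b' ?s' = (if k' < g \<and> ?b' k' > 0 then 2 * g - k' else k' + 1)"
    if "is_first g ?b' ?s' k'" for k'
    using first_objI[OF that] by (simp add: fire_time_def Let_def)
  show ?thesis
  proof (cases "s 0 = 1")
    case True
    then have "fire_time g b s = 1" using fire_time_1[OF t] by simp
    moreover consider "e = 0" "2 \<le> g" | "e = 0" "g = 1" | "e = g" "e \<noteq> 0" | "e \<noteq> 0" "e \<noteq> g" using g by linarith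
    then have "fire_time g ?b' ?s' = (if e = 0 then 2 * g - 1 else if e = g then 2 * g else 1)"
    proof cases
      case 1
      then show ?thesis using seg_step_fire(1)[OF t True, where e = e] X'[of 1] by simp
    next
      case 2
      then show ?thesis using seg_step_fire(2)[OF t True, where e = e] X'[of 0] by simp
    next
      case 3
      then show ?thesis using seg_step_fire(3)[OF t True, where e = e] X'[of 0] g by simp
    next
      case 4
      then show ?thesis using seg_step_fire(4)[OF t True, where e = e] X'[of 0] by simp
    qed
    ultimately show ?thesis by simp
  next
    case False
    then have X1: "fire_time g b s \<noteq> 1" using fire_time_1[OF t] by simp
    show ?thesis
    proof (cases "k < g \<and> b k > 0")
      case True
      then show ?thesis
        using seg_step_bullet(1-3)[OF t k, where e = e] X1 X'[of k] X'[of "Suc k"] X H kg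
        by (cases "e = k"; cases "Suc k < g") auto
    next
      case nb: False
      then have "1 \<le> k" using X X1 by (cases k) auto
      moreover have "k = g \<or> b k = 0" using nb kg by auto
      ultimately show ?thesis
        using seg_step_signal[OF t k, where e = e] X1 X'[of k] X'[of "k - 1"] X H nb
        by (cases "e = k - 1") (auto simp: Let_def)
    qed
  qed
qed

lemma dirt_0_step:
  assumes t: "tidy g b s" and d: "dirt g b s = 0"
  shows "dirt g (seg_bullet g e b s) (seg_signal g e b s) = 0" (is ?A)
    and "armed g (seg_bullet g e b s) (seg_signal g e b s) \<longleftrightarrow>
      (if armed g b s then e \<noteq> next_hop g b s \<or> g + 1 < fire_time g b s
       else fire_time g b s = 1 \<and> e = 0 \<and> 2 \<le> g)" (is ?B)
proof -
  define k where "k = first_obj g b s"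
  let ?b' = "seg_bullet g e b s" and ?s' = "seg_signal g e b s"
  have k: "is_first g b s k" using first_obj_is_first by (simp add: k_def)
  have g: "1 \<le> g" and kg: "k \<le> g" using t k by (auto simp: tidy_def is_first_def)
  have only: "\<forall>j<g. j \<noteq> k \<longrightarrow> b j = 0" using d by (auto simp: dirt_def k_def Let_def split: if_splits)
  have X: "fire_time g b s = (if k < g \<and> b k > 0 then 2 * g - k else k + 1)"
    and H: "next_hop g b s = (if k < g \<and> b k > 0 then k else k - 1)"
    and A: "armed g b s \<longleftrightarrow> k < g \<and> b k = 2"
    by (simp_all add: fire_time_def next_hop_def armed_def Let_def k_def)
  have D': "dirt g ?b' ?s' = 0" if "is_first g ?b' ?s' k'" "\<forall>j<g. j \<noteq> k' \<longrightarrow> ?b' j = 0" for k'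
    using first_objI[OF that(1)] that(2) by (simp add: dirt_def Let_def)
  have A': "armed g ?b' ?s' \<longleftrightarrow> k' < g \<and> ?b' k' = 2" if "is_first g ?b' ?s' k'" for k'
    using first_objI[OF that] by (simp add: armed_def)
  have "?A \<and> ?B"
  proof (cases "s 0 = 1")
    case s0: True
    then have k0: "k = 0" and b0: "b 0 = 0" and X1: "fire_time g b s = 1"
      using fire_time_1[OF t] k t by (auto simp: is_first_def tidy_def)
    have nob: "\<forall>j<g. b j = 0" using only k0 b0 by auto
    note f5 = seg_step_fire(5)[OF t s0 nob, where e = e]
    consider "e = 0" "2 \<le> g" | "e = 0" "g = 1" | "e = g" "e \<noteq> 0" | "e \<noteq> 0" "e \<noteq> g" using g by linarith
    then show ?thesis
    proof cases
      case 1
      then show ?thesis using seg_step_fire(1)[OF t s0, where e = e] D'[of 1] A'[of 1] f5 g nob A k0 b0 X1 by auto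
    next
      case 2
      then show ?thesis using seg_step_fire(2)[OF t s0, where e = e] D'[of 0] A'[of 0] A k0 b0 by auto
    next
      case 3
      then show ?thesis using seg_step_fire(3)[OF t s0, where e = e] D'[of 0] A'[of 0] f5 A k0 b0 by auto
    next
      case 4
      then show ?thesis using seg_step_fire(4)[OF t s0, where e = e] D'[of 0] A'[of 0] f5 A k0 b0 by auto
    qed
  next
    case s0: False
    then have X1: "fire_time g b s \<noteq> 1" using fire_time_1[OF t] by simp
    show ?thesis
    proof (cases "k < g \<and> b k > 0")
      case True
      note f = seg_step_bullet[OF t k, where e = e]
      show ?thesis
      proof (cases "e = k")
        case False
        then have "dirt g ?b' ?s' = 0" "armed g ?b' ?s' \<longleftrightarrow> b k = 2"
          using f(1,4) True only D'[of k] A'[of k] by auto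
        then show ?thesis using False True H A X1 by auto
      next
        case ek: True
        show ?thesis
        proof (cases "Suc k < g")
          case Sk: True
          then have "b (Suc k) = 0" using only by auto
          then have "dirt g ?b' ?s' = 0" "armed g ?b' ?s' \<longleftrightarrow> b k = 2"
            using f(2,4) True ek Sk only D'[of "Suc k"] A'[of "Suc k"] by auto
          then show ?thesis using Sk True A X X1 by auto
        next
          case False
          then have Sk: "Suc k = g" using True by simp
          then have "is_first g ?b' ?s' k" "?b' k = 0" using f(3) True ek by auto
          moreover have "\<forall>j<g. j \<noteq> Suc k \<longrightarrow> ?b' j = 0" using f(4) True ek only by auto
          then have "\<forall>j<g. j \<noteq> k \<longrightarrow> ?b' j = 0" using Sk by auto
          ultimately have "dirt g ?b' ?s' = 0" "\<not> armed g ?b' ?s'" using D'[of k] A'[of k] by auto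
          then show ?thesis using Sk True A X X1 ek H by auto
        qed
      qed
    next
      case nb: False
      then have k1: "1 \<le> k" using X X1 by (cases k) auto
      have kk: "k = g \<or> b k = 0" using nb kg by auto
      have nob: "\<forall>j<g. b j = 0" using only kk by auto
      note f = seg_step_signal[OF t k kk k1, where e = e]
      have nob': "\<forall>j<g. ?b' j = 0" using f nob by blast
      have "\<not> armed g b s" using A nb by auto
      moreover have "dirt g ?b' ?s' = 0" using nob' by (simp add: dirt_def Let_def)
      moreover have "\<not> armed g ?b' ?s'" using nob' by (auto simp: armed_def)
      ultimately show ?thesis using X1 by simp
    qed
  qed
  then show ?A ?B by blast+
qed

lemma dirt_step:
  assumes t: "tidy g b s"
  shows "dirt g (seg_bullet g e b s) (seg_signal g e b s) \<le> dirt g b s"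
    and "fire_time g b s = 1 \<Longrightarrow> e = 0 \<or> e = g \<Longrightarrow>
      dirt g (seg_bullet g e b s) (seg_signal g e b s) \<le> 1"
proof -
  define k where "k = first_obj g b s"
  let ?b' = "seg_bullet g e b s" and ?s' = "seg_signal g e b s"
  have k: "is_first g b s k" using first_obj_is_first by (simp add: k_def)
  have g: "1 \<le> g" and kg: "k \<le> g" using t k by (auto simp: tidy_def is_first_def)
  have D': "dirt g ?b' ?s' \<le> 1" if "is_first g ?b' ?s' k'" "k' < g" "?b' k' > 0" for k'
    using first_objI[OF that(1)] that(2,3) by (simp add: dirt_def Let_def)
  show "dirt g ?b' ?s' \<le> dirt g b s"
  proof -
    consider "dirt g b s = 0" | "dirt g b s = 1" | "dirt g b s = 2" using dirt_le_2[of g b s] by linarith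
    then show ?thesis
    proof cases
      case 1
      then show ?thesis using dirt_0_step[OF t] by simp
    next
      case 2
      then have kb: "k < g" "b k > 0" and ex: "\<exists>j<g. b j > 0 \<and> j \<noteq> k"
        by (auto simp: dirt_def k_def Let_def split: if_splits)
      have zero: "\<And>j. j < k \<Longrightarrow> b j = 0" using k by (auto simp: is_first_def)
      from ex obtain j where "j < g" "b j > 0" "j \<noteq> k" by blast
      with zero have "Suc k < g" by (metis less_trans_Suc less_irrefl_nat linorder_neqE_nat)
      then show ?thesis using 2 seg_step_bullet(1,2)[OF t k kb, where e = e] D'[of k] D'[of "Suc k"] kb
        by (cases "e = k") auto
    next
      case 3
      then show ?thesis using dirt_le_2 by simp
    qed
  qed
  show "dirt g ?b' ?s' \<le> 1" if X1: "fire_time g b s = 1" and e: "e = 0 \<or> e = g"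
  proof -
    have s0: "s 0 = 1" using fire_time_1[OF t] X1 by simp
    consider "e = 0" "2 \<le> g" | "e = 0" "g = 1" | "e = g" using e g by linarith
    then show ?thesis
    proof cases
      case 1
      then show ?thesis using seg_step_fire(1)[OF t s0, where e = e] D'[of 1] by auto
    next
      case 2
      then have "is_first g ?b' ?s' 0" using seg_step_fire(2)[OF t s0, where e = e] by simp
      then have "first_obj g ?b' ?s' = 0" by (rule first_objI)
      then show ?thesis using 2 by (simp add: dirt_def Let_def)
    next
      case 3
      then show ?thesis using seg_step_fire(3)[OF t s0, where e = e] D'[of 0] g by auto
    qed
  qed
qed

lemma armed_shot:
  assumes "tidy g b s" "armed g b s" "fire_time g b s = g + 1"
  shows "seg_shot b s (g - 1) = 2"
proof -
  define k where "k = first_obj g b s"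
  have "k < g" "b k = 2" using assms(2) by (auto simp: armed_def k_def)
  moreover have "k = g - 1" using armed_next_hop[OF assms(2,3)] \<open>k < g\<close> \<open>b k = 2\<close>
    by (auto simp: next_hop_def Let_def k_def)
  ultimately show ?thesis using assms(1) by (auto simp: seg_shot_def tidy_def)
qed

section \<open>The duel between consecutive leaders\<close>

definition duel_value :: "nat \<Rightarrow> bool \<Rightarrow> nat \<Rightarrow> nat \<Rightarrow> nat \<Rightarrow> real" where
  "duel_value g ar X sh Y =
     (if ar then hit_value sh (X - g) (Y - 1) else hit_value sh (X + g - 2) (Y - 1) / 24)"

text \<open>If the second gap is long, progress comes from the target firing again (and dropping its shield),
  otherwise from the attacker firing again. At the threshold the time of a wasted shot, at most
  \<open>3 * g1 - 2\<close> moves, equals the firing period of the target, so that the relevant value of \<open>race\<close> is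
  on the right side of \<open>1 / 2\<close> in both cases.\<close>

definition duel_clock :: "nat \<Rightarrow> nat \<Rightarrow> nat \<Rightarrow> nat \<Rightarrow> real" where
  "duel_clock g1 g2 X Y = (if 2 * g2 + 1 < 3 * g1 then real X / (2 * real g1) else real Y / (2 * real g2))"

definition duel_pot :: "nat \<Rightarrow> nat \<Rightarrow> nat \<Rightarrow> bool \<Rightarrow> nat \<Rightarrow> nat \<Rightarrow> nat \<Rightarrow> real" where
  "duel_pot g1 g2 d ar X sh Y =
     (if d = 0 then 10 - duel_value g1 ar X sh Y + duel_clock g1 g2 X Y / 600
      else 10 + real d + real X / (2 * real g1) / 600)"

lemma duel_value_bounds: "0 \<le> duel_value g ar X sh Y" "duel_value g ar X sh Y \<le> 1"
  using hit_value_bounds[of sh "X - g" "Y - 1"] hit_value_bounds[of sh "X + g - 2" "Y - 1"]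
  by (auto simp: duel_value_def)

lemma duel_clock_bounds:
  assumes "1 \<le> g1" "1 \<le> g2" "X \<le> 2 * g1" "Y \<le> 2 * g2"
  shows "0 \<le> duel_clock g1 g2 X Y" "duel_clock g1 g2 X Y \<le> 1"
  using assms by (auto simp: duel_clock_def)

lemma duel_pot_bounds:
  assumes "1 \<le> g1" "1 \<le> g2" "X \<le> 2 * g1" "Y \<le> 2 * g2" "d \<le> 2"
  shows "9 \<le> duel_pot g1 g2 d ar X sh Y" (is ?A) "duel_pot g1 g2 d ar X sh Y \<le> 13" (is ?B)
proof -
  have "real X / (2 * real g1) \<le> 1" "0 \<le> real X / (2 * real g1)" using assms by auto
  then show ?A ?B
    using duel_value_bounds[of g1 ar X sh Y] duel_clock_bounds[OF assms(1-4)] assms(5)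
    by (auto simp: duel_pot_def)
qed

locale duel =
  fixes n g1 g2 X Y sh d hA hB :: nat and ar :: bool
    and X' Y' sh' d' :: "nat \<Rightarrow> nat" and ar' k :: "nat \<Rightarrow> bool"
  assumes g: "1 \<le> g1" "1 \<le> g2" "g1 + g2 \<le> n"
    and X: "1 \<le> X" "X \<le> 2 * g1" and Y: "1 \<le> Y" "Y \<le> 2 * g2"
    and hA: "hA < g1" and hB: "g1 \<le> hB" "hB < g1 + g2"
    and armed: "ar \<Longrightarrow> g1 < X" "ar \<Longrightarrow> X = g1 + 1 \<Longrightarrow> hA = g1 - 1"
    and X': "\<And>a. a < n \<Longrightarrow> X' a = (if X = 1 then if a = 0 then 2 * g1 - 1 else if a = n - 1 then 2 * g1 else 1
        else if a = hA then X - 1 else X)"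
    and Y': "\<And>a. a < n \<Longrightarrow> Y' a = (if Y = 1 then if a = g1 then 2 * g2 - 1 else if a = g1 - 1 then 2 * g2 else 1
        else if a = hB then Y - 1 else Y)"
    and sh': "\<And>a. a < n \<Longrightarrow> sh' a = (if Y = 1 \<and> a = g1 then 1 else if Y = 1 \<and> a = g1 - 1 then 0 else sh)"
    and d: "d \<le> 2" "d = 1 \<Longrightarrow> 2 \<le> X"
    and d'_le: "\<And>a. a < n \<Longrightarrow> d' a \<le> d"
    and d'_fire: "\<And>a. a < n \<Longrightarrow> X = 1 \<Longrightarrow> a = 0 \<or> a = n - 1 \<Longrightarrow> d' a \<le> 1"
    and ar': "\<And>a. a < n \<Longrightarrow> d = 0 \<Longrightarrow> ar' a \<longleftrightarrow> (if ar then a \<noteq> hA \<or> g1 + 1 < X else X = 1 \<and> a = 0 \<and> 2 \<le> g1)"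
    and kill: "Y = 1 \<or> sh = 0 \<Longrightarrow> ar \<and> X = g1 + 1 \<or> X = 1 \<and> g1 = 1 \<Longrightarrow> k (g1 - 1)"
begin

definition v0 :: real where "v0 = duel_value g1 ar X sh Y"

definition v :: "nat \<Rightarrow> real" where "v a = duel_value g1 (ar' a) (X' a) (sh' a) (Y' a)"

definition gain :: "nat \<Rightarrow> real" where "gain a = v a + (if k a then 1 else 0) - v0"

lemma n2: "2 \<le> n" using g by simp

lemma gain_ge_v: "v a - v0 \<le> gain a" by (simp add: gain_def)

lemma gain_ge_kill: "k a \<Longrightarrow> 1 - v0 \<le> gain a"
  using duel_value_bounds(1)[of g1 "ar' a" "X' a" "sh' a" "Y' a"] by (simp add: gain_def v_def)

lemma gain_ge: "- v0 \<le> gain a"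
  using duel_value_bounds(1)[of g1 "ar' a" "X' a" "sh' a" "Y' a"] by (simp add: gain_def v_def)

lemma sum_gain_ge:
  assumes "F \<subseteq> {..<n}" "\<And>a. a < n \<Longrightarrow> a \<notin> F \<Longrightarrow> v a = v0"
  shows "sum gain F \<le> (\<Sum>a<n. gain a)"
  using assms by (intro sum_mono2) (auto simp: gain_def)

lemma gain_waiting:
  assumes d0: "d = 0" and X2: "2 \<le> X" and Y2: "2 \<le> Y"
  shows "0 \<le> (\<Sum>a<n. gain a)"
proof -
  have n: "hA < n" "hB < n" "hA \<noteq> hB" using hA hB g by auto
  have "0 \<le> gain hA + gain hB"
  proof -
    obtain x where x: "Y = Suc (Suc x)" using Y2 by (metis add_2_eq_Suc le_Suc_ex)
    have YA: "Y' hA = Y" "sh' hA = sh" "X' hA = X - 1" using X'[of hA] Y'[of hA] sh'[of hA] n X2 Y2 by auto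
    have YB: "Y' hB = Y - 1" "sh' hB = sh" "X' hB = X" using X'[of hB] Y'[of hB] sh'[of hB] n X2 Y2 by auto
    have aB: "ar' hB = ar" using ar'[of hB] n d0 X2 by auto
    show ?thesis
    proof (cases ar)
      case True
      then obtain y where y: "X = g1 + Suc y" using armed(1) by (metis less_imp_Suc_add add_Suc_right)
      have v0: "v0 = hit_value sh (Suc y) (Suc x)" unfolding v0_def duel_value_def using True y x by simp
      have vB: "v hB = hit_value sh (Suc y) x" unfolding v_def duel_value_def using True y x YB aB by simp
      have "hit_value sh y (Suc x) - v0 \<le> gain hA"
      proof (cases "y = 0")
        case False
        then have "ar' hA" using ar'[of hA] n d0 True y by simp
        then have "v hA = hit_value sh y (Suc x)" unfolding v_def duel_value_def using y x YA by simp
        then show ?thesis using gain_ge_v[of hA] by simp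
      next
        case y0: True
        then have h: "hA = g1 - 1" using armed(2) True y by simp
        show ?thesis
        proof (cases "sh = 0")
          case True
          then have "k hA" using kill h \<open>ar\<close> y y0 by simp
          then show ?thesis using gain_ge_kill[of hA] hit_value_bounds(2)[of sh y "Suc x"] by linarith
        next
          case False
          then have "hit_value sh y (Suc x) = 0" using y0 by (simp add: hit_value_def)
          then show ?thesis using gain_ge[of hA] by simp
        qed
      qed
      moreover have "hit_value sh (Suc y) x - v0 \<le> gain hB" using vB gain_ge_v[of hB] by simp
      ultimately show ?thesis using hit_value_harmonic[of sh y x] v0 by linarith
    next
      case False
      have "1 \<le> X + g1 - 2" using X2 g by simp
      then obtain y where y: "X + g1 - 2 = Suc y" by (metis Suc_le_D One_nat_def)
      have y': "X - 1 + g1 - 2 = y" using y X2 by linarith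
      have v0: "v0 = hit_value sh (Suc y) (Suc x) / 24" unfolding v0_def duel_value_def using False y x by simp
      have vB: "v hB = hit_value sh (Suc y) x / 24" unfolding v_def duel_value_def using False y x YB aB by simp
      have "\<not> ar' hA" using ar'[of hA] n d0 False X2 by simp
      then have vA: "v hA = hit_value sh y (Suc x) / 24" unfolding v_def duel_value_def using y' x YA by simp
      show ?thesis using gain_ge_v[of hA] gain_ge_v[of hB] vA vB v0 hit_value_harmonic[of sh y x] by linarith
    qed
  qed
  also have "\<dots> = sum gain {hA, hB}" using n by simp
  also have "\<dots> \<le> (\<Sum>a<n. gain a)"
  proof (rule sum_gain_ge)
    show "{hA, hB} \<subseteq> {..<n}" using n by simp
    show "v a = v0" if "a < n" "a \<notin> {hA, hB}" for a
      unfolding v_def v0_def using that X'[of a] Y'[of a] sh'[of a] ar'[of a] X2 Y2 d0 by auto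
  qed
  finally show ?thesis .
qed

lemma not_armed_if_X1: "X = 1 \<Longrightarrow> \<not> ar" using armed(1) g by auto

lemma gain_A_fires:
  assumes d0: "d = 0" and X1: "X = 1" and Y2: "2 \<le> Y"
  shows "race (3 * g1 - 2) (Y - 1) / 96 \<le> (\<Sum>a<n. gain a)"
proof -
  define x where "x = Y - 1"
  define y where "y = g1 - 1"
  have x: "1 \<le> x" "Y - 1 = x" using Y2 by (simp_all add: x_def)
  have n: "0 < n" "n - 1 < n" "hB < n" "0 \<noteq> n - 1" "0 \<noteq> hB" using hB g n2 by auto
  have nar: "\<not> ar" using not_armed_if_X1[OF X1] .
  have v0: "v0 = hit_value sh y x / 24" unfolding v0_def duel_value_def using nar X1 by (simp add: x_def y_def)
  have sg: "sh' a = sh" if "a < n" for a using sh'[OF that] Y2 by simp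
  have G0: "hit_value sh y x - v0 \<le> gain 0"
  proof (cases "2 \<le> g1")
    case True
    then have "ar' 0" using ar'[of 0] n d0 nar X1 by simp
    moreover have "X' 0 - g1 = y" "Y' 0 = Y" using X'[of 0] Y'[of 0] n X1 Y2 by (auto simp: y_def)
    ultimately have "v 0 = hit_value sh y x" unfolding v_def duel_value_def using sg n x by simp
    then show ?thesis using gain_ge_v[of 0] by simp
  next
    case False
    then have g1: "g1 = 1" using g by simp
    show ?thesis
    proof (cases "sh = 0")
      case True
      then have "k 0" using kill X1 g1 by simp
      then show ?thesis using gain_ge_kill[of 0] hit_value_bounds(2)[of sh y x] by linarith
    next
      case False
      obtain x' where "x = Suc x'" using x(1) by (metis Suc_le_D One_nat_def)
      then have "hit_value sh y x = 0" using False g1 by (simp add: hit_value_def y_def)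
      then show ?thesis using gain_ge[of 0] by simp
    qed
  qed
  have Xn: "X' (n - 1) + g1 - 2 = 3 * g1 - 2" "\<not> ar' (n - 1)"
    using X'[of "n - 1"] ar'[of "n - 1"] n X1 nar d0 by auto
  have "race (3 * g1 - 2) x / 96 \<le> sum gain {0, n - 1, hB}"
  proof (cases "sh = 0")
    case True
    have "1 / 4 \<le> hit_value sh y x" using True race_le_1[of y x] by (simp add: hit_value_def)
    moreover have "v0 \<le> 1 / 24" using v0 hit_value_bounds(2)[of sh y x] by simp
    moreover have "sum gain {0, n - 1, hB} \<ge> gain 0 - 2 / 24"
      using n gain_ge[of "n - 1"] gain_ge[of hB] \<open>v0 \<le> 1 / 24\<close> by (cases "n - 1 = hB") auto
    ultimately show ?thesis using G0 race_le_1[of "3 * g1 - 2" x] by linarith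
  next
    case False
    have hv: "hit_value sh b c = race b c / 4" for b c using False by (simp add: hit_value_def)
    have G: "(race (3 * g1 - 2) x - race y x) / 96 \<le> gain (n - 1) + (if n - 1 = hB then 0 else gain hB)"
    proof (cases "n - 1 = hB")
      case True
      then have "Y' (n - 1) - 1 = x - 1" using Y'[of "n - 1"] n Y2 by (simp add: x_def)
      then have "v (n - 1) = race (3 * g1 - 2) (x - 1) / 96" unfolding v_def duel_value_def using sg n Xn by (simp add: hv)
      moreover have "race (3 * g1 - 2) x \<le> race (3 * g1 - 2) (x - 1)" by (rule race_antimono_x) simp
      ultimately show ?thesis using True gain_ge_v[of "n - 1"] v0 by (simp add: hv field_simps)
    next
      case ne: False
      then have "Y' (n - 1) - 1 = x" using Y'[of "n - 1"] n Y2 by (simp add: x_def)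
      then have v1: "v (n - 1) = race (3 * g1 - 2) x / 96" unfolding v_def duel_value_def using sg n Xn by (simp add: hv)
      have "\<not> ar' hB" "X' hB + g1 - 2 = y" "Y' hB - 1 = x - 1"
        using ar'[of hB] X'[of hB] Y'[of hB] n ne nar d0 X1 Y2 g by (auto simp: x_def y_def)
      then have v2: "v hB = race y (x - 1) / 96" unfolding v_def duel_value_def using sg n by (simp add: hv)
      have "race y x \<le> race y (x - 1)" by (rule race_antimono_x) simp
      then show ?thesis using v1 v2 ne gain_ge_v[of "n - 1"] gain_ge_v[of hB] v0 by (simp add: hv field_simps)
    qed
    have "sum gain {0, n - 1, hB} = gain 0 + (gain (n - 1) + (if n - 1 = hB then 0 else gain hB))"
      using n by (cases "n - 1 = hB") auto
    then show ?thesis using G G0 v0 race_nonneg[of y x] by (simp add: hv field_simps)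
  qed
  also have "\<dots> \<le> (\<Sum>a<n. gain a)"
  proof (rule sum_gain_ge)
    show "{0, n - 1, hB} \<subseteq> {..<n}" using n by auto
    show "v a = v0" if "a < n" "a \<notin> {0, n - 1, hB}" for a
      unfolding v_def v0_def using that X'[of a] Y'[of a] sh'[of a] ar'[of a] X1 Y2 d0 nar by auto
  qed
  finally show ?thesis unfolding x_def .
qed

lemma gain_B_fires:
  assumes d0: "d = 0" and X2: "2 \<le> X" and Y1: "Y = 1"
  defines "y \<equiv> (if ar then X - g1 else X + g1 - 2)"
  shows "(1 - race y (2 * g2 - 1)) / 48 \<le> (\<Sum>a<n. gain a)"
proof -
  define w :: real where "w = (if ar then 1 else 1 / 24)"
  have n: "g1 < n" "g1 - 1 < n" "hA < n" "g1 \<noteq> g1 - 1" "hA \<noteq> g1" using hA g by auto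
  have v0: "v0 = w / 4" unfolding v0_def duel_value_def using Y1 by (simp add: hit_value_x0 w_def)
  define R where "R = race y (2 * g2 - 1)"
  define R' where "R' = race y (2 * g2 - 2)"
  have RR: "R \<le> R'" unfolding R_def R'_def by (rule race_antimono_x) simp
  have GB: "w * (R' / 4 - 1 / 4) \<le> gain g1"
  proof -
    have "X' g1 = X" "Y' g1 - 1 = 2 * g2 - 2" "sh' g1 = 1" "ar' g1 = ar"
      using X'[of g1] Y'[of g1] sh'[of g1] ar'[of g1] n X2 Y1 d0 by auto
    then have "v g1 = w * (R' / 4)" unfolding v_def duel_value_def by (simp add: hit_value_def w_def R'_def y_def)
    then show ?thesis using gain_ge_v[of g1] v0 by (simp add: algebra_simps)
  qed
  have GA: "w * (3 / 4 - 3 / 4 * R) \<le> gain (g1 - 1) + (if hA = g1 - 1 then 0 else gain hA)"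
  proof (cases "ar \<and> X = g1 + 1")
    case True
    then have h: "hA = g1 - 1" using armed(2) by simp
    have "k (g1 - 1)" using kill True Y1 by simp
    then have "1 - v0 \<le> gain (g1 - 1)" by (rule gain_ge_kill)
    then show ?thesis using h v0 True race_nonneg[of y "2 * g2 - 1"] by (simp add: w_def R_def)
  next
    case nk: False
    have ar1: "ar' (g1 - 1) = ar" using ar'[of "g1 - 1"] n d0 X2 nk armed(1) by auto
    have Yd: "Y' (g1 - 1) - 1 = 2 * g2 - 1" "sh' (g1 - 1) = 0"
      using Y'[of "g1 - 1"] sh'[of "g1 - 1"] n Y1 g by auto
    let ?y = "if ar then X' (g1 - 1) - g1 else X' (g1 - 1) + g1 - 2"
    have "X' (g1 - 1) \<le> X" using X'[of "g1 - 1"] n X2 by simp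
    then have "?y \<le> y" by (auto simp: y_def)
    then have "race ?y (2 * g2 - 1) \<le> R" unfolding R_def by (rule race_mono_y)
    moreover have "v (g1 - 1) = w * (1 - 3 / 4 * race ?y (2 * g2 - 1))"
      unfolding v_def duel_value_def using ar1 Yd by (simp add: hit_value_def w_def)
    moreover have "0 \<le> w" by (simp add: w_def)
    ultimately have "w * (1 - 3 / 4 * R) \<le> v (g1 - 1)" by (simp add: mult_left_mono)
    then have *: "w * (3 / 4 - 3 / 4 * R) \<le> gain (g1 - 1)"
      using gain_ge_v[of "g1 - 1"] v0 by (simp add: algebra_simps)
    have "0 \<le> gain hA" if ne: "hA \<noteq> g1 - 1"
    proof -
      have "Y' hA = 1" "ar' hA = ar" using Y'[of hA] ar'[of hA] n ne Y1 d0 X2 nk armed(1) by auto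
      then have "v hA = w / 4" unfolding v_def duel_value_def by (simp add: hit_value_x0 w_def)
      then show ?thesis using gain_ge_v[of hA] v0 by simp
    qed
    then have "0 \<le> (if hA = g1 - 1 then 0 else gain hA)" by simp
    then show ?thesis using * by linarith
  qed
  have "(1 - R) / 48 \<le> w * (1 - R) / 2"
    using race_le_1[of y "2 * g2 - 1"] by (simp add: w_def R_def)
  also have "\<dots> \<le> w * (R' / 4 - 1 / 4) + w * (3 / 4 - 3 / 4 * R)"
  proof -
    have "0 \<le> w * (R' - R)" using RR by (simp add: w_def)
    then show ?thesis by (simp add: field_simps)
  qed
  also have "\<dots> \<le> gain g1 + (gain (g1 - 1) + (if hA = g1 - 1 then 0 else gain hA))" using GA GB by linarith
  also have "\<dots> = sum gain {g1, g1 - 1, hA}"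
    using n by (cases "hA = g1 - 1") auto
  also have "\<dots> \<le> (\<Sum>a<n. gain a)"
  proof (rule sum_gain_ge)
    show "{g1, g1 - 1, hA} \<subseteq> {..<n}" using n by auto
    show "v a = v0" if "a < n" "a \<notin> {g1, g1 - 1, hA}" for a
      unfolding v_def v0_def using that X'[of a] Y'[of a] sh'[of a] ar'[of a] X2 Y1 d0 by auto
  qed
  finally show ?thesis by (simp add: R_def)
qed

lemma gain_both_fire:
  assumes d0: "d = 0" and X1: "X = 1" and Y1: "Y = 1"
  shows "1 / 192 \<le> (\<Sum>a<n. gain a)"
proof -
  have nar: "\<not> ar" using not_armed_if_X1[OF X1] .
  have n: "0 < n" "n - 1 < n" "g1 < n" "g1 - 1 < n" "0 \<noteq> n - 1" "g1 \<noteq> 0" "g1 - 1 \<noteq> n - 1" "g1 \<noteq> g1 - 1"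
    using g by auto
  have v0: "v0 = 1 / 96" unfolding v0_def duel_value_def using nar Y1 by (simp add: hit_value_x0)
  have G0: "1 / 4 - 1 / 96 \<le> gain 0 + (if g1 - 1 = 0 then 0 else gain (g1 - 1))"
  proof (cases "g1 = 1")
    case True
    then have "k 0" using kill X1 Y1 by simp
    then show ?thesis using gain_ge_kill[of 0] v0 True by simp
  next
    case False
    then have g12: "2 \<le> g1" using g by simp
    have "ar' 0" "Y' 0 = 1" using ar'[of 0] Y'[of 0] n d0 nar X1 Y1 g12 by auto
    then have "v 0 = 1 / 4" unfolding v_def duel_value_def by (simp add: hit_value_x0)
    moreover have "0 \<le> gain (g1 - 1)"
    proof -
      have "\<not> ar' (g1 - 1)" "sh' (g1 - 1) = 0"
        using ar'[of "g1 - 1"] sh'[of "g1 - 1"] n d0 nar Y1 g12 by auto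
      then have "v (g1 - 1) \<ge> 1 / 96"
        using race_le_1[of "X' (g1 - 1) + g1 - 2" "Y' (g1 - 1) - 1"]
        unfolding v_def duel_value_def by (simp add: hit_value_def)
      then show ?thesis using gain_ge_v[of "g1 - 1"] v0 by linarith
    qed
    ultimately show ?thesis using gain_ge_v[of 0] v0 g12 by simp
  qed
  have Gn: "0 \<le> gain (n - 1)" if ne: "n - 1 \<noteq> g1"
  proof -
    have "\<not> ar' (n - 1)" "Y' (n - 1) = 1" using ar'[of "n - 1"] Y'[of "n - 1"] n ne d0 nar Y1 by auto
    then have "v (n - 1) = 1 / 96" unfolding v_def duel_value_def by (simp add: hit_value_x0)
    then show ?thesis using gain_ge_v[of "n - 1"] v0 by simp
  qed
  have "1 / 192 \<le> gain 0 + (if g1 - 1 = 0 then 0 else gain (g1 - 1)) + gain g1 + (if n - 1 = g1 then 0 else gain (n - 1))"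
    using G0 Gn gain_ge[of g1] v0 by auto
  also have "\<dots> = sum gain {0, n - 1, g1, g1 - 1}"
    using n by (cases "g1 - 1 = 0"; cases "n - 1 = g1") (auto simp: insert_commute)
  also have "\<dots> \<le> (\<Sum>a<n. gain a)"
  proof (rule sum_gain_ge)
    show "{0, n - 1, g1, g1 - 1} \<subseteq> {..<n}" using n by auto
    show "v a = v0" if "a < n" "a \<notin> {0, n - 1, g1, g1 - 1}" for a
      unfolding v_def v0_def using that X'[of a] Y'[of a] sh'[of a] ar'[of a] X1 Y1 d0 nar by auto
  qed
  finally show ?thesis .
qed

lemma gain_nonneg:
  assumes d0: "d = 0" shows "0 \<le> (\<Sum>a<n. gain a)"
proof -
  consider "X = 1" "Y = 1" | "X = 1" "2 \<le> Y" | "2 \<le> X" "Y = 1" | "2 \<le> X" "2 \<le> Y" using X Y by linarith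
  then show ?thesis
  proof cases
    case 1
    then show ?thesis using gain_both_fire[OF d0] by linarith
  next
    case 2
    then show ?thesis using gain_A_fires[OF d0] race_nonneg[of "3 * g1 - 2" "Y - 1"] by linarith
  next
    case 3
    have "race (if ar then X - g1 else X + g1 - 2) (2 * g2 - 1) \<le> 1" by (rule race_le_1)
    then show ?thesis using gain_B_fires[OF d0 3] by argo
  next
    case 4
    then show ?thesis using gain_waiting[OF d0] by blast
  qed
qed

lemma gain_fire:
  assumes d0: "d = 0" and c: "if 2 * g2 + 1 < 3 * g1 then X = 1 else Y = 1"
  shows "1 / 192 \<le> (\<Sum>a<n. gain a)"
proof -
  consider "X = 1" "Y = 1" | "X = 1" "2 \<le> Y" "2 * g2 + 1 < 3 * g1" | "2 \<le> X" "Y = 1" "3 * g1 \<le> 2 * g2 + 1"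
  proof -
    have "X = 1 \<or> 2 \<le> X" "Y = 1 \<or> 2 \<le> Y" using X Y by linarith+
    then show thesis using that c by (cases "2 * g2 + 1 < 3 * g1") auto
  qed
  then show ?thesis
  proof cases
    case 1
    then show ?thesis using gain_both_fire[OF d0] by simp
  next
    case 2
    have "1 / 2 \<le> race (3 * g1 - 2) (Y - 1)" by (rule race_ge_half) (use 2 Y in simp)
    then show ?thesis using gain_A_fires[OF d0 2(1,2)] by linarith
  next
    case 3
    let ?y = "if ar then X - g1 else X + g1 - 2"
    have "?y \<le> 3 * g1 - 2" using X g by auto
    then have "race ?y (2 * g2 - 1) \<le> 1 / 2" by (intro race_le_half) (use 3 g in auto)
    then show ?thesis using gain_B_fires[OF d0 3(1,2)] by argo
  qed
qed

definition pot_change :: "nat \<Rightarrow> real" where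
  "pot_change a = duel_pot g1 g2 (d' a) (ar' a) (X' a) (sh' a) (Y' a) - duel_pot g1 g2 d ar X sh Y
     - (if k a then 1 else 0)"

lemma sum_X_change: "(\<Sum>a<n. real (X' a) - real X) \<le> (if X = 1 then 4 * real g1 else - 1)"
proof (cases "X = 1")
  case True
  have "(\<Sum>a<n. real (X' a) - real X) = (\<Sum>a\<in>{0, n - 1}. real (X' a) - real X)"
    using n2 X' True by (intro sum.mono_neutral_right) auto
  also have "\<dots> = real (X' 0) - 1 + (real (X' (n - 1)) - 1)" using n2 True by simp
  also have "\<dots> \<le> 4 * real g1" using X'[of 0] X'[of "n - 1"] n2 True by simp
  finally show ?thesis using True by simp
next
  case False
  have h: "hA < n" using hA g by simp
  have "(\<Sum>a<n. real (X' a) - real X) = (\<Sum>a\<in>{hA}. real (X' a) - real X)"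
    using h X' False by (intro sum.mono_neutral_right) auto
  also have "\<dots> = - 1" using X'[OF h] False X by simp
  finally show ?thesis using False by simp
qed

lemma sum_Y_change: "(\<Sum>a<n. real (Y' a) - real Y) \<le> (if Y = 1 then 4 * real g2 else - 1)"
proof (cases "Y = 1")
  case True
  have n: "g1 < n" "g1 - 1 < n" "g1 \<noteq> g1 - 1" using g by auto
  have "(\<Sum>a<n. real (Y' a) - real Y) = (\<Sum>a\<in>{g1, g1 - 1}. real (Y' a) - real Y)"
    using n Y' True by (intro sum.mono_neutral_right) auto
  also have "\<dots> = real (Y' g1) - 1 + (real (Y' (g1 - 1)) - 1)" using n True by simp
  also have "\<dots> \<le> 4 * real g2" using Y'[of g1] Y'[of "g1 - 1"] n True by simp
  finally show ?thesis using True by simp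
next
  case False
  have h: "hB < n" using hB g by simp
  have "(\<Sum>a<n. real (Y' a) - real Y) = (\<Sum>a\<in>{hB}. real (Y' a) - real Y)"
    using h Y' False by (intro sum.mono_neutral_right) auto
  also have "\<dots> = - 1" using Y'[OF h] False Y by simp
  finally show ?thesis using False by simp
qed

lemma clean_drift:
  assumes d0: "d = 0"
  shows "(\<Sum>a<n. pot_change a) \<le> - 1 / (1200 * (real g1 + real g2))"
proof -
  define G where "G = (\<Sum>a<n. gain a)"
  define K where "K = (\<Sum>a<n. duel_clock g1 g2 (X' a) (Y' a) - duel_clock g1 g2 X Y)"
  have "pot_change a = - gain a + (duel_clock g1 g2 (X' a) (Y' a) - duel_clock g1 g2 X Y) / 600" if "a < n" for a
    unfolding pot_change_def duel_pot_def gain_def v_def v0_def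
    using d'_le[OF that] d0 by (simp add: diff_divide_distrib)
  then have "(\<Sum>a<n. pot_change a) = (\<Sum>a<n. - gain a + (duel_clock g1 g2 (X' a) (Y' a) - duel_clock g1 g2 X Y) / 600)"
    by (intro sum.cong) auto
  also have "\<dots> = - G + K / 600"
    unfolding G_def K_def sum_divide_distrib sum.distrib sum_negf by (rule refl)
  also have "\<dots> \<le> - 1 / (1200 * (real g1 + real g2))"
  proof -
    have mono: "- 1 / (1200 * real h) \<le> - 1 / (1200 * (real g1 + real g2))" if "1 \<le> h" "h \<le> g1 + g2" for h
    proof -
      have "1 / (1200 * (real g1 + real g2)) \<le> 1 / (1200 * real h)"
        using that by (intro divide_left_mono) auto
      then show ?thesis by simp
    qed
    have eq: "- (1 / (2 * z)) / 600 = - 1 / (1200 * z)" for z :: real by simp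
    have big: "- (1 / 192) + 2 / 600 \<le> - 1 / (1200 * real h)" if "1 \<le> h" for h
    proof -
      have "1 / (1200 * real h) \<le> 1 / 1200" using that by (simp add: divide_le_eq)
      then show ?thesis by simp
    qed
    show ?thesis
    proof (cases "2 * g2 + 1 < 3 * g1")
      case c: True
      have "K = (\<Sum>a<n. real (X' a) - real X) / (2 * real g1)"
        unfolding K_def duel_clock_def using c by (simp add: sum_divide_distrib diff_divide_distrib)
      also have "\<dots> \<le> (if X = 1 then 4 * real g1 else - 1) / (2 * real g1)"
        using sum_X_change by (intro divide_right_mono) auto
      finally have K: "K \<le> (if X = 1 then 2 else - (1 / (2 * real g1)))" using g by (simp split: if_splits)
      show ?thesis
      proof (cases "X = 1")
        case True
        then show ?thesis using gain_fire[OF d0] c K big[of g1] mono[of g1] g unfolding G_def[symmetric] by auto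
      next
        case False
        then show ?thesis using gain_nonneg[OF d0] K eq[of "real g1"] mono[of g1] g unfolding G_def[symmetric] by auto
      qed
    next
      case c: False
      have "K = (\<Sum>a<n. real (Y' a) - real Y) / (2 * real g2)"
        unfolding K_def duel_clock_def using c by (simp add: sum_divide_distrib diff_divide_distrib)
      also have "\<dots> \<le> (if Y = 1 then 4 * real g2 else - 1) / (2 * real g2)"
        using sum_Y_change by (intro divide_right_mono) auto
      finally have K: "K \<le> (if Y = 1 then 2 else - (1 / (2 * real g2)))" using g by (simp split: if_splits)
      show ?thesis
      proof (cases "Y = 1")
        case True
        then show ?thesis using gain_fire[OF d0] c K big[of g2] mono[of g2] g unfolding G_def[symmetric] by auto
      next
        case False
        then show ?thesis using gain_nonneg[OF d0] K eq[of "real g2"] mono[of g2] g unfolding G_def[symmetric] by auto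
      qed
    qed
  qed
  finally show ?thesis .
qed

lemma dirty_drift:
  assumes d1: "1 \<le> d"
  shows "(\<Sum>a<n. pot_change a) \<le> - 1 / (1200 * (real g1 + real g2))"
proof -
  define c where "c = - 1 / (1200 * real g1)"
  define h where "h = (if X = 1 then 0 else hA)"
  have hn: "h < n" using hA g by (auto simp: h_def)
  have X'le: "X' a \<le> 2 * g1" if "a < n" for a using X'[OF that] X by auto
  have Y'le: "Y' a \<le> 2 * g2" if "a < n" for a using Y'[OF that] Y by auto
  have c1: "- 1 + 1 / 600 \<le> c" using g by (simp add: c_def field_simps)
  have drop: "pot_change a \<le> - 1 + 1 / 600" if a: "a < n" and lt: "d' a < d" for a
  proof -
    define p where "p = real X / (2 * real g1)"
    define q where "q = real (X' a) / (2 * real g1)"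
    have "q \<le> 1" using X'le[OF a] g by (simp add: q_def)
    moreover have "0 \<le> p" by (simp add: p_def)
    moreover have "real (d' a) + 1 \<le> real d" using lt by simp
    moreover have "pot_change a \<le> (if d' a = 0 then 10 - duel_value g1 (ar' a) (X' a) (sh' a) (Y' a)
        + duel_clock g1 g2 (X' a) (Y' a) / 600 else 10 + real (d' a) + q / 600) - (10 + real d + p / 600)"
      unfolding pot_change_def duel_pot_def p_def q_def using d1 by auto
    ultimately show ?thesis
      using duel_value_bounds(1)[of g1 "ar' a" "X' a" "sh' a" "Y' a"]
        duel_clock_bounds(2)[OF g(1,2) X'le[OF a] Y'le[OF a]]
      by (cases "d' a = 0") simp_all
  qed
  have same: "pot_change a \<le> (real (X' a) - real X) / (1200 * real g1)" if "a < n" "d' a = d" for a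
    using that d1 by (simp add: pot_change_def duel_pot_def diff_divide_distrib)
  have le0: "pot_change a \<le> 0" if a: "a < n" and ne: "a \<noteq> h" for a
  proof (cases "d' a < d")
    case True
    then show ?thesis using drop[OF a] by simp
  next
    case False
    then have dd: "d' a = d" using d'_le[OF a] by simp
    have "X' a \<le> X"
    proof (cases "X = 1 \<and> a = n - 1")
      case True
      then show ?thesis using d'_fire[OF a] dd d d1 by fastforce
    next
      case False
      then show ?thesis using X'[OF a] ne by (auto simp: h_def split: if_splits)
    qed
    then have "(real (X' a) - real X) / (1200 * real g1) \<le> 0" by (simp add: divide_nonpos_nonneg)
    then show ?thesis using same[OF a dd] by linarith
  qed
  have "pot_change h \<le> c"
  proof (cases "d' h < d")
    case True
    then show ?thesis using drop[OF hn] c1 by linarith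
  next
    case False
    then have dd: "d' h = d" using d'_le[OF hn] by simp
    have "X \<noteq> 1"
    proof
      assume "X = 1"
      then show False using d'_fire[OF hn] dd d d1 by (auto simp: h_def)
    qed
    then have "real (X' h) - real X = - 1" using X'[OF hn] X by (simp add: h_def)
    then show ?thesis using same[OF hn dd] by (simp add: c_def)
  qed
  moreover have "(\<Sum>a<n. pot_change a) \<le> pot_change h"
  proof -
    have "(\<Sum>a<n. pot_change a) = pot_change h + (\<Sum>a\<in>{..<n} - {h}. pot_change a)"
      using hn by (simp add: sum.remove)
    also have "(\<Sum>a\<in>{..<n} - {h}. pot_change a) \<le> 0" using le0 by (intro sum_nonpos) auto
    finally show ?thesis by simp
  qed
  moreover have "c \<le> - 1 / (1200 * (real g1 + real g2))"
  proof -
    have "1 / (1200 * (real g1 + real g2)) \<le> 1 / (1200 * real g1)"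
      using g by (intro divide_left_mono) auto
    then show ?thesis by (simp add: c_def)
  qed
  ultimately show ?thesis by linarith
qed

lemma duel_drift: "(\<Sum>a<n. pot_change a) \<le> - 1 / (1200 * (real g1 + real g2))"
  using clean_drift dirty_drift by (cases "d = 0") auto

end

context ring
begin

section \<open>Eliminating leaders\<close>

definition leaders :: "config \<Rightarrow> nat set" where
  "leaders C = {A. A < n \<and> leader (C A) = 1}"

definition gap :: "config \<Rightarrow> nat \<Rightarrow> nat" where
  "gap C A = (LEAST k. 1 \<le> k \<and> leader (ag C A k) = 1)"

definition next_ldr :: "config \<Rightarrow> nat \<Rightarrow> nat" where
  "next_ldr C A = (A + gap C A) mod n"

lemma finite_leaders: "finite (leaders C)" by (simp add: leaders_def)

lemma gap_le: "1 \<le> t \<Longrightarrow> leader (ag C A t) = 1 \<Longrightarrow> gap C A \<le> t"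
  unfolding gap_def by (rule Least_le) simp

lemma gap_props:
  assumes "A \<in> leaders C"
  shows "1 \<le> gap C A" "gap C A \<le> n" "leader (ag C A (gap C A)) = 1"
    "\<And>k. 1 \<le> k \<Longrightarrow> k < gap C A \<Longrightarrow> leader (ag C A k) \<noteq> 1" "next_ldr C A \<in> leaders C"
proof -
  let ?P = "\<lambda>k. 1 \<le> k \<and> leader (ag C A k) = 1"
  have P: "?P n" using assms n_pos by (simp add: leaders_def ag_n ag_0)
  have G: "?P (gap C A)" unfolding gap_def by (rule LeastI[of ?P, OF P])
  then show "1 \<le> gap C A" "leader (ag C A (gap C A)) = 1" by auto
  show "gap C A \<le> n" using P by (intro gap_le) auto
  show "leader (ag C A k) \<noteq> 1" if "1 \<le> k" "k < gap C A" for k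
    using gap_le[of k C A] that by auto
  show "next_ldr C A \<in> leaders C"
    using G n_pos by (simp add: leaders_def next_ldr_def ag_def)
qed

lemma gapI:
  assumes "1 \<le> g" "leader (ag C A g) = 1" "\<And>k. 1 \<le> k \<Longrightarrow> k < g \<Longrightarrow> leader (ag C A k) \<noteq> 1"
  shows "gap C A = g"
  unfolding gap_def
proof (rule Least_equality)
  show "1 \<le> g \<and> leader (ag C A g) = 1" using assms by simp
  fix k assume "1 \<le> k \<and> leader (ag C A k) = 1"
  then show "g \<le> k" using assms(3)[of k] by (cases "k < g") auto
qed

lemma leaders_apart:
  assumes "A \<in> leaders C" "A' \<in> leaders C" "A \<noteq> A'"
  obtains t where "0 < t" "t < n" "A' = (A + t) mod n" "gap C A \<le> t" "t + gap C A' \<le> n"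
proof -
  have A: "A < n" "A' < n" "leader (C A) = 1" "leader (C A') = 1" using assms by (auto simp: leaders_def)
  obtain t where t: "t < n" "(A + t) mod n = A'" using offset_exists[OF A(2)] by blast
  have t0: "0 < t" using t A assms(3) by (cases t) auto
  have "gap C A \<le> t" using t t0 A by (intro gap_le) (auto simp: ag_def)
  moreover have "(A' + (n - t)) mod n = A"
  proof -
    have "(A' + (n - t)) mod n = (A + t + (n - t)) mod n" using t(2) by (metis mod_add_left_eq)
    also have "\<dots> = A" using t(1) A(1) by simp
    finally show ?thesis .
  qed
  then have "gap C A' \<le> n - t" using t A by (intro gap_le) (auto simp: ag_def)
  ultimately show thesis using that[of t] t t0 by auto
qed

lemma inj_next_ldr: "inj_on (next_ldr C) (leaders C)"
proof (rule inj_onI, rule ccontr)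
  fix A A' assume A: "A \<in> leaders C" "A' \<in> leaders C" and eq: "next_ldr C A = next_ldr C A'" and ne: "A \<noteq> A'"
  from A ne obtain t where t: "0 < t" "t < n" "A' = (A + t) mod n" "gap C A \<le> t" "t + gap C A' \<le> n"
    by (rule leaders_apart)
  have "(A + gap C A) mod n = (A + (t + gap C A')) mod n"
    using eq t(3) by (simp add: next_ldr_def mod_simps add.assoc)
  moreover have "1 \<le> gap C A" "1 \<le> gap C A'" using gap_props(1) A by auto
  ultimately show False
    using offset_eq_iff[of "gap C A" "t + gap C A'" A] offset_eq_iff[of "gap C A" 0 A] t
    by (cases "t + gap C A' = n") auto
qed

lemma card_prev_leader: "card {A \<in> leaders C. next_ldr C A = j} \<le> 1"
proof -
  have "card {A \<in> leaders C. next_ldr C A = j} \<le> Suc 0"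
    by (subst card_le_Suc0_iff_eq) (auto simp: finite_leaders dest: inj_onD[OF inj_next_ldr])
  then show ?thesis by simp
qed

lemma sum_gap_le: "(\<Sum>A\<in>leaders C. gap C A) \<le> n"
proof -
  let ?S = "SIGMA A:leaders C. {..<gap C A}"
  have inj: "inj_on (\<lambda>(A, k). (A + k) mod n) ?S"
  proof (rule inj_onI, clarsimp)
    fix A k A' k' assume A: "A \<in> leaders C" "A' \<in> leaders C" and k: "k < gap C A" "k' < gap C A'"
      and eq: "(A + k) mod n = (A' + k') mod n"
    show "A = A' \<and> k = k'"
    proof (cases "A = A'")
      case True
      then show ?thesis using offset_eq_iff[of k k' A] eq k gap_props(2)[OF A(1)] by auto
    next
      case False
      from A False obtain t where t: "0 < t" "t < n" "A' = (A + t) mod n" "gap C A \<le> t" "t + gap C A' \<le> n"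
        by (rule leaders_apart)
      have "(A + k) mod n = (A + (t + k')) mod n" using eq t(3) by (simp add: mod_simps add.assoc)
      then have "k = t + k'" using offset_eq_iff[of k "t + k'" A] t k by auto
      then show ?thesis using k t by simp
    qed
  qed
  have "card ?S \<le> card {..<n}"
    by (rule card_inj_on_le[OF inj]) (use n_pos in auto)
  then show ?thesis using finite_leaders by simp
qed

lemma sum_next_gap_le: "(\<Sum>A\<in>leaders C. gap C (next_ldr C A)) \<le> n"
proof -
  have "(\<Sum>A\<in>leaders C. gap C (next_ldr C A)) = (\<Sum>B\<in>next_ldr C ` leaders C. gap C B)"
    by (simp add: sum.reindex[OF inj_next_ldr])
  also have "\<dots> \<le> (\<Sum>B\<in>leaders C. gap C B)"
    by (rule sum_mono2) (use finite_leaders gap_props(5) in auto)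
  finally show ?thesis using sum_gap_le[of C] by simp
qed

lemma two_leaders_gaps:
  assumes A: "A \<in> leaders C" and m: "2 \<le> card (leaders C)"
  shows "next_ldr C A \<noteq> A" "gap C A + gap C (next_ldr C A) \<le> n"
proof -
  obtain A' where A': "A' \<in> leaders C" "A' \<noteq> A"
    using m A by (metis One_nat_def card_le_Suc0_iff_eq finite_leaders not_less_eq_eq numeral_2_eq_2)
  from A A'(1) A'(2)[symmetric] obtain t where t: "t < n" "gap C A \<le> t" by (rule leaders_apart)
  have "(A + gap C A) mod n \<noteq> (A + 0) mod n"
    using offset_eq_iff[of "gap C A" 0 A] t gap_props(1)[OF A] by auto
  then show ne: "next_ldr C A \<noteq> A" using A by (auto simp: next_ldr_def leaders_def)
  from A gap_props(5)[OF A] ne[symmetric] obtain u where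
    u: "u < n" "next_ldr C A = (A + u) mod n" "u + gap C (next_ldr C A) \<le> n" by (rule leaders_apart)
  have "u = gap C A" using u t offset_eq_iff[of u "gap C A" A] by (simp add: next_ldr_def)
  then show "gap C A + gap C (next_ldr C A) \<le> n" using u by simp
qed

text \<open>The step in which a leader that is hit survives: it leaves all gaps unchanged.\<close>

definition survive :: "config \<Rightarrow> nat \<Rightarrow> config" where
  "survive C i = (let j = Suc i mod n; C' = step_arc N n C i in
     if kills (C i) (C j) then C'(i := (C' i)\<lparr>signal := 1\<rparr>, j := (C' j)\<lparr>leader := 1\<rparr>) else C')"

lemma survive_other:
  assumes "q \<noteq> i" "q \<noteq> Suc i mod n" shows "survive C i q = C q"
  using assms by (simp add: survive_def Let_def step_arc_other)

lemma survive_initiator: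
  assumes S: "settled C" and i: "i < n"
  defines "l \<equiv> C i" and "r \<equiv> C (Suc i mod n)"
  shows "leader (survive C i i) = leader l" "bullet (survive C i i) = 0"
    "shield (survive C i i) = (if fires l then 1 else shield l)"
    "signal (survive C i i) = (if leader r = 1 then 1
       else max (if fires l then 0 else signal l) (if shot l > 0 then 0 else signal r))"
proof -
  have v: "valid C" using S by (simp add: settled_def calm_def)
  have q: "l \<in> Q N" "r \<in> Q N" "2 \<le> N"
    using valid_Q[OF v i] valid_Q[OF v Suc_lt] N_ge_2 by (auto simp: l_def r_def)
  have ne: "Suc i mod n \<noteq> i" by (rule Suc_mod_neq[OF i])
  have nc: "\<not> creates N l r" using settled_no_create[OF S i] by (simp add: l_def r_def)
  have st: "step_arc N n C i i = fst (trans N l r)" using step_arc_initiator[OF i] by (simp add: l_def r_def)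
  have sv: "survive C i i = (if kills l r then (step_arc N n C i i)\<lparr>signal := 1\<rparr> else step_arc N n C i i)"
    using ne by (auto simp: survive_def Let_def l_def r_def)
  note t = trans_initiator[OF q]
  show "leader (survive C i i) = leader l" "bullet (survive C i i) = 0"
    "shield (survive C i i) = (if fires l then 1 else shield l)"
    unfolding sv st by (simp_all add: t)
  show "signal (survive C i i) = (if leader r = 1 then 1
       else max (if fires l then 0 else signal l) (if shot l > 0 then 0 else signal r))"
  proof (cases "leader r = 1")
    case True
    have "(if fires l then 0 else signal l) \<le> 1" using q(1) by (auto simp: Q_def)
    then show ?thesis unfolding sv st
      using True by (simp add: t(5) trans_leader[OF q True] max_def)
  next
    case False
    then have r0: "leader r = 0" using leader_cases[OF q(2)] by simp
    then have "\<not> kills l r" by (simp add: kills_def)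
    then show ?thesis unfolding sv st using r0 by (simp add: t(5) trans_follower[OF q r0 nc])
  qed
qed

lemma survive_responder:
  assumes S: "settled C" and i: "i < n"
  defines "l \<equiv> C i" and "r \<equiv> C (Suc i mod n)" and "r' \<equiv> survive C i (Suc i mod n)"
  shows "leader r' = leader r" (is ?A)
    "leader r = 1 \<Longrightarrow> bullet r' = (if signal r = 1 then 1 else bullet r)" (is "PROP ?B")
    "leader r = 1 \<Longrightarrow> shield r' = (if signal r = 1 then 0 else shield r)" (is "PROP ?C")
    "leader r = 1 \<Longrightarrow> signal r' = 0" (is "PROP ?D")
    "leader r \<noteq> 1 \<Longrightarrow> bullet r' = (if bullet r = 0 then shot l else bullet r)" (is "PROP ?E")
    "leader r \<noteq> 1 \<Longrightarrow> signal r' = (if shot l > 0 then 0 else signal r)" (is "PROP ?F")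
    "leader r \<noteq> 1 \<Longrightarrow> shield r' = shield r" (is "PROP ?G")
proof -
  have v: "valid C" using S by (simp add: settled_def calm_def)
  have q: "l \<in> Q N" "r \<in> Q N" "2 \<le> N"
    using valid_Q[OF v i] valid_Q[OF v Suc_lt] N_ge_2 by (auto simp: l_def r_def)
  have ne: "Suc i mod n \<noteq> i" by (rule Suc_mod_neq[OF i])
  have nc: "\<not> creates N l r" using settled_no_create[OF S i] by (simp add: l_def r_def)
  define u where "u = snd (trans N l r)"
  have sv: "r' = (if kills l r then u\<lparr>leader := 1\<rparr> else u)"
    using ne by (auto simp: survive_def Let_def l_def r_def r'_def u_def step_arc_responder)
  have a: "leader r = 1 \<Longrightarrow> bullet u = (if signal r = 1 then 1 else bullet r) \<and>
      shield u = (if signal r = 1 then 0 else shield r) \<and> signal u = 0 \<and> leader u = (if kills l r then 0 else 1)"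
    using trans_leader[OF q] by (simp add: u_def)
  have b: "leader r \<noteq> 1 \<Longrightarrow> \<not> kills l r \<and> bullet u = (if bullet r = 0 then shot l else bullet r) \<and>
      signal u = (if shot l > 0 then 0 else signal r) \<and> shield u = shield r \<and> leader u = leader r"
    using trans_follower[OF q _ nc] leader_cases[OF q(2)] by (auto simp: u_def kills_def)
  show ?A "PROP ?B" "PROP ?C" "PROP ?D" "PROP ?E" "PROP ?F" "PROP ?G"
    using a b unfolding sv by (cases "leader r = 1"; simp)+
qed

lemma leader_survive:
  assumes "settled C" "i < n"
  shows "leader (survive C i q) = leader (C q)"
  using survive_initiator(1)[OF assms] survive_responder(1)[OF assms] survive_other[of q i C]
  by (cases "q = i"; cases "q = Suc i mod n") auto

lemma gap_survive:
  assumes "settled C" "i < n"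
  shows "gap (survive C i) = gap C" "next_ldr (survive C i) = next_ldr C"
    "leaders (survive C i) = leaders C"
  using leader_survive[OF assms]
  by (auto simp: gap_def next_ldr_def leaders_def ag_def fun_eq_iff)

definition seg_b :: "config \<Rightarrow> nat \<Rightarrow> nat \<Rightarrow> nat" where "seg_b C A k = bullet (ag C A k)"
definition seg_s :: "config \<Rightarrow> nat \<Rightarrow> nat \<Rightarrow> nat" where "seg_s C A k = signal (ag C A k)"

lemma seg_tidy:
  assumes S: "settled C" and A: "A \<in> leaders C"
  shows "tidy (gap C A) (seg_b C A) (seg_s C A)"
  unfolding tidy_def
proof (intro conjI allI impI)
  have c: "calm C" "valid C" using S by (simp_all add: settled_def calm_def)
  fix k
  have s: "signal (ag C A k) \<le> 1" using valid_at[OF c(2), of A k] by (simp add: Q_def)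
  then show "seg_s C A k \<le> 1" by (simp add: seg_s_def)
  have "\<not> (bullet (ag C A k) > 0 \<and> signal (ag C A k) = 1)"
    using calmD(2)[OF c(1), of "(A + k) mod n"] n_pos by (simp add: ag_def)
  then show "\<not> (seg_b C A k > 0 \<and> seg_s C A k > 0)" using s by (auto simp: seg_b_def seg_s_def)
qed (rule gap_props(1)[OF A])

definition arc_code :: "nat \<Rightarrow> nat \<Rightarrow> nat" where
  "arc_code g a = (if a < g then a else if a = n - 1 then g else Suc g)"

lemma seg_survive:
  assumes S: "settled C" and A: "A \<in> leaders C" and gn: "gap C A < n" and a: "a < n" and k: "k < gap C A"
  defines "D \<equiv> survive C ((A + a) mod n)" and "g \<equiv> gap C A"
  shows "seg_b D A k = seg_bullet g (arc_code g a) (seg_b C A) (seg_s C A) k" (is ?A)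
    and "seg_s D A k = seg_signal g (arc_code g a) (seg_b C A) (seg_s C A) k" (is ?B)
proof -
  define i where "i = (A + a) mod n"
  have i: "i < n" using n_pos by (simp add: i_def)
  have l: "C i = ag C A a" by (simp add: i_def ag_def)
  have j: "Suc i mod n = (A + Suc a) mod n" by (simp add: i_def mod_simps)
  have r: "C (Suc i mod n) = ag C A (Suc a)" by (simp add: j ag_def)
  have Di: "ag D A a = D i" by (simp add: i_def ag_def)
  have Dj: "ag D A (Suc a) = D (Suc i mod n)" by (simp add: j ag_def)
  have Do: "ag D A k' = ag C A k'" if "k' < n" "k' \<noteq> a" "k' \<noteq> Suc a mod n" for k'
  proof -
    have "(A + k') mod n \<noteq> i" using that a offset_eq_iff[of k' a A] by (simp add: i_def)
    moreover have "(A + k') mod n \<noteq> Suc i mod n"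
      using that offset_eq_iff[of k' "Suc a mod n" A] n_pos by (simp add: j mod_simps)
    ultimately show ?thesis by (simp add: ag_def D_def i_def[symmetric] survive_other)
  qed
  note I = survive_initiator[OF S i, folded D_def[folded i_def], unfolded l r]
  note R = survive_responder[OF S i, folded D_def[folded i_def], unfolded l r]
  have L0: "leader (ag C A 0) = 1" using A by (simp add: leaders_def ag_0)
  have Lin: "leader (ag C A k') \<noteq> 1" if "1 \<le> k'" "k' < g" for k' using gap_props(4)[OF A] that by (simp add: g_def)
  have Lg: "leader (ag C A g) = 1" using gap_props(3)[OF A] by (simp add: g_def)
  have "?A \<and> ?B"
  proof -
    consider "a < g" | "g \<le> a" "a = n - 1" | "g \<le> a" "a < n - 1" using a by linarith
    then show ?thesis
    proof cases
      case 1
      have code: "arc_code g a = a" using 1 by (simp add: arc_code_def)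
      have sm: "Suc a mod n = Suc a" using 1 gn by (simp add: g_def)
      have f: "fires (ag C A a) \<longleftrightarrow> a = 0 \<and> seg_s C A 0 = 1"
        using L0 Lin[of a] 1 by (cases a) (auto simp: fires_def seg_s_def)
      have sh: "shot (ag C A a) = seg_shot (seg_b C A) (seg_s C A) a"
        using f by (simp add: shot_def seg_shot_def seg_b_def)
      have fs: "(if fires (ag C A a) then 0 else signal (ag C A a)) = (if a = 0 \<and> seg_s C A 0 = 1 then 0 else seg_s C A a)"
        using f by (simp add: seg_s_def)
      have Lr: "leader (ag C A (Suc a)) = 1 \<longleftrightarrow> Suc a = g" using Lin[of "Suc a"] Lg 1 by (cases "Suc a = g") auto
      consider "k = a" | "k = Suc a" | "k \<noteq> a" "k \<noteq> Suc a" by blast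
      then show ?thesis
      proof cases
        case ka: 1
        have eb: "seg_b D A a = 0" using I(2) Di by (simp add: seg_b_def)
        have es: "seg_s D A a = (if Suc a = g then 1 else
            max (if a = 0 \<and> seg_s C A 0 = 1 then 0 else seg_s C A a)
              (if seg_shot (seg_b C A) (seg_s C A) a > 0 then 0 else seg_s C A (Suc a)))"
          using I(4) Di unfolding sh fs Lr by (simp add: seg_s_def)
        show ?thesis unfolding ka code seg_bullet_def seg_signal_def eb es using 1 by simp
      next
        case ka: 2
        then have nl: "leader (ag C A (Suc a)) \<noteq> 1" using Lr k by (auto simp: g_def)
        have eb: "seg_b D A (Suc a) = (if seg_b C A (Suc a) = 0 then seg_shot (seg_b C A) (seg_s C A) a else seg_b C A (Suc a))"
          using R(5)[OF nl] Dj unfolding sh by (simp add: seg_b_def)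
        have es: "seg_s D A (Suc a) = (if seg_shot (seg_b C A) (seg_s C A) a > 0 then 0 else seg_s C A (Suc a))"
          using R(6)[OF nl] Dj unfolding sh by (simp add: seg_s_def)
        show ?thesis unfolding ka code seg_bullet_def seg_signal_def eb es using 1 by simp
      next
        case 3
        then have "ag D A k = ag C A k" using Do[of k] k gn sm by simp
        then show ?thesis using 1 3 code by (simp add: seg_bullet_def seg_signal_def) (simp add: seg_b_def seg_s_def)
      qed
    next
      case 2
      have code: "arc_code g a = g" using 2 by (simp add: arc_code_def)
      have Sa: "Suc a = n" using 2 n_pos by simp
      have r0: "ag C A (Suc a) = ag C A 0" "ag D A (Suc a) = ag D A 0" using Sa ag_n by auto
      show ?thesis
      proof (cases "k = 0")
        case True
        have "bullet (ag D A 0) = (if seg_s C A 0 = 1 then 1 else seg_b C A 0)" "signal (ag D A 0) = 0"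
          using R(2,4) L0 Dj r0 by (simp_all add: seg_s_def seg_b_def)
        then show ?thesis using True code by (simp add: seg_bullet_def seg_signal_def) (simp add: seg_b_def seg_s_def)
      next
        case False
        then have "ag D A k = ag C A k" using Do[of k] k gn Sa 2 by (simp add: g_def)
        then show ?thesis using False code by (simp add: seg_bullet_def seg_signal_def) (simp add: seg_b_def seg_s_def)
      qed
    next
      case 3
      have code: "arc_code g a = Suc g" using 3 by (simp add: arc_code_def)
      have "Suc a mod n = Suc a" using 3 by simp
      then have "ag D A k = ag C A k" using Do[of k] k gn 3 by (simp add: g_def)
      then show ?thesis using code by (simp add: seg_bullet_def seg_signal_def) (simp add: seg_b_def seg_s_def)
    qed
  qed
  then show ?A ?B by blast+
qed

definition psi :: "config \<Rightarrow> nat \<Rightarrow> real" where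
  "psi C A = (let g1 = gap C A; B = next_ldr C A; g2 = gap C B in
     duel_pot g1 g2 (dirt g1 (seg_b C A) (seg_s C A)) (armed g1 (seg_b C A) (seg_s C A))
       (fire_time g1 (seg_b C A) (seg_s C A)) (shield (C B))
       (fire_time g2 (seg_b C B) (seg_s C B)))"

definition psi_sum :: "config \<Rightarrow> real" where
  "psi_sum C = (\<Sum>A\<in>leaders C. psi C A)"

lemma psi_bounds:
  assumes "A \<in> leaders C" shows "9 \<le> psi C A" "psi C A \<le> 13"
  using assms gap_props(1,5) fire_time_bounds(2) dirt_le_2
  unfolding psi_def Let_def by (auto intro!: duel_pot_bounds)

lemma psi_sum_bounds: "9 * real (card (leaders C)) \<le> psi_sum C" "psi_sum C \<le> 13 * real (card (leaders C))"
proof -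
  have "(\<Sum>A\<in>leaders C. 9) \<le> psi_sum C" "psi_sum C \<le> (\<Sum>A\<in>leaders C. 13)"
    unfolding psi_sum_def by (rule sum_mono, erule psi_bounds)+
  then show "9 * real (card (leaders C)) \<le> psi_sum C" "psi_sum C \<le> 13 * real (card (leaders C))" by simp_all
qed

definition killed :: "config \<Rightarrow> nat \<Rightarrow> bool" where
  "killed C i \<longleftrightarrow> kills (C i) (C (Suc i mod n))"

lemma psi_drift:
  assumes S: "settled C" and A: "A \<in> leaders C" and m: "2 \<le> card (leaders C)"
  shows "(\<Sum>i<n. psi (survive C i) A - psi C A -
      (if killed C i \<and> Suc i mod n = next_ldr C A then 1 else 0))
    \<le> - 1 / (1200 * (real (gap C A) + real (gap C (next_ldr C A))))"
proof -
  define B where "B = next_ldr C A"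
  define g1 where "g1 = gap C A"
  define g2 where "g2 = gap C B"
  define bA where "bA = seg_b C A"
  define sA where "sA = seg_s C A"
  define bB where "bB = seg_b C B"
  define sB where "sB = seg_s C B"
  define D where "D a = survive C ((A + a) mod n)" for a
  have B: "B \<in> leaders C" using gap_props(5)[OF A] by (simp add: B_def)
  have g: "1 \<le> g1" "1 \<le> g2" "g1 + g2 \<le> n"
    using gap_props(1)[OF A] gap_props(1)[OF B] two_leaders_gaps(2)[OF A m] by (simp_all add: g1_def g2_def B_def)
  have gn: "gap C A < n" "gap C B < n" using g by (simp_all add: g1_def g2_def)
  have tA: "tidy g1 bA sA" and tB: "tidy g2 bB sB"
    using seg_tidy[OF S A] seg_tidy[OF S B] by (simp_all add: g1_def g2_def bA_def sA_def bB_def sB_def)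
  have in_n: "(A + a) mod n < n" for a using n_pos by simp
  have Beq: "B = (A + g1) mod n" by (simp add: B_def next_ldr_def g1_def)
  have gapD: "gap (D a) = gap C" "next_ldr (D a) = next_ldr C" for a
    using gap_survive[OF S in_n] by (simp_all add: D_def)
  define bc where "bc a = (if g1 \<le> a then a - g1 else a + n - g1)" for a
  have bc: "bc a < n" "(B + bc a) mod n = (A + a) mod n" if "a < n" for a
  proof -
    show "bc a < n" using that g by (auto simp: bc_def)
    have "g1 + bc a = (if g1 \<le> a then a else a + n)" using g by (auto simp: bc_def)
    moreover have "(B + bc a) mod n = (A + (g1 + bc a)) mod n" by (simp add: Beq mod_simps add.assoc)
    ultimately show "(B + bc a) mod n = (A + a) mod n" by (simp add: add.assoc[symmetric])
  qed
  define eA where "eA a = arc_code g1 a" for a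
  define eB where "eB a = arc_code g2 (bc a)" for a
  have segA: "seg_b (D a) A k = seg_bullet g1 (eA a) bA sA k \<and> seg_s (D a) A k = seg_signal g1 (eA a) bA sA k"
    if "a < n" "k < g1" for a k
    using seg_survive[OF S A gn(1) that(1)] that(2) by (simp add: D_def g1_def bA_def sA_def eA_def)
  have segB: "seg_b (D a) B k = seg_bullet g2 (eB a) bB sB k \<and> seg_s (D a) B k = seg_signal g2 (eB a) bB sB k"
    if "a < n" "k < g2" for a k
    using seg_survive[OF S B gn(2) bc(1)[OF that(1)]] that bc(2)[OF that(1)] by (simp add: D_def g2_def bB_def sB_def eB_def)
  define X where "X = fire_time g1 bA sA"
  define Y where "Y = fire_time g2 bB sB"
  define X' where "X' a = fire_time g1 (seg_b (D a) A) (seg_s (D a) A)" for a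
  define Y' where "Y' a = fire_time g2 (seg_b (D a) B) (seg_s (D a) B)" for a
  define d' where "d' a = dirt g1 (seg_b (D a) A) (seg_s (D a) A)" for a
  define ar' where "ar' a = armed g1 (seg_b (D a) A) (seg_s (D a) A)" for a
  have new: "X' a = fire_time g1 (seg_bullet g1 (eA a) bA sA) (seg_signal g1 (eA a) bA sA)"
    "d' a = dirt g1 (seg_bullet g1 (eA a) bA sA) (seg_signal g1 (eA a) bA sA)"
    "ar' a = armed g1 (seg_bullet g1 (eA a) bA sA) (seg_signal g1 (eA a) bA sA)"
    "Y' a = fire_time g2 (seg_bullet g2 (eB a) bB sB) (seg_signal g2 (eB a) bB sB)" if "a < n" for a
    unfolding X'_def Y'_def d'_def ar'_def
    by (rule segment_cong, rule segA[OF that], assumption)+ (rule segment_cong, rule segB[OF that], assumption)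
  have eA0: "eA a = 0 \<longleftrightarrow> a = 0" and eAg: "eA a = g1 \<longleftrightarrow> a = n - 1" if "a < n" for a
    using g that by (auto simp: eA_def arc_code_def)
  have eAh: "eA a = h \<longleftrightarrow> a = h" if "a < n" "h < g1" for a h
    using that by (auto simp: eA_def arc_code_def)
  have eB0: "eB a = 0 \<longleftrightarrow> a = g1" and eBg: "eB a = g2 \<longleftrightarrow> a = g1 - 1" if "a < n" for a
    using g that by (auto simp: eB_def arc_code_def bc_def)
  have eBh: "eB a = h \<longleftrightarrow> a = g1 + h" if "a < n" "h < g2" for a h
    using that g by (auto simp: eB_def arc_code_def bc_def)
  have B0: "ag C B 0 = C B" using B by (simp add: leaders_def ag_0)
  have Y1: "Y = 1 \<longleftrightarrow> signal (C B) = 1"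
    using fire_time_1[OF tB] B0 by (simp add: Y_def sB_def seg_s_def)
  have LB: "leader (C B) = 1" using B by (simp add: leaders_def)
  interpret du: duel n g1 g2 X Y "shield (C B)" "dirt g1 bA sA" "next_hop g1 bA sA" "g1 + next_hop g2 bB sB"
    "armed g1 bA sA" X' Y' "\<lambda>a. shield (D a B)" d' ar'
    "\<lambda>a. killed C ((A + a) mod n) \<and> Suc ((A + a) mod n) mod n = next_ldr C A"
  proof (unfold_locales, goal_cases)
    case 1 show ?case by (rule g) next
    case 2 show ?case by (rule g) next
    case 3 show ?case by (rule g) next
    case 4 show ?case unfolding X_def by (rule fire_time_bounds[OF g(1)]) next
    case 5 show ?case unfolding X_def by (rule fire_time_bounds[OF g(1)]) next
    case 6 show ?case unfolding Y_def by (rule fire_time_bounds[OF g(2)]) next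
    case 7 show ?case unfolding Y_def by (rule fire_time_bounds[OF g(2)]) next
    case 8 show ?case by (rule next_hop_less[OF tA]) next
    case 9 show ?case by simp next
    case 10 show ?case using next_hop_less[OF tB] by simp next
    case 11 then show ?case unfolding X_def by (rule armed_fire_time) next
    case 12 then show ?case unfolding X_def by (rule armed_next_hop) next
    case (13 a)
    show ?case unfolding new(1)[OF 13] fire_time_step[OF tA] X_def[symmetric]
      by (simp only: eA0[OF 13] eAg[OF 13] eAh[OF 13 next_hop_less[OF tA]])
  next
    case (14 a)
    show ?case unfolding new(4)[OF 14] fire_time_step[OF tB] Y_def[symmetric]
      by (simp only: eB0[OF 14] eBg[OF 14] eBh[OF 14 next_hop_less[OF tB]])
  next
    case (15 a)
    define i where "i = (A + a) mod n"
    have i: "i < n" using n_pos by (simp add: i_def)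
    have si: "Suc i mod n = (A + Suc a) mod n" by (simp add: i_def mod_simps)
    consider "a = g1" | "a = g1 - 1" "a \<noteq> g1" | "a \<noteq> g1" "a \<noteq> g1 - 1" by blast
    then show ?case
    proof cases
      case 1
      then have "i = B" by (simp add: i_def Beq)
      then have "shield (D a B) = (if fires (C B) then 1 else shield (C B))"
        using survive_initiator(3)[OF S i] by (simp add: D_def i_def)
      then show ?thesis using 1 Y1 LB by (simp add: fires_def)
    next
      case 2
      then have "Suc i mod n = B" using g by (simp add: si Beq)
      then have "shield (D a B) = (if signal (C B) = 1 then 0 else shield (C B))"
        using survive_responder(3)[OF S i] LB by (simp add: D_def i_def)
      then show ?thesis using 2 Y1 by simp
    next
      case 3
      have "B \<noteq> i" using 3 15 g offset_eq_iff[of g1 a A] by (simp add: Beq i_def)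
      moreover have "B \<noteq> Suc i mod n"
      proof
        assume "B = Suc i mod n"
        then have "(A + g1) mod n = (A + Suc a mod n) mod n" by (simp add: Beq si mod_simps)
        then have "g1 = Suc a mod n" using offset_eq_iff[of g1 "Suc a mod n" A] g n_pos by simp
        then show False using 3 15 g by (cases "Suc a = n") auto
      qed
      ultimately have "D a B = C B" by (simp add: D_def i_def[symmetric] survive_other)
      then show ?thesis using 3 by simp
    qed
  next
    case 16 show ?case by (rule dirt_le_2) next
    case 17 then show ?case unfolding X_def by (rule dirt_1_time) next
    case (18 a) show ?case unfolding new(2)[OF 18] by (rule dirt_step(1)[OF tA]) next
    case (19 a)
    then show ?case unfolding new(2)[OF 19(1)] X_def
      by (intro dirt_step(2)[OF tA]) (simp_all add: eA0 eAg)
  next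
    case (20 a)
    show ?case unfolding new(3)[OF 20(1)] dirt_0_step(2)[OF tA 20(2)] X_def[symmetric]
      by (simp only: eA0[OF 20(1)] eAh[OF 20(1) next_hop_less[OF tA]])
  next
    case 21
    define a where "a = g1 - 1"
    have a: "Suc a = g1" "a < g1" using g by (auto simp: a_def)
    have s: "seg_shot bA sA a = 2"
      using 21(2) armed_shot[OF tA] fire_time_1[OF tA] by (auto simp: a_def X_def seg_shot_def)
    have "\<not> fires (ag C A a)" if "a \<noteq> 0"
      using gap_props(4)[OF A, of a] that a by (simp add: g1_def fires_def)
    moreover have "fires (ag C A a) \<longleftrightarrow> sA 0 = 1" if "a = 0"
      using that A by (simp add: fires_def sA_def seg_s_def leaders_def ag_0)
    ultimately have "shot (ag C A a) = 2"
      using s by (cases "a = 0") (auto simp: seg_shot_def shot_def bA_def seg_b_def split: if_splits)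
    then have "kills (ag C A a) (C B)" using 21(1) LB Y1 by (auto simp: kills_def)
    moreover have "Suc ((A + a) mod n) mod n = B" unfolding Beq a(1)[symmetric] by (simp add: mod_simps)
    moreover have "C ((A + a) mod n) = ag C A a" by (simp add: ag_def)
    ultimately show ?case by (simp add: killed_def a_def B_def)
  qed
  have eq: "psi (D a) A = duel_pot g1 g2 (d' a) (ar' a) (X' a) (shield (D a B)) (Y' a)" for a
    unfolding psi_def Let_def gapD B_def[symmetric] g1_def[symmetric] g2_def[symmetric]
    by (simp add: d'_def ar'_def X'_def Y'_def)
  have eq0: "psi C A = duel_pot g1 g2 (dirt g1 bA sA) (armed g1 bA sA) X (shield (C B)) Y"
    unfolding psi_def Let_def B_def[symmetric] g1_def[symmetric] g2_def[symmetric]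
    by (simp add: X_def Y_def bA_def sA_def bB_def sB_def)
  have "(\<Sum>i<n. psi (survive C i) A - psi C A - (if killed C i \<and> Suc i mod n = next_ldr C A then 1 else 0))
    = (\<Sum>a<n. psi (D a) A - psi C A - (if killed C ((A + a) mod n) \<and> Suc ((A + a) mod n) mod n = next_ldr C A then 1 else 0))"
    unfolding D_def by (rule sum_offset[symmetric])
  also have "\<dots> = (\<Sum>a<n. du.pot_change a)"
    by (rule sum.cong) (simp_all add: du.pot_change_def eq eq0)
  also have "\<dots> \<le> - 1 / (1200 * (real g1 + real g2))" by (rule du.duel_drift)
  finally show ?thesis by (simp add: g1_def g2_def B_def)
qed

lemma psi_cong:
  assumes A: "A \<in> leaders D"
  defines "B \<equiv> next_ldr D A"
  defines "m \<equiv> gap D A + gap D B"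
  assumes L: "\<And>k. 1 \<le> k \<Longrightarrow> k \<le> m \<Longrightarrow> leader (ag C A k) = leader (ag D A k)"
    and bs: "\<And>k. k < m \<Longrightarrow> bullet (ag C A k) = bullet (ag D A k) \<and> signal (ag C A k) = signal (ag D A k)"
    and sh: "shield (C B) = shield (D B)"
  shows "psi C A = psi D A"
proof -
  define g1 where "g1 = gap D A"
  define g2 where "g2 = gap D B"
  have B: "B \<in> leaders D" using gap_props(5)[OF A] by (simp add: B_def)
  have m: "m = g1 + g2" by (simp add: m_def g1_def g2_def)
  have Beq: "B = (A + g1) mod n" by (simp add: B_def next_ldr_def g1_def)
  have agB: "ag C' B k = ag C' A (g1 + k)" for C' k by (simp add: Beq ag_add)
  have g1: "gap C A = g1"
    using gap_props(1,3,4)[OF A] L by (intro gapI) (auto simp: m g1_def[symmetric])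
  then have nB: "next_ldr C A = B" by (simp add: next_ldr_def Beq)
  have g2: "gap C B = g2"
    using gap_props(1,3,4)[OF B] L gap_props(1)[OF A]
    by (intro gapI) (auto simp: m g2_def[symmetric] agB g1_def[symmetric])
  have sA: "seg_b C A k = seg_b D A k \<and> seg_s C A k = seg_s D A k" if "k < g1" for k
    using bs[of k] that by (simp add: m seg_b_def seg_s_def)
  have sB: "seg_b C B k = seg_b D B k \<and> seg_s C B k = seg_s D B k" if "k < g2" for k
    using bs[of "g1 + k"] that by (simp add: m seg_b_def seg_s_def agB)
  show ?thesis
    unfolding psi_def Let_def nB g1 g2 B_def[symmetric] g1_def[symmetric] g2_def[symmetric] sh
    using segment_cong[of g1, OF sA] segment_cong[of g2, OF sB] by simp
qed

lemma psi_sum_step: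
  assumes S: "settled C" and i: "i < n"
  shows "psi_sum (step_arc N n C i) \<le> psi_sum (survive C i) - (if killed C i then 1 else 0)"
proof (cases "killed C i")
  case False
  then have "survive C i = step_arc N n C i" by (simp add: survive_def killed_def Let_def)
  then show ?thesis using False by simp
next
  case True
  define C' where "C' = step_arc N n C i"
  define D where "D = survive C i"
  define j where "j = Suc i mod n"
  have v: "valid C" using S by (simp add: settled_def calm_def)
  have jn: "j < n" "j \<noteq> i" using Suc_lt Suc_mod_neq[OF i] by (auto simp: j_def)
  have D: "D = C'(i := (C' i)\<lparr>signal := 1\<rparr>, j := (C' j)\<lparr>leader := 1\<rparr>)"
    using True by (simp add: D_def C'_def survive_def killed_def j_def Let_def)
  have k: "kills (C i) (C j)" using True by (simp add: killed_def j_def)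
  then have "leader (C j) = 1" by (simp add: kills_def)
  then have "leader (C' j) = 0"
    using trans_leader(1)[OF valid_Q[OF v i] valid_Q[OF v jn(1)] N_ge_2] k
    by (simp add: C'_def j_def step_arc_responder)
  then have lead: "leaders C' = leaders D - {j}" and jD: "j \<in> leaders D"
    using jn by (auto simp: leaders_def D)
  have same: "psi C' A = psi D A"
    if A: "A \<in> leaders D" and n1: "next_ldr D A \<noteq> j" and n2: "next_ldr D (next_ldr D A) \<noteq> j" for A
  proof (rule psi_cong[OF A])
    let ?B = "next_ldr D A"
    let ?m = "gap D A + gap D ?B"
    have B: "?B \<in> leaders D" by (rule gap_props(5)[OF A])
    have agB: "ag D ?B k = ag D A (gap D A + k)" for k by (simp add: next_ldr_def ag_add)
    have nj: "(A + k) mod n \<noteq> j" if k: "1 \<le> k" "k \<le> ?m" for k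
    proof
      assume e: "(A + k) mod n = j"
      then have "leader (ag D A k) = 1" using jD by (simp add: ag_def leaders_def)
      consider "k < gap D A" | "k = gap D A" | "gap D A < k" "k < ?m" | "k = ?m" using k by linarith
      then show False
      proof cases
        case 1
        then show False using gap_props(4)[OF A k(1)] \<open>leader (ag D A k) = 1\<close> by simp
      next
        case 2
        then show False using e n1 by (simp add: next_ldr_def)
      next
        case 3
        then have "leader (ag D ?B (k - gap D A)) = 1" using \<open>leader (ag D A k) = 1\<close> by (simp add: agB)
        moreover have "1 \<le> k - gap D A" "k - gap D A < gap D ?B" using 3 by linarith+
        ultimately show False using gap_props(4)[OF B] by blast
      next
        case 4
        then have "next_ldr D ?B = j"
          using e by (simp add: next_ldr_def[of D ?B]) (simp add: next_ldr_def mod_simps add.assoc)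
        then show False using n2 by simp
      qed
    qed
    show "leader (ag C' A k) = leader (ag D A k)" if "1 \<le> k" "k \<le> ?m" for k
      using nj[OF that] by (simp add: ag_def D)
    show "bullet (ag C' A k) = bullet (ag D A k) \<and> signal (ag C' A k) = signal (ag D A k)" if "k < ?m" for k
    proof -
      have "(A + k) mod n \<noteq> i"
      proof
        assume "(A + k) mod n = i"
        then have "(A + Suc k) mod n = j" by (metis add_Suc_right mod_Suc_eq j_def)
        then show False using nj[of "Suc k"] that by simp
      qed
      then show ?thesis by (simp add: ag_def D)
    qed
    show "shield (C' ?B) = shield (D ?B)" by (simp add: D)
  qed
  let ?x = "\<lambda>A. if next_ldr D A = j then 1 else 0 :: real"
  have one: "(\<Sum>A\<in>leaders D. ?x A) \<le> 1"
  proof -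
    have "(\<Sum>A\<in>leaders D. ?x A) = real (card {A \<in> leaders D. next_ldr D A = j})"
      using finite_leaders by (simp add: sum.If_cases Int_def)
    also have "card {A \<in> leaders D. next_ldr D A = j} \<le> 1" by (rule card_prev_leader)
    finally show ?thesis by simp
  qed
  have two: "(\<Sum>A\<in>leaders D. ?x (next_ldr D A)) \<le> 1"
  proof -
    have "(\<Sum>A\<in>leaders D. ?x (next_ldr D A)) = (\<Sum>B\<in>next_ldr D ` leaders D. ?x B)"
      by (simp add: sum.reindex[OF inj_next_ldr])
    also have "\<dots> \<le> (\<Sum>B\<in>leaders D. ?x B)"
      by (rule sum_mono2) (use finite_leaders gap_props(5) in auto)
    finally show ?thesis using one by simp
  qed
  have pt: "psi C' A \<le> psi D A + 4 * ?x A + 4 * ?x (next_ldr D A)" if "A \<in> leaders D - {j}" for A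
  proof (cases "next_ldr D A = j \<or> next_ldr D (next_ldr D A) = j")
    case True
    have "psi C' A \<le> 13" "9 \<le> psi D A" using psi_bounds[of A] that lead by auto
    then show ?thesis using True by auto
  next
    case False
    then show ?thesis using same[of A] that by simp
  qed
  have "psi_sum C' \<le> (\<Sum>A\<in>leaders D - {j}. psi D A + 4 * ?x A + 4 * ?x (next_ldr D A))"
    unfolding psi_sum_def lead by (rule sum_mono) (rule pt)
  also have "\<dots> \<le> (\<Sum>A\<in>leaders D. psi D A + 4 * ?x A + 4 * ?x (next_ldr D A)) - psi D j"
  proof -
    have "(\<Sum>A\<in>leaders D. psi D A + 4 * ?x A + 4 * ?x (next_ldr D A)) =
      psi D j + 4 * ?x j + 4 * ?x (next_ldr D j) + (\<Sum>A\<in>leaders D - {j}. psi D A + 4 * ?x A + 4 * ?x (next_ldr D A))"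
      by (rule sum.remove[OF finite_leaders jD])
    moreover have "0 \<le> ?x j" "0 \<le> ?x (next_ldr D j)" by auto
    ultimately show ?thesis by linarith
  qed
  also have "\<dots> = psi_sum D + 4 * (\<Sum>A\<in>leaders D. ?x A) + 4 * (\<Sum>A\<in>leaders D. ?x (next_ldr D A)) - psi D j"
    by (simp add: psi_sum_def sum.distrib sum_distrib_left)
  also have "\<dots> \<le> psi_sum D - 1" using one two psi_bounds(1)[OF jD] by linarith
  finally show ?thesis using True by (simp add: C'_def D_def)
qed

lemma psi_sum_drift:
  assumes S: "settled C" and m: "2 \<le> card (leaders C)"
  shows "(\<Sum>i<n. psi_sum (step_arc N n C i)) \<le> real n * psi_sum C - (psi_sum C)\<^sup>2 / (405600 * real n)"
proof -
  let ?L = "leaders C"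
  define c where "c = real (card ?L)"
  define t where "t = c / (2 * real n)"
  let ?g = "\<lambda>A. real (gap C A) + real (gap C (next_ldr C A))"
  let ?k = "\<lambda>i A. if killed C i \<and> Suc i mod n = next_ldr C A then 1 else 0 :: real"
  have "psi_sum (step_arc N n C i) \<le> (\<Sum>A\<in>?L. psi (survive C i) A - ?k i A)" if i: "i < n" for i
  proof -
    have "(\<Sum>A\<in>?L. ?k i A) \<le> (if killed C i then 1 else 0)"
    proof (cases "killed C i")
      case True
      have "(\<Sum>A\<in>?L. ?k i A) = real (card {A \<in> ?L. next_ldr C A = Suc i mod n})"
        using True finite_leaders by (simp add: sum.If_cases Int_def eq_commute)
      also have "card {A \<in> ?L. next_ldr C A = Suc i mod n} \<le> 1" by (rule card_prev_leader)
      finally show ?thesis using True by simp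
    qed simp
    moreover have "psi_sum (survive C i) = (\<Sum>A\<in>?L. psi (survive C i) A)"
      by (simp add: psi_sum_def gap_survive[OF S i])
    ultimately show ?thesis using psi_sum_step[OF S i] by (simp add: sum_subtractf)
  qed
  then have "(\<Sum>i<n. psi_sum (step_arc N n C i)) \<le> (\<Sum>i<n. \<Sum>A\<in>?L. psi (survive C i) A - ?k i A)"
    by (intro sum_mono) simp
  also have "\<dots> = (\<Sum>A\<in>?L. \<Sum>i<n. psi (survive C i) A - ?k i A)" by (rule sum.swap)
  also have "\<dots> = (\<Sum>A\<in>?L. real n * psi C A + (\<Sum>i<n. psi (survive C i) A - psi C A - ?k i A))"
    by (simp add: sum_subtractf)
  also have "\<dots> \<le> (\<Sum>A\<in>?L. real n * psi C A + - 1 / (1200 * ?g A))"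
    by (intro sum_mono add_left_mono psi_drift[OF S _ m])
  also have "\<dots> \<le> (\<Sum>A\<in>?L. real n * psi C A - (2 * t - t\<^sup>2 * ?g A) / 1200)"
  proof (rule sum_mono)
    fix A assume A: "A \<in> ?L"
    have pos: "0 < ?g A" using gap_props(1)[OF A] by simp
    have "0 \<le> (1 - t * ?g A)\<^sup>2 / ?g A" using pos by simp
    also have "\<dots> = 1 / ?g A - (2 * t - t\<^sup>2 * ?g A)" using pos by (simp add: field_simps power2_eq_square)
    finally have "2 * t - t\<^sup>2 * ?g A \<le> 1 / ?g A" by simp
    then have "(2 * t - t\<^sup>2 * ?g A) / 1200 \<le> 1 / ?g A / 1200" by (rule divide_right_mono) simp
    then show "real n * psi C A + - 1 / (1200 * ?g A) \<le> real n * psi C A - (2 * t - t\<^sup>2 * ?g A) / 1200"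
      by (simp add: mult.commute)
  qed
  also have "\<dots> = real n * psi_sum C - (2 * t * c - t\<^sup>2 * (\<Sum>A\<in>?L. ?g A)) / 1200"
    by (simp add: psi_sum_def c_def sum_subtractf sum_distrib_left sum_divide_distrib[symmetric] diff_divide_distrib)
  also have "\<dots> \<le> real n * psi_sum C - (2 * t * c - t\<^sup>2 * (2 * real n)) / 1200"
  proof -
    have "(\<Sum>A\<in>?L. ?g A) = real (\<Sum>A\<in>?L. gap C A) + real (\<Sum>A\<in>?L. gap C (next_ldr C A))"
      by (simp add: sum.distrib)
    also have "\<dots> \<le> real n + real n"
      using sum_gap_le[of C] sum_next_gap_le[of C] by (intro add_mono) (simp_all only: of_nat_le_iff)
    finally have "t\<^sup>2 * (\<Sum>A\<in>?L. ?g A) \<le> t\<^sup>2 * (2 * real n)" by (intro mult_left_mono) auto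
    then show ?thesis by argo
  qed
  also have "2 * t * c - t\<^sup>2 * (2 * real n) = c\<^sup>2 / (2 * real n)"
    using n_pos by (simp add: t_def field_simps power2_eq_square)
  also have "real n * psi_sum C - c\<^sup>2 / (2 * real n) / 1200 \<le> real n * psi_sum C - (psi_sum C)\<^sup>2 / (405600 * real n)"
  proof -
    have "0 \<le> 9 * real (card ?L)" by simp
    then have "0 \<le> psi_sum C" using psi_sum_bounds(1)[of C] by linarith
    then have "(psi_sum C)\<^sup>2 \<le> (13 * c)\<^sup>2" using psi_sum_bounds(2)[of C] by (intro power_mono) (simp_all add: c_def)
    then have "(psi_sum C)\<^sup>2 / (405600 * real n) \<le> (13 * c)\<^sup>2 / (405600 * real n)"
      by (intro divide_right_mono) auto
    also have "\<dots> = c\<^sup>2 / (2 * real n) / 1200" by (simp add: power_mult_distrib)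
    finally show ?thesis by simp
  qed
  finally show ?thesis .
qed

text \<open>With \<open>m\<close> leaders, \<open>psi_sum\<close> is of order \<open>m\<close> and drops at rate \<open>(m / n)\<^sup>2\<close>; hence its reciprocal grows at
  constant rate, which avoids the logarithmic loss of waiting for the kills one by one.\<close>

definition leader_pot :: "config \<Rightarrow> real" where
  "leader_pot C = 405600 * (real n)\<^sup>2 * (1 - 1 / psi_sum C)"

lemma psi_sum_ge_1:
  assumes "settled C" shows "1 \<le> psi_sum C"
proof -
  have "leaders C \<noteq> {}" using settled_leader[OF assms] by (auto simp: leaders_def)
  then have "1 \<le> card (leaders C)" using finite_leaders by (simp add: Suc_leI card_gt_0_iff)
  then have "1 \<le> real (card (leaders C))" by simp
  then show ?thesis using psi_sum_bounds(1)[of C] by linarith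
qed

lemma leader_pot_bounds:
  assumes "settled C" shows "0 \<le> leader_pot C" "leader_pot C \<le> 405600 * (real n)\<^sup>2"
  using psi_sum_ge_1[OF assms] by (simp_all add: leader_pot_def mult_left_le)

lemma leader_pot_drift:
  assumes S: "settled C" and m: "2 \<le> card (leaders C)"
  shows "(\<Sum>i<n. leader_pot (step_arc N n C i)) \<le> real n * (leader_pot C - 1)"
proof -
  define K :: real where "K = 405600 * (real n)\<^sup>2"
  define P where "P = psi_sum C"
  define Pi where "Pi i = psi_sum (step_arc N n C i)" for i
  have P: "1 \<le> P" using psi_sum_ge_1[OF S] by (simp add: P_def)
  have K: "0 < K" using n_pos by (simp add: K_def)
  have "1 - 1 / Pi i \<le> 1 - 1 / P + (Pi i - P) / P\<^sup>2" if "i < n" for i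
  proof -
    have p: "1 \<le> Pi i" using psi_sum_ge_1[OF settled_step[OF S that]] by (simp add: Pi_def)
    have "0 \<le> (Pi i - P)\<^sup>2 / (Pi i * P\<^sup>2)" using p by simp
    also have "\<dots> = 1 / Pi i - 1 / P + (Pi i - P) / P\<^sup>2"
      using p P by (simp add: field_simps power2_eq_square)
    finally show ?thesis by linarith
  qed
  then have "(\<Sum>i<n. 1 - 1 / Pi i) \<le> (\<Sum>i<n. 1 - 1 / P + (Pi i - P) / P\<^sup>2)" by (intro sum_mono) simp
  also have "\<dots> = real n * (1 - 1 / P) + ((\<Sum>i<n. Pi i) - real n * P) / P\<^sup>2"
    by (simp add: sum.distrib sum_subtractf sum_divide_distrib[symmetric])
  also have "\<dots> \<le> real n * (1 - 1 / P) + - (P\<^sup>2 / (405600 * real n)) / P\<^sup>2"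
    using psi_sum_drift[OF S m] by (intro add_left_mono divide_right_mono) (simp_all add: Pi_def P_def)
  also have "- (P\<^sup>2 / (405600 * real n)) / P\<^sup>2 = - real n / K"
    using P n_pos by (simp add: K_def field_simps power2_eq_square)
  finally have "K * (\<Sum>i<n. 1 - 1 / Pi i) \<le> K * (real n * (1 - 1 / P) + - real n / K)"
    using K by (intro mult_left_mono) auto
  also have "\<dots> = real n * (K * (1 - 1 / P) - 1)" using K by (simp add: algebra_simps)
  finally show ?thesis by (simp add: leader_pot_def K_def P_def Pi_def sum_distrib_left)
qed

lemma unsafe_two_leaders:
  assumes S: "settled C" and u: "\<not> safe N n C"
  shows "2 \<le> card (leaders C)"
proof (rule ccontr)
  assume "\<not> 2 \<le> card (leaders C)"
  moreover have "leaders C \<noteq> {}" using settled_leader[OF S] by (auto simp: leaders_def)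
  then have "card (leaders C) \<noteq> 0" using finite_leaders by simp
  ultimately have "card (leaders C) = 1" by linarith
  then obtain A where "leaders C = {A}" by (auto simp: card_1_singleton_iff)
  then have "\<exists>!q. q < n \<and> leader (C q) = 1" unfolding leaders_def by (metis (mono_tags, lifting) mem_Collect_eq singleton_iff)
  then show False using settled_unique_safe[OF S] u by simp
qed

section \<open>The Lyapunov function\<close>

text \<open>In an earlier phase the maxima of the later potentials are added; since the phases are closed under
  steps, entering the next phase never increases the sum.\<close>

definition pot_max2 :: real where "pot_max2 = 405600 * (real n)\<^sup>2"

definition pot_max1 :: real where "pot_max1 = 10 / 3 * real n * (2 * real N + 4)"

definition lyapunov :: "config \<Rightarrow> real" where
  "lyapunov C =
     (if settled C then leader_pot C
      else if calm C then 10 / 3 * real n * log_pot (harm_pot C) + pot_max2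
      else 2 * real n * log_pot (stray_pot C) + pot_max1 + pot_max2)"

lemma lyapunov_settled: "settled C \<Longrightarrow> 0 \<le> lyapunov C \<and> lyapunov C \<le> pot_max2"
  using leader_pot_bounds by (simp add: lyapunov_def pot_max2_def)

lemma lyapunov_calm:
  assumes "calm C"
  shows "lyapunov C \<le> 10 / 3 * real n * log_pot (harm_pot C) + pot_max2" (is ?A) "0 \<le> lyapunov C" (is ?B)
    "10 / 3 * real n * log_pot (harm_pot C) + pot_max2 \<le> pot_max1 + pot_max2"
proof -
  have l: "0 \<le> log_pot (harm_pot C)" using harm_pot_cases by (rule log_pot_nonneg)
  have p: "0 \<le> 10 / 3 * real n * log_pot (harm_pot C)" "0 \<le> pot_max2" using l by (simp_all add: pot_max2_def)
  have "?A \<and> ?B"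
  proof (cases "settled C")
    case True
    then show ?thesis using lyapunov_settled[of C] p by linarith
  next
    case False
    then have "lyapunov C = 10 / 3 * real n * log_pot (harm_pot C) + pot_max2" using assms by (simp add: lyapunov_def)
    then show ?thesis using p by linarith
  qed
  then show ?A ?B by auto
  have "log_pot (harm_pot C) \<le> 1 + real (2 * N + 3)" using harm_pot_cases harm_pot_le by (rule log_pot_le)
  then have "10 / 3 * real n * log_pot (harm_pot C) \<le> 10 / 3 * real n * (2 * real N + 4)"
    by (intro mult_left_mono) auto
  then show "10 / 3 * real n * log_pot (harm_pot C) + pot_max2 \<le> pot_max1 + pot_max2" by (simp add: pot_max1_def)
qed

lemma lyapunov_any:
  shows "lyapunov C \<le> 2 * real n * log_pot (stray_pot C) + pot_max1 + pot_max2" (is ?A) "0 \<le> lyapunov C" (is ?B)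
proof -
  have l: "0 \<le> log_pot (stray_pot C)" using stray_pot_cases by (rule log_pot_nonneg)
  have p: "0 \<le> pot_max1" "0 \<le> pot_max2" by (simp_all add: pot_max1_def pot_max2_def)
  have l2: "0 \<le> 2 * real n * log_pot (stray_pot C)" using l by simp
  have "?A \<and> ?B"
  proof (cases "calm C")
    case True
    then show ?thesis using lyapunov_calm[OF True] l2 by linarith
  next
    case False
    then have "\<not> settled C" by (auto simp: settled_def)
    then show ?thesis using False l2 p by (simp add: lyapunov_def)
  qed
  then show ?A ?B by auto
qed

lemma lyapunov_drift:
  assumes v: "valid C" and u: "\<not> safe N n C"
  shows "(\<Sum>i<n. lyapunov (step_arc N n C i)) \<le> real n * (lyapunov C - 1)"
proof -
  let ?s = "step_arc N n C"
  consider "settled C" | "calm C" "\<not> settled C" | "\<not> calm C" "\<not> settled C" by (auto simp: settled_def)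
  then show ?thesis
  proof cases
    case 1
    have "(\<Sum>i<n. lyapunov (?s i)) = (\<Sum>i<n. leader_pot (?s i))"
      using settled_step[OF 1] by (intro sum.cong) (auto simp: lyapunov_def)
    then show ?thesis using leader_pot_drift[OF 1 unsafe_two_leaders[OF 1 u]] 1 by (simp add: lyapunov_def)
  next
    case 2
    have W: "1 \<le> harm_pot C" using 2 harm_pot_cases[of C] by (auto simp: settled_def)
    have "(\<Sum>i<n. lyapunov (?s i)) \<le> (\<Sum>i<n. 10 / 3 * real n * log_pot (harm_pot (?s i)) + pot_max2)"
      by (intro sum_mono lyapunov_calm(1) calm_step[OF 2(1)]) simp
    also have "\<dots> = 10 / 3 * real n * (\<Sum>i<n. log_pot (harm_pot (?s i))) + real n * pot_max2"
      by (simp add: sum.distrib sum_distrib_left)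
    also have "\<dots> \<le> 10 / 3 * real n * (real n * log_pot (harm_pot C) - 3 / 10) + real n * pot_max2"
      by (intro add_right_mono mult_left_mono log_pot_drift W harm_pot_cases harm_pot_sum[OF 2(1)]) simp
    also have "\<dots> = real n * (lyapunov C - 1)" using 2 by (simp add: lyapunov_def algebra_simps)
    finally show ?thesis .
  next
    case 3
    have W: "1 \<le> stray_pot C" using 3 v stray_pot_cases[of C] by (auto simp: calm_def)
    have "(\<Sum>i<n. lyapunov (?s i)) \<le> (\<Sum>i<n. 2 * real n * log_pot (stray_pot (?s i)) + pot_max1 + pot_max2)"
      by (intro sum_mono lyapunov_any(1))
    also have "\<dots> = 2 * real n * (\<Sum>i<n. log_pot (stray_pot (?s i))) + real n * (pot_max1 + pot_max2)"
      by (simp add: sum.distrib sum_distrib_left algebra_simps)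
    also have "\<dots> \<le> 2 * real n * (real n * log_pot (stray_pot C) - 1 / 2) + real n * (pot_max1 + pot_max2)"
      by (intro add_right_mono mult_left_mono log_pot_drift W stray_pot_cases stray_pot_sum[OF v]) simp
    also have "\<dots> = real n * (lyapunov C - 1)" using 3 by (simp add: lyapunov_def algebra_simps)
    finally show ?thesis .
  qed
qed

lemma lyapunov_le: "lyapunov C \<le> 405700 * real n * real N"
proof -
  have "log_pot (stray_pot C) \<le> 1 + real (2 * N + 1)" using stray_pot_cases stray_pot_le by (rule log_pot_le)
  then have "2 * real n * log_pot (stray_pot C) \<le> 2 * real n * (2 * real N + 2)" by (intro mult_left_mono) auto
  then have "lyapunov C \<le> 2 * real n * (2 * real N + 2) + pot_max1 + pot_max2"
    using lyapunov_any(1)[of C] by linarith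
  also have "\<dots> \<le> real n * (4 * real N + 4 + 10 / 3 * (2 * real N + 4) + 405600 * real n)"
    by (simp add: pot_max1_def pot_max2_def field_simps power2_eq_square)
  also have "\<dots> \<le> real n * (405700 * real N)"
  proof (rule mult_left_mono)
    have "real n \<le> real N" "2 \<le> real N" using n_le_N N_ge_2 by simp_all
    then show "4 * real N + 4 + 10 / 3 * (2 * real N + 4) + 405600 * real n \<le> 405700 * real N" by argo
  qed simp
  finally show ?thesis by (simp add: ac_simps)
qed

lemma expected_conv_time_bound:
  assumes "valid C"
  shows "expected_conv_time N n C \<le> ennreal (405700 * real n * real N)"
proof -
  have "expected_conv_time N n C \<le> ennreal (lyapunov C)"
    by (rule expected_conv_time_le_Lyapunov[where I = valid])
      (use n_pos valid_step lyapunov_any(2) lyapunov_drift assms in auto)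
  also have "\<dots> \<le> ennreal (405700 * real n * real N)" by (rule ennreal_leI[OF lyapunov_le])
  finally show ?thesis .
qed

end

theorem theorem1:
  shows "\<exists>c1 c2 :: real. \<forall>N::nat. N \<ge> 2 \<longrightarrow>
           real (card (Q N)) \<le> c2 * real N \<and>
           (\<forall>n::nat. 2 \<le> n \<and> n \<le> N \<longrightarrow>
              self_stabilizing_LE N n \<and>
              (\<forall>C. valid_config N n C \<longrightarrow>
                 expected_conv_time N n C \<le> ennreal (c1 * real n * real N)))"
proof -
  have "self_stabilizing_LE N n \<and>
      (\<forall>C. valid_config N n C \<longrightarrow> expected_conv_time N n C \<le> ennreal (405700 * real n * real N))"
    if "2 \<le> n" "n \<le> N" for N n :: nat
  proof -
    interpret ring N n using that by unfold_locales
    have "AE \<omega> in sched n. \<exists>t. safe N n (exec N n C \<omega> t)" if "valid C" for C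
    proof (rule AE_safe_if_expected_conv_time_finite)
      show "expected_conv_time N n C \<noteq> \<infinity>"
        using expected_conv_time_bound[OF that] by (metis ennreal_less_top infinity_ennreal_def leD)
    qed
    then show ?thesis using expected_conv_time_bound by (simp add: self_stabilizing_LE_def)
  qed
  then show ?thesis using card_Q_le by (intro exI[of _ 405700] exI[of _ 48]) auto
qed

end
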